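(* Let $\Sigma$ be a non-degenerate homogeneous hypersurface with isotropy in complex affine four-space. Then for a suitable choice of affine coordinates $(x,y,z,w)$, $\Sigma$ is locally defined near the origin by a power series $$w=F(x,y,z)=2xy+z^2+c(x,y,z)+O(4),$$ where the cubic part $c$ lies in the span of $x^3,\ x^2z,\ x^2y-2xz^2,\ 3xyz-z^3,\ xy^2-2yz^2,\ y^2z,\ y^3$ (i.e. is trace-free with respect to the quadratic form $2xy+z^2$); and if $c\neq0$, the coordinates may be further chosen so that $F$ has one of the forms - I3: $w=2xy+z^2+x^3+O(4)$, - I2: $w=2xy+z^2+x^2z+O(4)$, - I1: $w=2xy+z^2+x^2y-2xz^2+O(4)$, - I0: $w=2xy+z^2+3xyz-z^3+O(4)$. In these four cases the residual affine coordinate freedom preserving the given normal form (origin, tangent plane, affine normal, quadratic and cubic terms) is generated by the scalings $$x\mapsto\lambda^{t-1}x,\quad y\mapsto\lambda^{t+1}y,\quad z\mapsto\lambda^t z,\quad w\mapsto \lambda^{2t}w\qquad(\lambda\in\mathbb{C}^\* )$$ with $t=3,2,1,0$ respectively, together with, in case I3, the transformations $$(x,y,z,w)\mapsto\bigl(x,\ -\tfrac{t^2}{2}x+y-tz,\ tx+z,\ w\bigr)\qquad(t\in\mathbb{C}),$$ and, in case I0, the swap $x\leftrightarrow y$.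
   Context: Complex affine four-space with coordinates $(x,y,z,w)$. A hypersurface is homogeneous if it is (an open subset of, after analytic continuation) an orbit of a Lie subgroup of the affine group; non-degenerate means its graph function over the tangent plane has non-degenerate Hessian; "with isotropy" means the stabiliser of a point in its affine symmetry group has positive dimension. $O(4)$ denotes terms of total degree at least $4$. The coordinates are chosen so that $\{w=0\}$ is the tangent plane at the origin and the $w$-axis is the affine normal. *)

theory Defs
  imports "HOL-Analysis.Analysis"
begin

text \<open>Points of complex affine four-space are vectors p :: complex^4 with coordinates
  x = p$1, y = p$2, z = p$3, w = p$4.  Points of the coordinate hyperplane are u :: complex^3
  with x = u$1, y = u$2, z = u$3.\<close>

definition lift :: "complex^3 \<Rightarrow> complex \<Rightarrow> complex^4" where
  "lift u w = (\<chi> i. if i = 1 then u$1 else if i = 2 then u$2 else if i = 3 then u$3 else w)"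

definition proj3 :: "complex^4 \<Rightarrow> complex^3" where
  "proj3 p = (\<chi> j. if j = 1 then p$1 else if j = 2 then p$2 else p$3)"

definition wc :: "complex^4 \<Rightarrow> complex" where
  "wc p = p$4"

definition cholo :: "(complex^3) set \<Rightarrow> (complex^3 \<Rightarrow> complex) \<Rightarrow> bool" where
  "cholo U G \<longleftrightarrow> open U \<and>
     (\<forall>u\<in>U. \<exists>D. (G has_derivative D) (at u) \<and> (\<forall>c v. D (c *s v) = c * D v))"

definition graph_chart ::
  "(complex^4) set \<Rightarrow> complex^4^4 \<Rightarrow> complex^4 \<Rightarrow> (complex^3) set \<Rightarrow> (complex^3 \<Rightarrow> complex)
     \<Rightarrow> (complex^4) set \<Rightarrow> bool" where
  "graph_chart S L b U G V \<longleftrightarrow> invertible L \<and> open V \<and> cholo U G \<and>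
     S \<inter> V = (\<lambda>u. L *v lift u (G u) + b) ` U \<inter> V"

definition hypersurface :: "(complex^4) set \<Rightarrow> bool" where
  "hypersurface S \<longleftrightarrow> (\<forall>p\<in>S. \<exists>L b U G V. graph_chart S L b U G V \<and> p \<in> V)"

definition qform :: "complex^3^3 \<Rightarrow> complex^3 \<Rightarrow> complex" where
  "qform h u = (\<Sum>i\<in>UNIV. \<Sum>j\<in>UNIV. h$i$j * u$i * u$j)"

text \<open>Non-degenerate: at every point, in suitable affine coordinates centred there with the
  tangent plane as w = 0, the graph function is G(u) = Hessian quadratic form + o(|u|^2),
  with non-degenerate (symmetric) Hessian.\<close>
definition nondegenerate :: "(complex^4) set \<Rightarrow> bool" where
  "nondegenerate S \<longleftrightarrow> (\<forall>p\<in>S. \<exists>L b U G V h.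
     graph_chart S L b U G V \<and> p \<in> V \<and> 0 \<in> U \<and> p = L *v lift 0 (G 0) + b \<and>
     transpose h = h \<and> det h \<noteq> 0 \<and>
     (\<forall>e>0. \<exists>d>0. \<forall>u. norm u < d \<longrightarrow> norm (G u - qform h u) \<le> e * norm u ^ 2))"

definition tangent :: "(complex^4) set \<Rightarrow> complex^4 \<Rightarrow> complex^4 \<Rightarrow> bool" where
  "tangent S p v \<longleftrightarrow> (\<exists>L b U G V u0 D k. graph_chart S L b U G V \<and> p \<in> V \<and> u0 \<in> U \<and>
     p = L *v lift u0 (G u0) + b \<and> (G has_derivative D) (at u0) \<and> v = L *v lift k (D k))"

text \<open>Infinitesimal affine symmetries: affine vector fields q \<mapsto> M q + c tangent to S
  (the Lie algebra of the affine symmetry group of S).\<close>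
definition aff_sym :: "(complex^4) set \<Rightarrow> ((complex^4^4) \<times> (complex^4)) set" where
  "aff_sym S = {(M, c). \<forall>q\<in>S. tangent S q (M *v q + c)}"

definition homogeneous :: "(complex^4) set \<Rightarrow> bool" where
  "homogeneous S \<longleftrightarrow> (\<forall>p\<in>S. \<forall>v. tangent S p v \<longrightarrow> (\<exists>(M, c)\<in>aff_sym S. M *v p + c = v))"

definition has_isotropy :: "(complex^4) set \<Rightarrow> bool" where
  "has_isotropy S \<longleftrightarrow> (\<exists>p\<in>S. \<exists>(M, c)\<in>aff_sym S. (M, c) \<noteq> (0, 0) \<and> M *v p + c = 0)"

definition Q0 :: "complex^3 \<Rightarrow> complex" where
  "Q0 u = 2 * u$1 * u$2 + (u$3)^2"

text \<open>Cubic forms trace-free w.r.t. 2xy + z^2.\<close>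
definition tracefree_cubic :: "(complex^3 \<Rightarrow> complex) \<Rightarrow> bool" where
  "tracefree_cubic C \<longleftrightarrow> (\<exists>a1 a2 a3 a4 a5 a6 a7. \<forall>u.
     (let x = u$1; y = u$2; z = u$3 in
      C u = a1 * x^3 + a2 * (x^2 * z) + a3 * (x^2 * y - 2 * x * z^2) + a4 * (3 * x * y * z - z^3)
          + a5 * (x * y^2 - 2 * y * z^2) + a6 * (y^2 * z) + a7 * y^3))"

definition cI3 :: "complex^3 \<Rightarrow> complex" where "cI3 u = (u$1)^3"
definition cI2 :: "complex^3 \<Rightarrow> complex" where "cI2 u = (u$1)^2 * u$3"
definition cI1 :: "complex^3 \<Rightarrow> complex" where "cI1 u = (u$1)^2 * u$2 - 2 * u$1 * (u$3)^2"
definition cI0 :: "complex^3 \<Rightarrow> complex" where "cI0 u = 3 * u$1 * u$2 * u$3 - (u$3)^3"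

definition nf_chart ::
  "(complex^4) set \<Rightarrow> complex^4^4 \<Rightarrow> complex^4 \<Rightarrow> (complex^3) set \<Rightarrow> (complex^3 \<Rightarrow> complex)
     \<Rightarrow> (complex^3 \<Rightarrow> complex) \<Rightarrow> bool" where
  "nf_chart S L b U F C \<longleftrightarrow> invertible L \<and> cholo U F \<and> 0 \<in> U \<and>
     (\<exists>V. open V \<and> 0 \<in> V \<and> (\<lambda>q. L *v q + b) ` S \<inter> V = (\<lambda>u. lift u (F u)) ` U \<inter> V) \<and>
     (\<exists>K d. d > 0 \<and> (\<forall>u\<in>U. norm u < d \<longrightarrow> norm (F u - Q0 u - C u) \<le> K * norm u ^ 4))"

text \<open>Residual affine coordinate changes q \<mapsto> L q + b preserving the normal form with
  quadratic part Q and cubic part C: they fix the origin, the tangent plane w = 0 and the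
  affine normal (w-axis), and the transformed graph function c F(A^{-1} u) (where
  L = diag(A, c)) has the same quadratic and cubic terms.\<close>
definition residual :: "(complex^3 \<Rightarrow> complex) \<Rightarrow> (complex^3 \<Rightarrow> complex)
     \<Rightarrow> ((complex^4^4) \<times> (complex^4)) set" where
  "residual Q C = {(L, b). invertible L \<and> b = 0 \<and>
     (\<forall>u. wc (L *v lift u 0) = 0) \<and> proj3 (L *v lift 0 1) = 0 \<and>
     (\<forall>u. Q (proj3 (L *v lift u 0)) = wc (L *v lift 0 1) * Q u) \<and>
     (\<forall>u. C (proj3 (L *v lift u 0)) = wc (L *v lift 0 1) * C u)}"

inductive_set gen_grp :: "(complex^4^4) set \<Rightarrow> (complex^4^4) set" for G where
  gen_id: "mat 1 \<in> gen_grp G"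
| gen_mul: "g \<in> G \<Longrightarrow> h \<in> gen_grp G \<Longrightarrow> g ** h \<in> gen_grp G"
| gen_inv: "g \<in> G \<Longrightarrow> h \<in> gen_grp G \<Longrightarrow> matrix_inv g ** h \<in> gen_grp G"

definition ix4 :: "4 \<Rightarrow> nat" where
  "ix4 i = (if i = 1 then 0 else if i = 2 then 1 else if i = 3 then 2 else 3)"

definition mat4 :: "complex list list \<Rightarrow> complex^4^4" where
  "mat4 rs = (\<chi> i j. rs ! ix4 i ! ix4 j)"

definition scalings :: "int \<Rightarrow> (complex^4^4) set" where
  "scalings t = {mat4 [[l powi (t - 1), 0, 0, 0], [0, l powi (t + 1), 0, 0],
                       [0, 0, l powi t, 0], [0, 0, 0, l powi (2 * t)]] | l. l \<noteq> 0}"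

definition shearsI3 :: "(complex^4^4) set" where
  "shearsI3 = {mat4 [[1, 0, 0, 0], [- (s^2 / 2), 1, - s, 0], [s, 0, 1, 0], [0, 0, 0, 1]] | s. True}"

definition swapI0 :: "complex^4^4" where
  "swapI0 = mat4 [[0, 1, 0, 0], [1, 0, 0, 0], [0, 0, 1, 0], [0, 0, 0, 1]]"

end

theory Submission
  imports Defs "HOL-Complex_Analysis.Cauchy_Integral_Formula"
begin

text \<open>At a point of \<open>S\<close> expand the graph function over the tangent plane to third order. The quadratic
  part is diagonalised to \<open>2xy + z^2\<close>, and the shear \<open>u \<mapsto> u + w a\<close> changes the cubic part by a
  multiple of the quadratic one, so that it can be made trace-free.

  Since the symmetry algebra is transitive and has isotropy at one point, its dimension is at least 4,
  hence there is isotropy at every point. Comparing the terms of order at most 3 in the tangency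
  condition, an infinitesimal isotropy \<open>m\<close> acts on the tangent plane by an element \<open>\<mu> + A\<close> of the
  conformal algebra, preserves the affine normal direction because the cubic part is trace-free,
  and has \<open>C\<close> as an eigenvector of \<open>A\<close>. A nonzero \<open>A\<close> in the orthogonal algebra is conjugate either to a
  diagonal element, so that \<open>C\<close> is a weight vector of the 7-dimensional representation, or to a nilpotent
  one, so that \<open>C\<close> is a highest weight vector. Weight vectors are the four normal forms up to scale and
  the swap of \<open>x\<close> and \<open>y\<close>. The residual groups follow by comparing coefficients.\<close>

section \<open>Linear coordinates and holomorphic functions\<close>

text \<open>Holomorphy is given only as complex differentiability on an open set, and non-degeneracy
  only as an expansion up to o(|u|^2), whereas the normal form needs a cubic part with an O(|u|^4)
  remainder. The expansion is therefore obtained on complex lines: one-variable Cauchy estimates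
  give it, and Liouville's theorem shows that its third-order coefficient is a polynomial. The
  tangency condition contains the derivative of the remainder; Cauchy's estimate on a ball of radius
  |v| about v turns the bound O(|v|^4) into O(|v|^3). Multiples of \<open>Q0\<close> by linear forms
  are a complement of the trace-free cubics. An isotropy moves the w-axis only through such a
  multiple in the third-order equation, which is why trace-freeness forces the axis to be preserved.
  Under diag(1,-1,0) the seven basis cubics have weights 3, ..., -3. A form of weight k is
  multiplied by \<lambda>^(3t-k) under the scaling with exponents t-1, t+1, t, and this equals
  \<lambda>^(2t) exactly for t = k: this is the origin of t = 3, 2, 1, 0.\<close>

lemma lift_nth [simp]:
  "lift u w $ 1 = u$1" "lift u w $ 2 = u$2" "lift u w $ 3 = u$3" "lift u w $ 4 = w"
  by (simp_all add: lift_def)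

lemma proj3_nth [simp]: "proj3 p $ 1 = p$1" "proj3 p $ 2 = p$2" "proj3 p $ 3 = p$3"
  by (simp_all add: proj3_def)

lemma vec3_eq: "u = v \<longleftrightarrow> u$1 = v$1 \<and> u$2 = v$2 \<and> u$3 = v$3" for u v :: "'a^3"
  by (simp add: vec_eq_iff forall_3)

lemma vec4_eq: "u = v \<longleftrightarrow> u$1 = v$1 \<and> u$2 = v$2 \<and> u$3 = v$3 \<and> u$4 = v$4" for u v :: "'a^4"
  by (simp add: vec_eq_iff forall_4)

lemma proj3_lift [simp]: "proj3 (lift u w) = u"
  by (simp add: vec3_eq)

lemma wc_lift [simp]: "wc (lift u w) = w"
  by (simp add: wc_def)

lemma lift_proj3 [simp]: "lift (proj3 p) (wc p) = p"
  by (simp add: vec4_eq wc_def)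

lemma lift_0 [simp]: "lift 0 0 = 0"
  by (simp add: vec4_eq)

lemma proj3_linear [simp]:
  "proj3 0 = 0" "proj3 (p + q) = proj3 p + proj3 q" "proj3 (p - q) = proj3 p - proj3 q"
  "proj3 (c *s p) = c *s proj3 p" "proj3 (r *\<^sub>R p) = r *\<^sub>R proj3 p"
  by (simp_all add: vec3_eq)

lemma wc_linear [simp]:
  "wc 0 = 0" "wc (p + q) = wc p + wc q" "wc (p - q) = wc p - wc q" "wc (c *s p) = c * wc p"
  "wc (r *\<^sub>R p) = r *\<^sub>R wc p"
  by (simp_all add: wc_def)

lemma lift_scaleR: "lift (r *\<^sub>R u) (r *\<^sub>R w) = r *\<^sub>R lift u w"
  by (simp add: vec4_eq)

lemma scale_of_real: "of_real r *s v = r *\<^sub>R v" for v :: "complex^'n"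
  by (simp add: vec_eq_iff scaleR_conv_of_real[where 'a=complex])

lemma norm_cscale: "norm (c *s v) = norm c * norm v" for v :: "complex^'n"
  by (simp add: norm_vec_def L2_set_def norm_mult power_mult_distrib real_sqrt_mult
      flip: sum_distrib_left)

lemma bounded_linear_cscale_left: "bounded_linear (\<lambda>t. t *s (v :: complex^'n))"
  by (rule bounded_linear_intro[where K="norm v"])
    (simp_all add: vec_eq_iff algebra_simps norm_cscale)

lemma matrix_scale: "A *v (c *s v) = c *s (A *v v)" for A :: "complex^'n^'m"
  by (simp add: vec_eq_iff matrix_vector_mult_def sum_distrib_left mult.left_commute)

lemma bounded_linear_matrix: "bounded_linear ((*v) (A :: complex^'n^'m))"
  by (rule linear_conv_bounded_linear[THEN iffD1], rule linearI)
    (simp_all add: matrix_vector_right_distrib matrix_scale flip: scale_of_real)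

lemma bounded_linear_proj3: "bounded_linear proj3"
  by (rule linear_conv_bounded_linear[THEN iffD1], rule linearI) simp_all

lemma bounded_linear_wc: "bounded_linear wc"
  unfolding wc_def by (rule bounded_linear_vec_nth)

lemma has_derivative_lift:
  assumes "(f has_derivative f') (at x within A)" and "(g has_derivative g') (at x within A)"
  shows "((\<lambda>x. lift (f x) (g x)) has_derivative (\<lambda>x. lift (f' x) (g' x))) (at x within A)"
proof -
  have *: "bounded_linear (\<lambda>p. lift (fst p) (snd p))"
    by (rule linear_conv_bounded_linear[THEN iffD1], rule linearI) (simp_all add: vec4_eq)
  show ?thesis
    using bounded_linear.has_derivative[OF * has_derivative_Pair[OF assms]] by simp
qed

text \<open>The linear map (u, w) -> (A u + w a, c w), the general shape of a linear map preserving
  w = 0; for a = 0 it also preserves the w-axis.\<close>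

definition blk :: "complex^3^3 \<Rightarrow> complex^3 \<Rightarrow> complex \<Rightarrow> complex^4^4" where
  "blk A a c = (\<chi> i j. lift (if j = 4 then a else \<chi> k. lift (A$k) 0 $ j) (if j = 4 then c else 0) $ i)"

lemma blk_nth [simp]:
  "blk A a c $1$1 = A$1$1" "blk A a c $1$2 = A$1$2" "blk A a c $1$3 = A$1$3" "blk A a c $1$4 = a$1"
  "blk A a c $2$1 = A$2$1" "blk A a c $2$2 = A$2$2" "blk A a c $2$3 = A$2$3" "blk A a c $2$4 = a$2"
  "blk A a c $3$1 = A$3$1" "blk A a c $3$2 = A$3$2" "blk A a c $3$3 = A$3$3" "blk A a c $3$4 = a$3"
  "blk A a c $4$1 = 0" "blk A a c $4$2 = 0" "blk A a c $4$3 = 0" "blk A a c $4$4 = c"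
  by (simp_all add: blk_def)

lemma blk_mult: "blk A a c *v p = lift (A *v proj3 p + wc p *s a) (c * wc p)"
  by (simp add: vec4_eq matrix_vector_mult_def sum_3 sum_4 wc_def mult.commute)

lemma invertible_iff_inj: "invertible A \<longleftrightarrow> inj ((*v) A)" for A :: "complex^'n^'n"
  using matrix_left_invertible_injective[of A] by (simp add: invertible_left_inverse)

lemma inj_mult_iff: "inj ((*v) A) \<longleftrightarrow> (\<forall>v. A *v v = 0 \<longrightarrow> v = 0)" for A :: "complex^'n^'m"
  by (metis (no_types, opaque_lifting) eq_iff_diff_eq_0 injI inj_eq matrix_vector_mult_0_right matrix_vector_mult_diff_distrib)

lemma invertible_blk:
  assumes "invertible A" "c \<noteq> 0" shows "invertible (blk A a c)"
  unfolding invertible_iff_inj inj_mult_iff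
proof (intro allI impI)
  fix p assume "blk A a c *v p = 0"
  then have 0: "A *v proj3 p + wc p *s a = 0" "c * wc p = 0"
    by (metis blk_mult proj3_lift proj3_linear(1)) (metis blk_mult \<open>blk A a c *v p = 0\<close> wc_lift wc_linear(1))
  with assms have "wc p = 0" by simp
  with 0 have "A *v proj3 p = 0" by simp
  with assms have "proj3 p = 0" by (simp add: invertible_iff_inj inj_mult_iff)
  with \<open>wc p = 0\<close> show "p = 0" by (metis lift_0 lift_proj3)
qed

lemma matrix_inv_mult:
  assumes "invertible A" shows "A ** matrix_inv A = mat 1" "matrix_inv A ** A = mat 1"
  using someI_ex[OF assms[unfolded invertible_def]] by (simp_all add: matrix_inv_def)

lemma matrix_inv_mult_vec:
  assumes "invertible A" shows "matrix_inv A *v (A *v v) = v" "A *v (matrix_inv A *v v) = v"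
  using assms by (simp_all add: matrix_vector_mul_assoc matrix_inv_mult)

lemma invertible_matrix_inv: "invertible A \<Longrightarrow> invertible (matrix_inv A)"
  unfolding invertible_def using matrix_inv_mult unfolding invertible_def by blast

section \<open>Holomorphic functions of three variables on complex lines\<close>

lemma choloD:
  assumes "cholo U G" "u \<in> U"
  obtains D where "(G has_derivative D) (at u)" "\<And>c v. D (c *s v) = c * D v"
  using assms unfolding cholo_def by blast

lemma cholo_derivative_scale:
  assumes "cholo U G" "u \<in> U" "(G has_derivative D) (at u)" shows "D (c *s v) = c * D v"
  using assms has_derivative_unique unfolding cholo_def by blast

lemma cholo_line:
  assumes "cholo U G" "u + t *s v \<in> U" "(G has_derivative D) (at (u + t *s v))"
  shows "((\<lambda>t. G (u + t *s v)) has_field_derivative D v) (at t)"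
proof -
  have "((\<lambda>t. u + t *s v) has_derivative (\<lambda>h. h *s v)) (at t)"
    using bounded_linear.has_derivative[OF bounded_linear_cscale_left has_derivative_ident]
    by (auto intro!: derivative_eq_intros)
  from has_derivative_compose[OF this assms(3)]
  have "((\<lambda>t. G (u + t *s v)) has_derivative (\<lambda>h. D (h *s v))) (at t)" .
  also have "(\<lambda>h. D (h *s v)) = (*) (D v)"
    using cholo_derivative_scale[OF assms] by (auto simp: mult.commute)
  finally show ?thesis
    unfolding has_field_derivative_def .
qed

lemma cholo_line_holomorphic:
  assumes "cholo U G" "\<And>t. t \<in> T \<Longrightarrow> u + t *s v \<in> U"
  shows "(\<lambda>t. G (u + t *s v)) holomorphic_on T"
proof (rule holomorphic_onI)
  fix t assume "t \<in> T"
  with assms obtain D where "(G has_derivative D) (at (u + t *s v))"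
    by (meson choloD)
  then show "(\<lambda>t. G (u + t *s v)) field_differentiable at t within T"
    using cholo_line assms \<open>t \<in> T\<close> field_differentiable_at_within field_differentiable_def by blast
qed

lemma cholo_continuous_on: "cholo U G \<Longrightarrow> continuous_on U G"
  by (meson choloD continuous_at_imp_continuous_on has_derivative_continuous)

text \<open>Cauchy's inequality for the first derivative on the complex line through
  \<open>u\<close> in the unit direction of \<open>v\<close>; complex homogeneity of
  \<open>D\<close> restores the length of \<open>v\<close>.\<close>

lemma cholo_derivative_bound:
  assumes G: "cholo U G" and "cball u r \<subseteq> U" "r > 0"
    and B: "\<And>w. w \<in> cball u r \<Longrightarrow> norm (G w) \<le> B" and D: "(G has_derivative D) (at u)"
  shows "norm (D v) \<le> B / r * norm v"
proof (cases "v = 0")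
  case True
  then show ?thesis using has_derivative_bounded_linear[OF D] by (simp add: linear_simps)
next
  case False
  define e where "e = (1 / norm v) *\<^sub>R v"
  have e: "norm e = 1" using False by (simp add: e_def)
  have in_ball: "u + t *s e \<in> cball u r" if "norm t \<le> r" for t
    using that by (simp add: dist_norm norm_cscale e)
  have hol: "(\<lambda>t. G (u + t *s e)) holomorphic_on cball 0 r"
    by (rule cholo_line_holomorphic[OF G]) (use assms in_ball in auto)
  have "norm ((deriv ^^ 1) (\<lambda>t. G (u + t *s e)) 0) \<le> fact 1 * B / r^1"
  proof (rule Cauchy_inequality)
    show "(\<lambda>t. G (u + t *s e)) holomorphic_on ball 0 r"
      using hol ball_subset_cball by (rule holomorphic_on_subset)
  qed (use hol \<open>r > 0\<close> in_ball B in \<open>auto simp: holomorphic_on_imp_continuous_on\<close>)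
  moreover have "((\<lambda>t. G (u + t *s e)) has_field_derivative D e) (at 0)"
    by (rule cholo_line[OF G]) (use assms D in auto)
  ultimately have "norm (D e) \<le> B / r" by (simp add: DERIV_imp_deriv)
  moreover have "of_real (norm v) *s e = v"
    using False by (simp add: e_def scale_of_real)
  then have "D v = of_real (norm v) * D e"
    using cholo_derivative_scale[OF G _ D, of "of_real (norm v)" e] subsetD[OF assms(2), of u] assms(3)
    by simp
  ultimately have "norm (D v) = norm v * norm (D e)" "norm (D e) \<le> B / r"
    by (auto simp: norm_mult)
  then show ?thesis
    unfolding mult.commute[of "B / r"] by (metis mult_left_mono norm_ge_zero)
qed

section \<open>Residual groups of the normal forms\<close>

definition vec3 :: "complex \<Rightarrow> complex \<Rightarrow> complex \<Rightarrow> complex^3" where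
  "vec3 x y z = vector [x, y, z]"

lemma vec3_nth [simp]: "vec3 x y z $ 1 = x" "vec3 x y z $ 2 = y" "vec3 x y z $ 3 = z"
  by (simp_all add: vec3_def)

lemma vec3_all: "(\<forall>u. P u) \<longleftrightarrow> (\<forall>x y z. P (vec3 x y z))"
proof -
  have "u = vec3 (u$1) (u$2) (u$3)" for u by (simp add: vec3_eq)
  then show ?thesis by metis
qed

lemma matrix_mult_nth3 [simp]:
  "(A *v u) $ i = A$i$1 * u$1 + A$i$2 * u$2 + A$i$3 * u$3" for A :: "complex^3^'n"
  by (simp add: matrix_vector_mult_def sum_3)

section \<open>Comparing coefficients of quadratic and cubic forms\<close>

lemma quadratic_form_coeffs:
  fixes k1 k2 k3 k4 k5 k6 :: complex
  assumes "\<And>x y z. k1 * x^2 + k2 * y^2 + k3 * z^2 + k4 * (x * y) + k5 * (x * z) + k6 * (y * z) = 0"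
  shows "k1 = 0 \<and> k2 = 0 \<and> k3 = 0 \<and> k4 = 0 \<and> k5 = 0 \<and> k6 = 0"
  using assms[of 1 0 0] assms[of 0 1 0] assms[of 0 0 1] assms[of 1 1 0] assms[of 1 0 1] assms[of 0 1 1]
  by simp

lemma cubic_form_coeffs:
  fixes k1 k2 k3 k4 k5 k6 k7 k8 k9 k10 :: complex
  assumes k: "\<And>x y z. k1 * x^3 + k2 * y^3 + k3 * z^3 + k4 * (x^2 * y) + k5 * (x^2 * z) + k6 * (x * y^2)
    + k7 * (y^2 * z) + k8 * (x * z^2) + k9 * (y * z^2) + k10 * (x * y * z) = 0"
  shows "k1 = 0 \<and> k2 = 0 \<and> k3 = 0 \<and> k4 = 0 \<and> k5 = 0 \<and> k6 = 0 \<and> k7 = 0 \<and> k8 = 0 \<and> k9 = 0 \<and> k10 = 0"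
proof -
  have 1: "k1 = 0" "k2 = 0" "k3 = 0" using k[of 1 0 0] k[of 0 1 0] k[of 0 0 1] by simp_all
  \<comment> \<open>Changing the sign of one variable separates the two mixed monomials in each pair
    of variables.\<close>
  have "k4 + k6 = 0" "- k4 + k6 = 0" using k[of 1 1 0] k[of 1 "-1" 0] 1 by simp_all
  moreover have "k5 + k8 = 0" "- k5 + k8 = 0" using k[of 1 0 1] k[of 1 0 "-1"] 1 by simp_all
  moreover have "k7 + k9 = 0" "- k7 + k9 = 0" using k[of 0 1 1] k[of 0 1 "-1"] 1 by simp_all
  ultimately have 2: "k4 = 0" "k5 = 0" "k6 = 0" "k7 = 0" "k8 = 0" "k9 = 0" by algebra+
  then show ?thesis using k[of 1 1 1] 1 by simp
qed

text \<open>Preserving the plane w = 0 kills the last row of \<open>L\<close> off the diagonal,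
  fixing the w-axis kills the last column; invertibility then passes to both diagonal
  blocks.\<close>

lemma residual_iff:
  "(L, b) \<in> residual Q C \<longleftrightarrow> b = 0 \<and> (\<exists>A c. L = blk A 0 c \<and> invertible A \<and> c \<noteq> 0 \<and>
     (\<forall>u. Q (A *v u) = c * Q u) \<and> (\<forall>u. C (A *v u) = c * C u))" (is "?l \<longleftrightarrow> ?r")
proof
  assume l: ?l
  then have inv: "invertible L" and "b = 0" and z: "\<And>u. wc (L *v lift u 0) = 0" "proj3 (L *v lift 0 1) = 0"
    and QC: "\<And>u. Q (proj3 (L *v lift u 0)) = wc (L *v lift 0 1) * Q u"
      "\<And>u. C (proj3 (L *v lift u 0)) = wc (L *v lift 0 1) * C u"
    by (auto simp: residual_def)
  define A where "A = (vector [proj3 (L$1), proj3 (L$2), proj3 (L$3)] :: complex^3^3)"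
  have "L$4$1 = 0" "L$4$2 = 0" "L$4$3 = 0"
    using z(1)[of "vec3 1 0 0"] z(1)[of "vec3 0 1 0"] z(1)[of "vec3 0 0 1"]
    by (simp_all add: wc_def matrix_vector_mult_def sum_4)
  moreover have "L$1$4 = 0" "L$2$4 = 0" "L$3$4 = 0"
    using z(2) by (simp_all add: vec3_eq matrix_vector_mult_def sum_4)
  ultimately have L: "L = blk A 0 (L$4$4)"
    by (simp add: vec4_eq A_def)
  have "wc (L *v lift 0 1) = L$4$4" "\<And>u. proj3 (L *v lift u 0) = A *v u"
    by (subst L, simp add: blk_mult)+
  moreover have "L$4$4 \<noteq> 0"
  proof
    assume "L$4$4 = 0"
    then have "L *v lift 0 1 = 0" by (subst L) (simp add: blk_mult)
    with inv have "lift 0 1 = 0" by (simp add: invertible_iff_inj inj_mult_iff)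
    then show False by (metis wc_lift wc_linear(1) zero_neq_one)
  qed
  moreover have "invertible A"
    unfolding invertible_iff_inj inj_mult_iff
  proof (intro allI impI)
    fix v assume "A *v v = 0"
    then have "L *v lift v 0 = 0" by (subst L) (simp add: blk_mult)
    with inv have "lift v 0 = 0" by (simp add: invertible_iff_inj inj_mult_iff)
    then show "v = 0" by (metis proj3_lift proj3_linear(1))
  qed
  ultimately show ?r using L QC \<open>b = 0\<close> by metis
next
  assume ?r
  then show ?l by (auto simp: residual_def blk_mult invertible_blk)
qed

lemma blk_compose: "blk A 0 c ** blk B 0 d = blk (A ** B) 0 (c * d)"
  by (simp add: vec4_eq matrix_matrix_mult_def sum_3 sum_4)

lemma blk_one: "mat 1 = blk (mat 1) 0 1"
  by (simp add: vec4_eq mat_def)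

lemma residual_group:
  shows "(mat 1, 0) \<in> residual Q C"
    and "(L, 0) \<in> residual Q C \<Longrightarrow> (M, 0) \<in> residual Q C \<Longrightarrow> (L ** M, 0) \<in> residual Q C"
    and "(L, 0) \<in> residual Q C \<Longrightarrow> (matrix_inv L, 0) \<in> residual Q C"
proof -
  show "(mat 1, 0) \<in> residual Q C"
    unfolding residual_iff using blk_one
    by (intro conjI refl exI[of _ "mat 1"] exI[of _ 1]) (auto simp: invertible_def intro: exI[of _ "mat 1"])
next
  assume "(L, 0) \<in> residual Q C" "(M, 0) \<in> residual Q C"
  then obtain A c B d where *: "L = blk A 0 c" "invertible A" "c \<noteq> 0" "M = blk B 0 d" "invertible B" "d \<noteq> 0"
    "\<And>u. Q (A *v u) = c * Q u" "\<And>u. C (A *v u) = c * C u"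
    "\<And>u. Q (B *v u) = d * Q u" "\<And>u. C (B *v u) = d * C u"
    unfolding residual_iff by blast
  then show "(L ** M, 0) \<in> residual Q C"
    unfolding residual_iff
    by (intro conjI refl exI[of _ "A ** B"] exI[of _ "c * d"])
      (simp_all add: blk_compose invertible_mult flip: matrix_vector_mul_assoc)
next
  assume "(L, 0) \<in> residual Q C"
  then obtain A c where *: "L = blk A 0 c" "invertible A" "c \<noteq> 0"
    "\<And>u. Q (A *v u) = c * Q u" "\<And>u. C (A *v u) = c * C u"
    unfolding residual_iff by blast
  have 1: "L ** blk (matrix_inv A) 0 (1 / c) = mat 1"
    using * by (simp add: blk_compose matrix_inv_mult flip: blk_one)
  have "matrix_inv L = matrix_inv L ** (L ** blk (matrix_inv A) 0 (1 / c))"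
    by (simp add: 1)
  also have "\<dots> = blk (matrix_inv A) 0 (1 / c)"
    using * by (simp add: matrix_mul_assoc matrix_inv_mult invertible_blk)
  finally have "matrix_inv L = blk (matrix_inv A) 0 (1 / c)" .
  moreover have "Q (matrix_inv A *v u) = 1 / c * Q u" "C (matrix_inv A *v u) = 1 / c * C u" for u
    using *(4,5)[of "matrix_inv A *v u"] * by (simp_all add: matrix_inv_mult_vec)
  ultimately show "(matrix_inv L, 0) \<in> residual Q C"
    unfolding residual_iff using *(2,3) invertible_matrix_inv
    by (intro conjI refl exI[of _ "matrix_inv A"] exI[of _ "1 / c"]) auto
qed

text \<open>Since the residual changes form a group, one inclusion needs to be checked on generators
  only.\<close>

lemma residual_eq_gen_grp:
  assumes "\<And>L. (L, 0) \<in> residual Q C \<Longrightarrow> L \<in> gen_grp G" and "\<And>g. g \<in> G \<Longrightarrow> (g, 0) \<in> residual Q C"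
  shows "residual Q C = (\<lambda>L. (L, 0)) ` gen_grp G"
proof -
  have "(L, 0) \<in> residual Q C" if "L \<in> gen_grp G" for L
    using that by induction (auto intro: residual_group assms(2))
  moreover have "b = 0" if "(L, b) \<in> residual Q C" for L b
    using that by (simp add: residual_def)
  ultimately show ?thesis using assms(1) by fastforce
qed

lemma residualE:
  assumes "(L, 0) \<in> residual Q0 C"
  obtains A c where "L = blk A 0 c" "c \<noteq> 0"
    "2 * A$1$1 * A$2$1 + (A$3$1)^2 = 0" "2 * A$1$2 * A$2$2 + (A$3$2)^2 = 0"
    "2 * A$1$3 * A$2$3 + (A$3$3)^2 = c" "A$1$1 * A$2$2 + A$1$2 * A$2$1 + A$3$1 * A$3$2 = c"
    "A$1$1 * A$2$3 + A$1$3 * A$2$1 + A$3$1 * A$3$3 = 0"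
    "A$1$2 * A$2$3 + A$1$3 * A$2$2 + A$3$2 * A$3$3 = 0"
    "\<And>u. Q0 (A *v u) = c * Q0 u"
    "\<And>u. C (A *v u) = c * C u"
proof -
  obtain A c where *: "L = blk A 0 c" "c \<noteq> 0"
    "\<And>u. Q0 (A *v u) = c * Q0 u" "\<And>u. C (A *v u) = c * C u"
    using assms unfolding residual_iff by blast
  have "(2 * A$1$1 * A$2$1 + (A$3$1)^2) * x^2 + (2 * A$1$2 * A$2$2 + (A$3$2)^2) * y^2
     + (2 * A$1$3 * A$2$3 + (A$3$3)^2 - c) * z^2
     + (2 * (A$1$1 * A$2$2 + A$1$2 * A$2$1 + A$3$1 * A$3$2 - c)) * (x * y)
     + (2 * (A$1$1 * A$2$3 + A$1$3 * A$2$1 + A$3$1 * A$3$3)) * (x * z)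
     + (2 * (A$1$2 * A$2$3 + A$1$3 * A$2$2 + A$3$2 * A$3$3)) * (y * z) = 0" for x y z
    using *(3)[of "vec3 x y z"] unfolding Q0_def by (simp) algebra
  from quadratic_form_coeffs[OF this] * show thesis
    by (intro that[of A c]) (simp_all del: distrib_left_numeral)
qed

lemma mat4_eq_blk:
  "mat4 [[a11, a12, a13, 0], [a21, a22, a23, 0], [a31, a32, a33, 0], [0, 0, 0, c]]
   = blk (vector [vec3 a11 a12 a13, vec3 a21 a22 a23, vec3 a31 a32 a33]) 0 c"
  by (simp add: vec4_eq mat4_def ix4_def)

text \<open>A kernel vector v satisfies Q0(u + v) = Q0(u) for all u, so it lies in the radical of
  the non-degenerate form \<open>Q0\<close>; testing the basis vectors reads off its
  coordinates.\<close>

lemma invertible_if_conformal: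
  assumes "\<And>u. Q0 (A *v u) = c * Q0 u" "c \<noteq> 0" shows "invertible A"
  unfolding invertible_iff_inj inj_mult_iff
proof (intro allI impI)
  fix v assume v: "A *v v = 0"
  have "Q0 (A *v (u + v)) = Q0 (A *v u)" for u by (simp only: matrix_vector_right_distrib v) simp
  then have *: "Q0 (u + v) = Q0 u" for u using assms by simp
  have "Q0 (vec3 1 0 0 + v) - Q0 (vec3 1 0 0) = 0" "Q0 (vec3 0 1 0 + v) - Q0 (vec3 0 1 0) = 0" 
     "Q0 (vec3 0 0 1 + v) - Q0 (vec3 0 0 1) = 0"
    by (simp_all only: *) simp_all
  moreover have "Q0 v = 0" using *[of 0] by (simp add: Q0_def)
  ultimately
  show "v = 0" unfolding Q0_def vec3_eq by (simp add: algebra_simps power2_eq_square)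
qed

lemma residual_blkI:
  assumes "\<And>u. Q0 (A *v u) = c * Q0 u" "\<And>u. C (A *v u) = c * C u" "c \<noteq> 0"
  shows "(blk A 0 c, 0) \<in> residual Q0 C"
  unfolding residual_iff using assms invertible_if_conformal by blast

lemma scaling_blk:
  assumes "l \<noteq> 0"
  shows "blk (vector [vec3 (l powi (t - 1)) 0 0, vec3 0 (l powi (t + 1)) 0, vec3 0 0 (l powi t)]) 0 (l powi (2 * t))
     \<in> scalings t"
  unfolding scalings_def mat4_eq_blk using assms by blast

text \<open>Both monomials of \<open>Q0\<close> scale by l^(2t) for every t, so only the cubic
  imposes a condition.\<close>

lemma scalings_residual:
  assumes "g \<in> scalings t"
    and "\<And>l u. l \<noteq> 0 \<Longrightarrow> C (vec3 (l powi (t - 1) * u$1) (l powi (t + 1) * u$2) (l powi t * u$3)) = l powi (2 * t) * C u"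
  shows "(g, 0) \<in> residual Q0 C"
proof -
  obtain l where l: "l \<noteq> 0" and g: "g = blk (vector [vec3 (l powi (t - 1)) 0 0, vec3 0 (l powi (t + 1)) 0, vec3 0 0 (l powi t)]) 0 (l powi (2 * t))"
    using assms(1) unfolding scalings_def mat4_eq_blk by blast
  have *: "vector [vec3 a 0 0, vec3 0 b 0, vec3 0 0 c] *v u = vec3 (a * u$1) (b * u$2) (c * u$3)" for a b c and u :: "complex^3"
    by (simp add: vec3_eq)
  have "l powi (t - 1) * l powi (t + 1) = l powi (2 * t)" "(l powi t)^2 = l powi (2 * t)"
    using l by (simp_all add: power_int_mult power_int_add[symmetric] power2_eq_square flip: power_int_add)
  then show ?thesis
    unfolding g using l assms(2)
    by (intro residual_blkI) (simp_all add: * Q0_def algebra_simps power_mult_distrib)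
qed

lemma residual_cI3: "residual Q0 cI3 = (\<lambda>L. (L, 0)) ` gen_grp (scalings 3 \<union> shearsI3)"
proof (rule residual_eq_gen_grp)
  fix L assume "(L, 0) \<in> residual Q0 cI3"
  then show "L \<in> gen_grp (scalings 3 \<union> shearsI3)"
  proof (rule residualE)
    fix A c
    assume L: "L = blk A 0 c" and c: "c \<noteq> 0"
      and q: "2 * A$1$1 * A$2$1 + (A$3$1)^2 = 0" "2 * A$1$2 * A$2$2 + (A$3$2)^2 = 0"
        "2 * A$1$3 * A$2$3 + (A$3$3)^2 = c" "A$1$1 * A$2$2 + A$1$2 * A$2$1 + A$3$1 * A$3$2 = c"
        "A$1$1 * A$2$3 + A$1$3 * A$2$1 + A$3$1 * A$3$3 = 0"
      and C: "\<And>u. cI3 (A *v u) = c * cI3 u"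
    \<comment> \<open>The cube of the first row is c x^3, so this row is a multiple of x.\<close>
    have a: "A$1$1 ^ 3 = c" "A$1$2 = 0" "A$1$3 = 0"
      using C[of "vec3 1 0 0"] C[of "vec3 0 1 0"] C[of "vec3 0 0 1"] by (simp_all add: cI3_def)
    then have b: "A$3$2 = 0" "A$3$3 ^ 2 = c" using q by simp_all
    have n: "A$1$1 \<noteq> 0" "A$3$3 \<noteq> 0" using a b c by auto
    \<comment> \<open>The pair satisfies A11^3 = c = A33^2, and the quotient parametrises this cusp:
      A11 = l^2, A33 = l^3, c = l^6.\<close>
    define l where "l = A$3$3 / A$1$1"
    define s where "s = A$3$1 / A$3$3"
    have l: "l \<noteq> 0" "A$1$1 = l^2" "A$3$3 = l^3" "c = l^6"
      using n a(1) b(2) unfolding l_def by (simp_all add: divide_simps) algebra+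
    have s: "A$3$1 = l^3 * s" using n l by (simp add: s_def)
    \<comment> \<open>Once the first and third rows are known, conformality determines the second
      row.\<close>
    have "l^2 * (A$2$2 - l^4) = 0" "l^2 * (A$2$1 + l^4 * s^2 / 2) = 0" "l^2 * (A$2$3 + l^4 * s) = 0"
      using q a b l s by (simp_all add: field_simps) algebra+
    then have r: "A$2$2 = l^4" "A$2$1 = - (l^4 * s^2 / 2)" "A$2$3 = - (l^4 * s)"
      using l(1) by (simp_all add: eq_neg_iff_add_eq_0)
    have "L = blk (vector [vec3 (l powi (3 - 1)) 0 0, vec3 0 (l powi (3 + 1)) 0, vec3 0 0 (l powi 3)]) 0 (l powi (2 * 3))
      ** (blk (vector [vec3 1 0 0, vec3 (- (s^2 / 2)) 1 (- s), vec3 s 0 1]) 0 1 ** mat 1)"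
      unfolding L using a b l s r
      by (simp add: blk_compose) (simp add: vec4_eq matrix_matrix_mult_def sum_3)
    moreover have "blk (vector [vec3 1 0 0, vec3 (- (s^2 / 2)) 1 (- s), vec3 s 0 1]) 0 1 \<in> shearsI3"
      unfolding shearsI3_def mat4_eq_blk by blast
    ultimately show "L \<in> gen_grp (scalings 3 \<union> shearsI3)"
      using scaling_blk[OF l(1), of 3] gen_grp.intros(1) by (metis Un_iff gen_grp.gen_mul)
  qed
next
  fix g assume "g \<in> scalings 3 \<union> shearsI3"
  then show "(g, 0) \<in> residual Q0 cI3"
  proof
    assume "g \<in> scalings 3"
    then show ?thesis by (rule scalings_residual) (simp add: cI3_def field_simps)
  next
    assume "g \<in> shearsI3"
    then show ?thesis
      unfolding shearsI3_def mat4_eq_blk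
      by (auto intro!: residual_blkI simp: Q0_def cI3_def power2_eq_square field_simps)
  qed
qed


text \<open>By unique factorisation, x'^2 z' = c x^2 z forces x' and z' to be multiples of x and z;
  the ten coefficients carry this out.\<close>

lemma cI2_residual_coeffs:
  fixes a :: "complex^3^3"
  assumes "\<And>u. cI2 (a *v u) = c * cI2 u" and c: "c \<noteq> 0"
  shows "a$1$2 = 0" "a$1$3 = 0" "a$3$1 = 0" "a$3$2 = 0" "(a$1$1)^2 * a$3$3 = c"
proof -
  note C = assms(1)[unfolded cI2_def]
  have "((a$1$1)^2 * a$3$1) * x^3
    + ((a$1$2)^2 * a$3$2) * y^3
    + ((a$1$3)^2 * a$3$3) * z^3
    + ((a$1$1)^2 * a$3$2 + 2 * a$1$1 * a$1$2 * a$3$1) * (x^2 * y)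
    + ((a$1$1)^2 * a$3$3 + 2 * a$1$1 * a$1$3 * a$3$1 - c) * (x^2 * z)
    + (2 * a$1$1 * a$1$2 * a$3$2 + (a$1$2)^2 * a$3$1) * (x * y^2)
    + ((a$1$2)^2 * a$3$3 + 2 * a$1$2 * a$1$3 * a$3$2) * (y^2 * z)
    + (2 * a$1$1 * a$1$3 * a$3$3 + (a$1$3)^2 * a$3$1) * (x * z^2)
    + (2 * a$1$2 * a$1$3 * a$3$3 + (a$1$3)^2 * a$3$2) * (y * z^2)
    + (2 * a$1$1 * a$1$2 * a$3$3 + 2 * a$1$1 * a$1$3 * a$3$2 + 2 * a$1$2 * a$1$3 * a$3$1) * (x * y * z) = 0" for x y z
    using C[of "vec3 x y z"] by simp algebra
  from cubic_form_coeffs[OF this]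
  have k: "(a$1$1)^2 * a$3$1 = 0"
    "(a$1$2)^2 * a$3$2 = 0"
    "(a$1$3)^2 * a$3$3 = 0"
    "(a$1$1)^2 * a$3$2 + 2 * a$1$1 * a$1$2 * a$3$1 = 0"
    "(a$1$1)^2 * a$3$3 + 2 * a$1$1 * a$1$3 * a$3$1 - c = 0"
    "2 * a$1$1 * a$1$2 * a$3$2 + (a$1$2)^2 * a$3$1 = 0"
    "(a$1$2)^2 * a$3$3 + 2 * a$1$2 * a$1$3 * a$3$2 = 0"
    "2 * a$1$1 * a$1$3 * a$3$3 + (a$1$3)^2 * a$3$1 = 0"
    "2 * a$1$2 * a$1$3 * a$3$3 + (a$1$3)^2 * a$3$2 = 0"
    "2 * a$1$1 * a$1$2 * a$3$3 + 2 * a$1$1 * a$1$3 * a$3$2 + 2 * a$1$2 * a$1$3 * a$3$1 = 0"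
    by simp_all
  have n: "a$1$1 \<noteq> 0" using k(5) c by auto
  then show 31: "a$3$1 = 0" using k(1) by simp
  then show 33: "(a$1$1)^2 * a$3$3 = c" using k(5) by simp
  then have "a$3$3 \<noteq> 0" using c by auto
  then show 13: "a$1$3 = 0" using k(3) by simp
  show 32: "a$3$2 = 0" using k(4) 31 n by simp
  show "a$1$2 = 0" using k(7) 32 \<open>a$3$3 \<noteq> 0\<close> by simp
qed

lemma residual_cI2: "residual Q0 cI2 = (\<lambda>L. (L, 0)) ` gen_grp (scalings 2)"
proof (rule residual_eq_gen_grp)
  fix L assume "(L, 0) \<in> residual Q0 cI2"
  then show "L \<in> gen_grp (scalings 2)"
  proof (rule residualE)
    fix A c
    assume L: "L = blk A 0 c" and c: "c \<noteq> 0"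
      and q: "2 * A$1$1 * A$2$1 + (A$3$1)^2 = 0" "2 * A$1$2 * A$2$2 + (A$3$2)^2 = 0"
        "2 * A$1$3 * A$2$3 + (A$3$3)^2 = c" "A$1$1 * A$2$2 + A$1$2 * A$2$1 + A$3$1 * A$3$2 = c"
        "A$1$1 * A$2$3 + A$1$3 * A$2$1 + A$3$1 * A$3$3 = 0"
      and C: "\<And>u. cI2 (A *v u) = c * cI2 u"
    note k = cI2_residual_coeffs[OF C c]
    define l where "l = A$1$1"
    have l: "l \<noteq> 0" using k(5) c by (auto simp: l_def)
    have b: "A$2$1 = 0" "A$2$3 = 0" using q l k by (auto simp: l_def)
    have "(A$3$3)^2 = c" using q(3) k by simp
    moreover have "A$3$3 \<noteq> 0" using k(5) c by auto
    \<comment> \<open>The quadratic form gives c = A33^2 and the cubic gives c = l^2 A33.\<close>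
    moreover have "A$3$3 * (A$3$3 - l^2) = 0"
      using k(5) \<open>(A$3$3)^2 = c\<close> by (simp add: l_def algebra_simps power2_eq_square)
    ultimately have 33: "A$3$3 = l^2" by simp
    then have cl: "c = l^4" using k(5) by (simp add: l_def)
    have "l * (A$2$2 - l^3) = 0" using q(4) k cl by (simp add: l_def algebra_simps power_numeral_reduce)
    then have 22: "A$2$2 = l^3" using l by simp
    have "L = blk (vector [vec3 (l powi (2 - 1)) 0 0, vec3 0 (l powi (2 + 1)) 0, vec3 0 0 (l powi 2)]) 0 (l powi (2 * 2)) ** mat 1"
      unfolding L using k b 22 33 cl by (simp add: vec4_eq l_def)
    then show "L \<in> gen_grp (scalings 2)"
      using scaling_blk[OF l, of 2] gen_grp.intros by metis
  qed
next
  fix g assume "g \<in> scalings 2"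
  then show "(g, 0) \<in> residual Q0 cI2"
    by (rule scalings_residual) (simp add: cI2_def field_simps)
qed

lemma cI1_residual_coeffs:
  fixes a :: "complex^3^3"
  assumes "\<And>u. Q0 (a *v u) = c * Q0 u" and "\<And>u. cI1 (a *v u) = c * cI1 u" and c: "c \<noteq> 0"
    and q: "2 * a$1$2 * a$2$2 + (a$3$2)^2 = 0" "a$1$1 * a$2$2 + a$1$2 * a$2$1 + a$3$1 * a$3$2 = c"
  shows "a$1$1 = 1" "a$1$2 = 0" "a$1$3 = 0" "a$2$1 = 0" "a$2$2 = c"
proof -
  \<comment> \<open>Eliminating the square of the third row by the conformality relation leaves an identity
    between multiples of the first row and of x.\<close>
  have E: "5 * ((a *v u)$1)^2 * (a *v u)$2 - 2 * c * (a *v u)$1 * Q0 u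
      = c * (5 * (u$1)^2 * u$2 - 2 * u$1 * Q0 u)" for u
    using assms(1,2)[of u] unfolding Q0_def cI1_def by algebra
  have "(5 * (a$1$1)^2 * a$2$1) * x^3
    + (5 * (a$1$2)^2 * a$2$2) * y^3
    + (5 * (a$1$3)^2 * a$2$3 - 2 * a$1$3 * c) * z^3
    + (5 * (a$1$1)^2 * a$2$2 + 10 * a$1$1 * a$1$2 * a$2$1 - 4 * a$1$1 * c - c) * (x^2 * y)
    + (5 * (a$1$1)^2 * a$2$3 + 10 * a$1$1 * a$1$3 * a$2$1) * (x^2 * z)
    + (10 * a$1$1 * a$1$2 * a$2$2 + 5 * (a$1$2)^2 * a$2$1 - 4 * a$1$2 * c) * (x * y^2)
    + (5 * (a$1$2)^2 * a$2$3 + 10 * a$1$2 * a$1$3 * a$2$2) * (y^2 * z)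
    + (10 * a$1$1 * a$1$3 * a$2$3 - 2 * a$1$1 * c + 5 * (a$1$3)^2 * a$2$1 + 2 * c) * (x * z^2)
    + (10 * a$1$2 * a$1$3 * a$2$3 - 2 * a$1$2 * c + 5 * (a$1$3)^2 * a$2$2) * (y * z^2)
    + (10 * a$1$1 * a$1$2 * a$2$3 + 10 * a$1$1 * a$1$3 * a$2$2 + 10 * a$1$2 * a$1$3 * a$2$1 - 4 * a$1$3 * c) * (x * y * z) = 0" for x y z
    using E[of "vec3 x y z"] unfolding Q0_def by simp algebra
  from cubic_form_coeffs[OF this]
  have k: "5 * (a$1$1)^2 * a$2$1 = 0"
    "5 * (a$1$2)^2 * a$2$2 = 0"
    "5 * (a$1$3)^2 * a$2$3 - 2 * a$1$3 * c = 0"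
    "5 * (a$1$1)^2 * a$2$2 + 10 * a$1$1 * a$1$2 * a$2$1 - 4 * a$1$1 * c - c = 0"
    "5 * (a$1$1)^2 * a$2$3 + 10 * a$1$1 * a$1$3 * a$2$1 = 0"
    "10 * a$1$1 * a$1$2 * a$2$2 + 5 * (a$1$2)^2 * a$2$1 - 4 * a$1$2 * c = 0"
    "5 * (a$1$2)^2 * a$2$3 + 10 * a$1$2 * a$1$3 * a$2$2 = 0"
    "10 * a$1$1 * a$1$3 * a$2$3 - 2 * a$1$1 * c + 5 * (a$1$3)^2 * a$2$1 + 2 * c = 0"
    "10 * a$1$2 * a$1$3 * a$2$3 - 2 * a$1$2 * c + 5 * (a$1$3)^2 * a$2$2 = 0"
    "10 * a$1$1 * a$1$2 * a$2$3 + 10 * a$1$1 * a$1$3 * a$2$2 + 10 * a$1$2 * a$1$3 * a$2$1 - 4 * a$1$3 * c = 0"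
    by simp_all
  show 12: "a$1$2 = 0"
  proof (rule ccontr)
    assume n: "a$1$2 \<noteq> 0"
    then have "a$2$2 = 0" using k(2) by simp
    then have "a$2$3 = 0" using n k(7) by simp
    then show False using n \<open>a$2$2 = 0\<close> k(9) c by simp
  qed
  show 13: "a$1$3 = 0"
  proof (rule ccontr)
    assume n: "a$1$3 \<noteq> 0"
    then have "a$2$2 = 0" using 12 k(9) by simp
    then show False using 12 q c by simp
  qed
  \<comment> \<open>With a13 = 0 the coefficient of x z^2 is 2 c (1 - a11). The value 1 reflects
    that x has exponent t - 1 = 0 here.\<close>
  show 11: "a$1$1 = 1" using k(8) 13 c by simp
  then show "a$2$2 = c" "a$2$1 = 0" using k(1,4) 12 by simp_all
qed

lemma residual_cI1: "residual Q0 cI1 = (\<lambda>L. (L, 0)) ` gen_grp (scalings 1)"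
proof (rule residual_eq_gen_grp)
  fix L assume "(L, 0) \<in> residual Q0 cI1"
  then show "L \<in> gen_grp (scalings 1)"
  proof (rule residualE)
    fix A c
    assume L: "L = blk A 0 c" and c: "c \<noteq> 0"
      and q: "2 * A$1$1 * A$2$1 + (A$3$1)^2 = 0" "2 * A$1$2 * A$2$2 + (A$3$2)^2 = 0"
        "2 * A$1$3 * A$2$3 + (A$3$3)^2 = c" "A$1$1 * A$2$2 + A$1$2 * A$2$1 + A$3$1 * A$3$2 = c"
        "A$1$1 * A$2$3 + A$1$3 * A$2$1 + A$3$1 * A$3$3 = 0"
      and Q: "\<And>u. Q0 (A *v u) = c * Q0 u" and C: "\<And>u. cI1 (A *v u) = c * cI1 u"
    note k = cI1_residual_coeffs[OF Q C c q(2,4)]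
    define l where "l = A$3$3"
    have b: "A$3$1 = 0" "A$3$2 = 0" "A$2$3 = 0" using q k by auto
    have cl: "c = l^2" using q(3) k by (simp add: l_def)
    then have l: "l \<noteq> 0" using c by auto
    have "L = blk (vector [vec3 (l powi (1 - 1)) 0 0, vec3 0 (l powi (1 + 1)) 0, vec3 0 0 (l powi 1)]) 0 (l powi (2 * 1)) ** mat 1"
      unfolding L using k b cl by (simp add: vec4_eq l_def)
    then show "L \<in> gen_grp (scalings 1)"
      using scaling_blk[OF l, of 1] gen_grp.intros by metis
  qed
next
  fix g assume "g \<in> scalings 1"
  then show "(g, 0) \<in> residual Q0 cI1"
    by (rule scalings_residual) (simp add: cI1_def field_simps)
qed

lemma cI0_residual_coeffs:
  fixes a :: "complex^3^3"
  assumes "\<And>u. Q0 (a *v u) = c * Q0 u" and "\<And>u. cI0 (a *v u) = c * cI0 u" and c: "c \<noteq> 0"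
  shows "a$3$1 = 0" "a$3$2 = 0" "a$3$3 = 1" "c = 1"
proof -
  \<comment> \<open>Twice the cubic is 3 z Q0 - 5 z^3. Replacing Q0(a u) by c Q0(u) leaves an
    identity that involves the third row of \<open>a\<close> alone.\<close>
  have E: "3 * c * (a *v u)$3 * Q0 u - 5 * ((a *v u)$3)^3 = c * (3 * u$3 * Q0 u - 5 * (u$3)^3)" for u
    using assms(1,2)[of u] unfolding Q0_def cI0_def by algebra
  have "(-5 * (a$3$1)^3) * x^3
    + (-5 * (a$3$2)^3) * y^3
    + (-5 * (a$3$3)^3 + 3 * a$3$3 * c + 2 * c) * z^3
    + (-15 * (a$3$1)^2 * a$3$2 + 6 * a$3$1 * c) * (x^2 * y)
    + (-15 * (a$3$1)^2 * a$3$3) * (x^2 * z)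
    + (-15 * a$3$1 * (a$3$2)^2 + 6 * a$3$2 * c) * (x * y^2)
    + (-15 * (a$3$2)^2 * a$3$3) * (y^2 * z)
    + (-15 * a$3$1 * (a$3$3)^2 + 3 * a$3$1 * c) * (x * z^2)
    + (-15 * a$3$2 * (a$3$3)^2 + 3 * a$3$2 * c) * (y * z^2)
    + (-30 * a$3$1 * a$3$2 * a$3$3 + 6 * a$3$3 * c - 6 * c) * (x * y * z) = 0" for x y z
    using E[of "vec3 x y z"] unfolding Q0_def by simp algebra
  from cubic_form_coeffs[OF this]
  have k: "-5 * (a$3$1)^3 = 0"
    "-5 * (a$3$2)^3 = 0"
    "-5 * (a$3$3)^3 + 3 * a$3$3 * c + 2 * c = 0"
    "-15 * (a$3$1)^2 * a$3$2 + 6 * a$3$1 * c = 0"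
    "-15 * (a$3$1)^2 * a$3$3 = 0"
    "-15 * a$3$1 * (a$3$2)^2 + 6 * a$3$2 * c = 0"
    "-15 * (a$3$2)^2 * a$3$3 = 0"
    "-15 * a$3$1 * (a$3$3)^2 + 3 * a$3$1 * c = 0"
    "-15 * a$3$2 * (a$3$3)^2 + 3 * a$3$2 * c = 0"
    "-30 * a$3$1 * a$3$2 * a$3$3 + 6 * a$3$3 * c - 6 * c = 0"
    by blast+
  show "a$3$1 = 0" "a$3$2 = 0" using k(1,2) by simp_all
  show 33: "a$3$3 = 1" using k(10) c \<open>a$3$1 = 0\<close> by simp
  then show "c = 1" using k(3) by simp
qed

lemma residual_cI0: "residual Q0 cI0 = (\<lambda>L. (L, 0)) ` gen_grp (scalings 0 \<union> {swapI0})"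
proof (rule residual_eq_gen_grp)
  fix L assume "(L, 0) \<in> residual Q0 cI0"
  then show "L \<in> gen_grp (scalings 0 \<union> {swapI0})"
  proof (rule residualE)
    fix A c
    assume L: "L = blk A 0 c" and c: "c \<noteq> 0"
      and q: "2 * A$1$1 * A$2$1 + (A$3$1)^2 = 0" "2 * A$1$2 * A$2$2 + (A$3$2)^2 = 0"
        "2 * A$1$3 * A$2$3 + (A$3$3)^2 = c" "A$1$1 * A$2$2 + A$1$2 * A$2$1 + A$3$1 * A$3$2 = c"
        "A$1$1 * A$2$3 + A$1$3 * A$2$1 + A$3$1 * A$3$3 = 0"
        "A$1$2 * A$2$3 + A$1$3 * A$2$2 + A$3$2 * A$3$3 = 0"
      and Q: "\<And>u. Q0 (A *v u) = c * Q0 u" and C: "\<And>u. cI0 (A *v u) = c * cI0 u"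
    note k = cI0_residual_coeffs[OF Q C c]
    have incl: "blk (vector [vec3 (l powi (0 - 1)) 0 0, vec3 0 (l powi (0 + 1)) 0, vec3 0 0 (l powi 0)]) 0 (l powi (2 * 0)) ** h
       \<in> gen_grp (scalings 0 \<union> {swapI0})" if "l \<noteq> 0" "h \<in> gen_grp (scalings 0 \<union> {swapI0})" for l h
      using scaling_blk[OF that(1), of 0] that(2) by (intro gen_grp.gen_mul) auto
    show "L \<in> gen_grp (scalings 0 \<union> {swapI0})"
    \<comment> \<open>With third row (0, 0, 1) and c = 1, the first equation of \<open>q\<close>
      reads A11 * A21 = 0: the two isotropic lines of 2xy are either exchanged (the swap) or each
      preserved.\<close>
    proof (cases "A$1$1 = 0")
      case True
      then have p: "A$1$2 * A$2$1 = 1" using q k by simp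
      then have n: "A$1$2 \<noteq> 0" "A$2$1 \<noteq> 0" by auto
      then have z: "A$2$2 = 0" "A$1$3 = 0" "A$2$3 = 0" using q k True by auto
      have "A$1$2 = inverse (A$2$1)" using p by (metis inverse_unique mult.commute)
      then have "L = blk (vector [vec3 (A$2$1 powi (0 - 1)) 0 0, vec3 0 (A$2$1 powi (0 + 1)) 0, vec3 0 0 (A$2$1 powi 0)]) 0 (A$2$1 powi (2 * 0))
         ** (swapI0 ** mat 1)"
        unfolding L swapI0_def mat4_eq_blk using z True k
        by (simp add: blk_compose) (simp add: vec4_eq matrix_matrix_mult_def sum_3 power_int_minus)
      moreover have "swapI0 ** mat 1 \<in> gen_grp (scalings 0 \<union> {swapI0})"
        by (intro gen_grp.intros) auto
      ultimately show ?thesis using incl n by metis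
    next
      case False
      then have "A$2$1 = 0" using q k by simp
      then have p: "A$1$1 * A$2$2 = 1" using q k by simp
      then have n: "A$2$2 \<noteq> 0" by auto
      then have z: "A$1$2 = 0" "A$1$3 = 0" "A$2$3 = 0" using q k False \<open>A$2$1 = 0\<close> by auto
      have "A$1$1 = inverse (A$2$2)" using p by (metis inverse_unique mult.commute)
      then have "L = blk (vector [vec3 (A$2$2 powi (0 - 1)) 0 0, vec3 0 (A$2$2 powi (0 + 1)) 0, vec3 0 0 (A$2$2 powi 0)]) 0 (A$2$2 powi (2 * 0)) ** mat 1"
        unfolding L using z \<open>A$2$1 = 0\<close> k by (simp add: vec4_eq power_int_minus)
      then show ?thesis using incl n gen_grp.intros(1) by metis
    qed
  qed
next
  fix g assume "g \<in> scalings 0 \<union> {swapI0}"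
  then show "(g, 0) \<in> residual Q0 cI0"
  proof
    assume "g \<in> scalings 0"
    then show ?thesis by (rule scalings_residual) (simp add: cI0_def power_int_minus field_simps)
  next
    assume "g \<in> {swapI0}"
    then show ?thesis
      unfolding swapI0_def mat4_eq_blk
      by (auto intro!: residual_blkI simp: Q0_def cI0_def)
  qed
qed

section \<open>Third order Taylor expansion\<close>

text \<open>Cauchy's inequality on the unit circle bounds every coefficient by \<open>M\<close>; for
  |t| at most 1/2 the tail from order 4 on is dominated by a geometric series of sum 2.\<close>

lemma holomorphic_taylor3_remainder:
  fixes f :: "complex \<Rightarrow> complex"
  assumes hol: "f holomorphic_on ball 0 2" and M: "\<And>t. norm t = 1 \<Longrightarrow> norm (f t) \<le> M"
  defines "c \<equiv> \<lambda>n. (deriv ^^ n) f 0 / fact n"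
  shows "norm (c n) \<le> M"
    and "norm t \<le> 1/2 \<Longrightarrow> norm (f t - (\<Sum>k<4. c k * t^k)) \<le> 2 * M * norm t ^ 4"
proof -
  show cM: "norm (c n) \<le> M" for n
  proof -
    have "norm ((deriv ^^ n) f 0) \<le> fact n * M / 1 ^ n"
    proof (rule Cauchy_inequality)
      show "f holomorphic_on ball 0 1"
        using hol by (rule holomorphic_on_subset) auto
      show "continuous_on (cball 0 1) f"
        using holomorphic_on_imp_continuous_on[OF hol] by (rule continuous_on_subset) auto
    qed (use M in auto)
    then show ?thesis by (simp add: c_def norm_divide divide_simps mult.commute)
  qed
  assume t: "norm t \<le> 1/2"
  have "(\<lambda>n. c n * t^n) sums f t"
    using holomorphic_power_series[OF hol, of t] t by (simp add: c_def)
  then have s: "(\<lambda>n. c (n + 4) * t^(n + 4)) sums (f t - (\<Sum>k<4. c k * t^k))"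
    by (subst sums_iff_shift) simp
  have b: "norm (c (n + 4) * t^(n + 4)) \<le> M * norm t ^ 4 * (1/2)^n" for n
  proof -
    have "norm (c (n + 4) * t^(n + 4)) = norm (c (n + 4)) * (norm t ^ 4 * norm t ^ n)"
      by (simp add: norm_mult norm_power power_add)
    also have "\<dots> \<le> M * (norm t ^ 4 * (1/2) ^ n)"
      using cM[of "n + 4"] cM[of 0] t order_trans[OF norm_ge_zero cM]
      by (intro mult_mono power_mono) auto
    finally show ?thesis by simp
  qed
  have g: "(\<lambda>n. M * norm t ^ 4 * (1/2::real)^n) sums (M * norm t ^ 4 * 2)"
    using geometric_sums[of "1/2::real"] by (intro sums_mult) simp
  have "norm (\<Sum>n. c (n + 4) * t^(n + 4)) \<le> (\<Sum>n. M * norm t ^ 4 * (1/2)^n)"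
    by (rule norm_suminf_le[OF b]) (use g in \<open>auto simp: sums_iff\<close>)
  then show "norm (f t - (\<Sum>k<4. c k * t^k)) \<le> 2 * M * norm t ^ 4"
    using s g by (simp add: sums_iff)
qed

lemma eq_0_if_le_eps_norm:
  fixes a :: complex
  assumes "\<And>e. e > 0 \<Longrightarrow> norm a \<le> e" shows "a = 0"
  using field_le_epsilon[of "norm a" 0] assms by auto

text \<open>The coefficients are peeled off from the lowest order: t = 0 gives a, then |b| is at
  most a constant times s for all small s, then |c| is at most every e.\<close>

lemma quadratic_coeffs_small_o:
  fixes a b c :: complex
  assumes small: "\<And>e. e > 0 \<Longrightarrow> \<exists>d>0. \<forall>t. norm t < d \<longrightarrow> norm (a + b * t + c * t^2) \<le> e * norm t ^ 2"
  shows "a = 0" "b = 0" "c = 0"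
proof -
  show a: "a = 0" using small[of 1] by auto (metis add.right_neutral mult_zero_right norm_le_zero_iff norm_zero zero_power2)
  obtain d where d: "d > 0" "\<And>t. norm t < d \<Longrightarrow> norm (b * t + c * t^2) \<le> norm t ^ 2"
    using small[of 1] a by auto
  have b1: "norm b \<le> (1 + norm c) * s" if s: "0 < s" "s < d" for s
  proof -
    have "norm (b * of_real s) \<le> norm (b * of_real s + c * (of_real s)^2) + norm (c * (of_real s)^2)"
      using norm_triangle_ineq4[of "b * of_real s + c * (of_real s)^2" "c * (of_real s)^2"] by simp
    also have "\<dots> \<le> s^2 + norm c * s^2"
      using d(2)[of "of_real s"] s by (simp add: norm_mult norm_power)
    finally have "s * norm b \<le> s * ((1 + norm c) * s)"
      using s by (simp add: norm_mult algebra_simps power2_eq_square)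
    then show ?thesis using s by simp
  qed
  show b: "b = 0"
  proof (rule eq_0_if_le_eps_norm)
    fix e :: real assume e: "e > 0"
    define s where "s = min (d/2) (e / (1 + norm c))"
    have n: "1 + norm c > 0" using norm_ge_zero[of c] by linarith
    have s: "0 < s" "s < d" using d e n by (auto simp: s_def)
    have "(1 + norm c) * s \<le> (1 + norm c) * (e / (1 + norm c))"
      using n by (intro mult_left_mono) (auto simp: s_def)
    then show "norm b \<le> e" using b1[OF s] n by simp
  qed
  show "c = 0"
  proof (rule eq_0_if_le_eps_norm)
    fix e :: real assume "e > 0"
    then obtain d where d: "d > 0" "\<And>t. norm t < d \<Longrightarrow> norm (c * t^2) \<le> e * norm t ^ 2"
      using small[of e] a b by auto
    from d(2)[of "of_real (d/2)"] d(1) show "norm c \<le> e" by (simp add: norm_mult norm_power)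
  qed
qed

section \<open>Recognising cubic polynomials by interpolation on lines\<close>

definition interp_point :: "nat \<Rightarrow> complex" where
  "interp_point m = [0, 1, -1, 2] ! m"

text \<open>The inverse of the Vandermonde matrix of the interpolation points.\<close>
definition interp_coeff :: "nat \<Rightarrow> nat \<Rightarrow> complex" where
  "interp_coeff k m = [[1, 0, 0, 0], [-1/2, 1, -1/3, -1/6], [-1, 1/2, 1/2, 0], [1/2, -1/2, -1/6, 1/6]] ! k ! m"

text \<open>Expressing the coefficients as fixed linear combinations of values keeps control of how
  they depend on further variables when \<open>f\<close> is a function of several variables on a
  line.\<close>

lemma cubic_interpolation:
  assumes "\<And>s. f s = (\<Sum>k<4. a k * s^k)"
  shows "f s = (\<Sum>k<4. (\<Sum>m<4. interp_coeff k m * f (interp_point m)) * s^k)"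
  unfolding assms interp_point_def interp_coeff_def
  by (simp add: eval_nat_numeral) (simp add: field_simps)

text \<open>A polynomial of degree at most 3 in each variable has total degree at most 9; comparing
  the coefficients of t^3 leaves the ten monomials of total degree 3.\<close>

lemma homogeneous_polynomial_part:
  fixes E :: "nat \<Rightarrow> nat \<Rightarrow> nat \<Rightarrow> complex"
  assumes "\<And>t. t^3 * v = (\<Sum>k<4. \<Sum>l<4. \<Sum>p<4. E k l p * (t*x)^k * (t*y)^l * (t*z)^p)"
  shows "v = E 3 0 0 * x^3 + E 0 3 0 * y^3 + E 0 0 3 * z^3 + E 2 1 0 * (x^2 * y) + E 2 0 1 * (x^2 * z)
    + E 1 2 0 * (x * y^2) + E 0 2 1 * (y^2 * z) + E 1 0 2 * (x * z^2) + E 0 1 2 * (y * z^2) + E 1 1 1 * (x * y * z)"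
proof -
  define e where "e n = (\<Sum>k<4. \<Sum>l<4. \<Sum>p<4. if n = k + l + p then E k l p * x^k * y^l * z^p else 0)" for n
  have "(\<Sum>n\<le>9. (if n = 3 then v else 0) * t^n) = (\<Sum>n\<le>9. e n * t^n)" for t
  proof -
    have "(\<Sum>n\<le>9. (if n = 3 then v else 0) * t^n) = t^3 * v"
      by (subst sum.mono_neutral_right[of _ "{3::nat}"]) auto
    also have "\<dots> = (\<Sum>k<4. \<Sum>l<4. \<Sum>p<4. E k l p * x^k * y^l * z^p * t^(k + l + p))"
      unfolding assms by (simp add: power_mult_distrib power_add mult_ac)
    also have "\<dots> = (\<Sum>k<4. \<Sum>l<4. \<Sum>p<4. \<Sum>n\<le>9.
        (if n = k + l + p then E k l p * x^k * y^l * z^p else 0) * t^n)"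
    proof (intro sum.cong refl)
      fix k l p :: nat assume "k \<in> {..<4}" "l \<in> {..<4}" "p \<in> {..<4}"
      then have "k + l + p \<le> 9" by simp
      then show "E k l p * x^k * y^l * z^p * t^(k + l + p) =
          (\<Sum>n\<le>9. (if n = k + l + p then E k l p * x^k * y^l * z^p else 0) * t^n)"
        by (subst sum.mono_neutral_right[of _ "{k + l + p}"]) auto
    qed
    also have "\<dots> = (\<Sum>n\<le>9. e n * t^n)"
      unfolding e_def sum_distrib_right
      by (simp only: sum.swap[where B="{..9::nat}"])
    finally show ?thesis .
  qed
  then have "\<forall>n\<le>9. (if n = 3 then v else 0) = e n"
    using polyfun_eq_coeffs[of "\<lambda>n. if n = 3 then v else 0" 9 e] by auto
  from this[rule_format, of 3] have "v = e 3" by simp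
  then show ?thesis
    by (simp add: e_def eval_nat_numeral)
qed

text \<open>Interpolating in x, then y, then z expresses C by its values on a 4 x 4 x 4 grid, hence
  as a polynomial of degree at most 3 in each variable; homogeneity then selects the cubic
  terms.\<close>

lemma cubic_on_lines:
  fixes C :: "complex^3 \<Rightarrow> complex"
  assumes lines: "\<And>u v. \<exists>a. \<forall>s. C (u + s *s v) = (\<Sum>k<4. a k * s^k)"
    and hom: "\<And>t u. C (t *s u) = t^3 * C u"
  obtains k1 k2 k3 k4 k5 k6 k7 k8 k9 k10 where
    "\<And>x y z. C (vec3 x y z) = k1 * x^3 + k2 * y^3 + k3 * z^3 + k4 * (x^2 * y) + k5 * (x^2 * z) + k6 * (x * y^2)
    + k7 * (y^2 * z) + k8 * (x * z^2) + k9 * (y * z^2) + k10 * (x * y * z)"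
proof -
  define g where "g p m n = (\<Sum>q<4. interp_coeff p q * C (vec3 (interp_point m) (interp_point n) (interp_point q)))"
    for p m n
  define E where "E k l p = (\<Sum>m<4. \<Sum>n<4. interp_coeff k m * interp_coeff l n * g p m n)" for k l p
  have *: "vec3 0 y z + s *s vec3 1 0 0 = vec3 s y z" "vec3 x 0 z + s *s vec3 0 1 0 = vec3 x s z"
     "vec3 x y 0 + s *s vec3 0 0 1 = vec3 x y s" for x y z s
    by (simp_all add: vec3_eq)
  have X: "C (vec3 x y z) = (\<Sum>k<4. (\<Sum>m<4. interp_coeff k m * C (vec3 (interp_point m) y z)) * x^k)" for x y z
    using lines[of "vec3 0 y z" "vec3 1 0 0"] cubic_interpolation[of "\<lambda>s. C (vec3 s y z)"] unfolding * by blast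
  have Y: "C (vec3 x y z) = (\<Sum>k<4. (\<Sum>m<4. interp_coeff k m * C (vec3 x (interp_point m) z)) * y^k)" for x y z
    using lines[of "vec3 x 0 z" "vec3 0 1 0"] cubic_interpolation[of "\<lambda>s. C (vec3 x s z)"] unfolding * by blast
  have Z: "C (vec3 x y z) = (\<Sum>k<4. (\<Sum>m<4. interp_coeff k m * C (vec3 x y (interp_point m))) * z^k)" for x y z
    using lines[of "vec3 x y 0" "vec3 0 0 1"] cubic_interpolation[of "\<lambda>s. C (vec3 x y s)"] unfolding * by blast
  have "C (vec3 x y z) = (\<Sum>k<4. \<Sum>l<4. \<Sum>p<4. E k l p * x^k * y^l * z^p)" for x y z
  proof -
    have "C (vec3 x y z) = (\<Sum>k<4. (\<Sum>m<4. interp_coeff k m * (\<Sum>l<4. (\<Sum>n<4. interp_coeff l n *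
       (\<Sum>p<4. g p m n * z^p)) * y^l)) * x^k)"
      unfolding g_def by (subst X, subst Y, subst Z) simp
    also have "\<dots> = (\<Sum>k<4. \<Sum>m<4. \<Sum>l<4. \<Sum>n<4. \<Sum>p<4.
        interp_coeff k m * interp_coeff l n * g p m n * x^k * y^l * z^p)"
      by (simp add: sum_distrib_left sum_distrib_right mult_ac)
    also have "\<dots> = (\<Sum>k<4. \<Sum>l<4. \<Sum>m<4. \<Sum>n<4. \<Sum>p<4.
        interp_coeff k m * interp_coeff l n * g p m n * x^k * y^l * z^p)"
      by (rule sum.cong[OF refl], rule sum.swap)
    also have "\<dots> = (\<Sum>k<4. \<Sum>l<4. \<Sum>m<4. \<Sum>p<4. \<Sum>n<4.
        interp_coeff k m * interp_coeff l n * g p m n * x^k * y^l * z^p)"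
      by (rule sum.cong[OF refl], rule sum.cong[OF refl], rule sum.cong[OF refl], rule sum.swap)
    also have "\<dots> = (\<Sum>k<4. \<Sum>l<4. \<Sum>p<4. \<Sum>m<4. \<Sum>n<4.
        interp_coeff k m * interp_coeff l n * g p m n * x^k * y^l * z^p)"
      by (rule sum.cong[OF refl], rule sum.cong[OF refl], rule sum.swap)
    also have "\<dots> = (\<Sum>k<4. \<Sum>l<4. \<Sum>p<4. E k l p * x^k * y^l * z^p)"
      by (simp add: E_def sum_distrib_right)
    finally show ?thesis .
  qed
  moreover have "t^3 * C (vec3 x y z) = C (vec3 (t*x) (t*y) (t*z))" for t x y z
  proof -
    have "t *s vec3 x y z = vec3 (t*x) (t*y) (t*z)" by (simp add: vec3_eq)
    then show ?thesis using hom[of t "vec3 x y z"] by simp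
  qed
  ultimately have "t^3 * C (vec3 x y z) = (\<Sum>k<4. \<Sum>l<4. \<Sum>p<4. E k l p * (t*x)^k * (t*y)^l * (t*z)^p)" for t x y z
    by simp
  from that[OF homogeneous_polynomial_part[OF this]] show thesis .
qed

lemma line_coeff_scale:
  assumes G: "cholo U G" "0 \<in> U"
  shows "(deriv ^^ n) (\<lambda>t. G (t *s (s *s w))) 0 = s^n * (deriv ^^ n) (\<lambda>t. G (t *s w)) 0"
proof -
  have cont: "continuous_on UNIV (\<lambda>t. t *s v)" for v :: "complex^3"
    by (intro linear_continuous_on bounded_linear_cscale_left)
  have op: "open {t. t *s v \<in> U}" for v
    using continuous_open_preimage[OF cont open_UNIV, of U] G(1) by (simp add: cholo_def vimage_def)
  have hol: "(\<lambda>t. G (t *s v)) holomorphic_on {t. t *s v \<in> U}" for v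
    using cholo_line_holomorphic[OF G(1), of "{t. t *s v \<in> U}" 0 v] by simp
  have "(deriv ^^ n) (\<lambda>t. (\<lambda>t. G (t *s w)) (s * t)) 0 = s^n * (deriv ^^ n) (\<lambda>t. G (t *s w)) (s * 0)"
    by (rule higher_deriv_compose_linear[OF hol op[of "s *s w"] op])
      (use G(2) in \<open>auto simp: vector_smult_assoc mult.commute\<close>)
  then show ?thesis by (simp add: vector_smult_assoc mult.commute)
qed

text \<open>C(w) is the third Taylor coefficient at 0 of t -> G(t w). It is homogeneous by
  construction. On the line u + s v it is a locally uniform limit of rescalings of G, hence entire
  in s, and its cubic growth makes it a polynomial of degree at most 3 by Liouville.\<close>

lemma taylor_cubic:
  assumes G: "cholo U G" "0 \<in> U"
    and qhom: "\<And>t u. q (t *s u) = t^2 * q u"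
    and qhol: "\<And>u v. (\<lambda>s. q (u + s *s v)) holomorphic_on UNIV"
    and q: "\<And>e. e > 0 \<Longrightarrow> \<exists>d>0. \<forall>u. norm u < d \<longrightarrow> norm (G u - q u) \<le> e * norm u ^ 2"
  obtains C r K where "r > 0" "ball 0 r \<subseteq> U"
    "\<And>u. norm u < r \<Longrightarrow> norm (G u - q u - C u) \<le> K * norm u ^ 4"
    "\<And>t u. C (t *s u) = t^3 * C u"
    "\<And>u v. \<exists>a. \<forall>s. C (u + s *s v) = (\<Sum>k<4. a k * s^k)"
proof -
  have "open U" using G by (simp add: cholo_def)
  then obtain R where R: "R > 0" "cball 0 R \<subseteq> U"
    using G(2) open_contains_cball by blast
  \<comment> \<open>For |w| at most r and |t| at most 2 the point t w stays in the ball of radius R,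
    so t -> G(t w) is holomorphic on a disc of radius 2.\<close>
  define r where "r = R / 2"
  have r: "r > 0" using R by (simp add: r_def)
  have "compact (G ` cball 0 R)"
    using cholo_continuous_on[OF G(1)] R by (intro compact_continuous_image compact_cball) (auto intro: continuous_on_subset)
  then have "bounded (G ` cball 0 R)" by (rule compact_imp_bounded)
  then obtain M where "\<forall>u\<in>cball 0 R. norm (G u) \<le> M" by (auto simp: bounded_iff)
  then have M: "norm (G u) \<le> M" if "norm u \<le> R" for u using that by simp
  have M0: "M \<ge> 0" using M[of 0] R order_trans[OF norm_ge_zero] by fastforce
  define c where "c n w = (deriv ^^ n) (\<lambda>t. G (t *s w)) 0 / fact n" for n w
  have hom: "c n (s *s w) = s^n * c n w" for n s w
    unfolding c_def line_coeff_scale[OF G] by simp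
  have c0: "c n 0 = 0" if "n > 0" for n
    using hom[of n 0 0] that by (simp add: power_0_left)
  have exp: "norm (c n w) \<le> M" "norm t \<le> 1/2 \<Longrightarrow> norm (G (t *s w) - (\<Sum>k<4. c k w * t^k)) \<le> 2 * M * norm t ^ 4"
    if w: "norm w \<le> r" for n t w
  proof -
    have *: "norm (t *s w) \<le> R" if "norm t \<le> 2" for t
      using mult_mono[of "norm t" 2 "norm w" r] w that r by (simp add: norm_cscale r_def)
    have hol: "(\<lambda>t. G (t *s w)) holomorphic_on ball 0 2"
      using cholo_line_holomorphic[OF G(1), of "ball 0 2" 0 w] * R by (force simp: subset_iff)
    show "norm (c n w) \<le> M" "norm t \<le> 1/2 \<Longrightarrow> norm (G (t *s w) - (\<Sum>k<4. c k w * t^k)) \<le> 2 * M * norm t ^ 4"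
      unfolding c_def using holomorphic_taylor3_remainder[OF hol, of M] M * by auto
  qed
  \<comment> \<open>The Taylor polynomial and the assumed o(|u|^2) expansion along the line through
    w must have the same coefficients up to order 2.\<close>
  have low: "c 0 w = 0" "c 1 w = 0" "c 2 w = q w" if w: "norm w \<le> r" for w
  proof -
    have "\<exists>d>0. \<forall>t. norm t < d \<longrightarrow> norm (c 0 w + c 1 w * t + (c 2 w - q w) * t^2) \<le> e * norm t ^ 2"
      if e: "e > 0" for e
    proof -
      define e' where "e' = e / (2 * (r^2 + 1))"
      have rr: "r^2 + 1 > 0" by (simp add: add_nonneg_pos)
      have e': "e' > 0" using e rr by (simp add: e'_def)
      obtain d where d: "d > 0" "\<And>u. norm u < d \<Longrightarrow> norm (G u - q u) \<le> e' * norm u ^ 2"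
        using q[OF e'] by blast
      \<comment> \<open>In this order: the range of the Taylor bound, membership of t w in the
        region of the o-estimate, and absorption of the terms of order 3 and 4 into e/2 *
        |t|^2.\<close>
      define d' where "d' = min (1/2) (min (d / (r + 1)) (e / (2 * (2 * M + 1))))"
      have d': "d' > 0" using d e M0 r by (simp add: d'_def)
      have "norm (c 0 w + c 1 w * t + (c 2 w - q w) * t^2) \<le> e * norm t ^ 2" if t: "norm t < d'" for t
      proof -
        have t2: "norm t \<le> 1/2" using t by (simp add: d'_def)
        have tw: "norm (t *s w) \<le> norm t * r" using w by (simp add: norm_cscale mult_left_mono)
        have "norm t * (r + 1) < d" using t r by (simp add: d'_def pos_less_divide_eq)
        then have twd: "norm (t *s w) < d" using tw by (simp add: algebra_simps) (smt (verit) norm_ge_zero)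
        have "norm (G (t *s w) - q (t *s w)) \<le> e' * (norm t * r)^2"
          using d(2)[OF twd] power_mono[OF tw norm_ge_zero, of 2] e'
          by (meson less_imp_le mult_left_mono order_trans)
        also have "\<dots> \<le> e / 2 * norm t ^ 2"
        proof -
          have "e' * r^2 \<le> e' * (r^2 + 1)" using e' by simp
          also have "\<dots> = e / 2" using rr unfolding e'_def by (metis nonzero_divide_mult_cancel_right
              divide_divide_eq_left less_irrefl mult.commute nonzero_eq_divide_eq)
          finally show ?thesis using mult_right_mono[of "e' * r^2" "e / 2" "norm t ^ 2"]
            by (simp add: power_mult_distrib mult_ac)
        qed
        finally have 1: "norm (G (t *s w) - q (t *s w)) \<le> e / 2 * norm t ^ 2" .
        have 2: "norm (G (t *s w) - (\<Sum>k<4. c k w * t^k)) \<le> 2 * M * norm t ^ 4"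
          using exp(2)[OF w t2] .
        have 3: "norm (c 3 w * t^3) \<le> M * norm t ^ 3"
          using exp(1)[OF w, of 3] by (simp add: norm_mult norm_power mult_right_mono)
        have eq: "c 0 w + c 1 w * t + (c 2 w - q w) * t^2
          = (G (t *s w) - q (t *s w)) - (G (t *s w) - (\<Sum>k<4. c k w * t^k)) - c 3 w * t^3"
          by (simp add: qhom eval_nat_numeral algebra_simps)
        have "norm (c 0 w + c 1 w * t + (c 2 w - q w) * t^2) \<le> e / 2 * norm t ^ 2 + 2 * M * norm t ^ 4 + M * norm t ^ 3"
          unfolding eq using 1 2 3
            norm_triangle_ineq4[of "(G (t *s w) - q (t *s w)) - (G (t *s w) - (\<Sum>k<4. c k w * t^k))" "c 3 w * t^3"]
            norm_triangle_ineq4[of "G (t *s w) - q (t *s w)" "G (t *s w) - (\<Sum>k<4. c k w * t^k)"]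
          by linarith
        also have "\<dots> \<le> e / 2 * norm t ^ 2 + (2 * M + 1) * norm t * norm t ^ 2"
        proof -
          have "2 * M * norm t ^ 4 = (2 * norm t) * M * norm t ^ 3" by (simp add: eval_nat_numeral)
          also have "\<dots> \<le> 1 * M * norm t ^ 3"
            using t2 M0 by (intro mult_right_mono) auto
          also have "\<dots> + M * norm t ^ 3 \<le> (2 * M + 1) * norm t ^ 3"
            by (simp add: algebra_simps)
          finally show ?thesis by (simp add: eval_nat_numeral algebra_simps)
        qed
        also have "\<dots> \<le> e / 2 * norm t ^ 2 + e / 2 * norm t ^ 2"
        proof -
          have "norm t < e / (2 * (2 * M + 1))" using t by (simp add: d'_def)
          then have "(2 * M + 1) * norm t \<le> e / 2" using M0 by (simp add: field_simps)
          then show ?thesis using mult_right_mono[of "(2 * M + 1) * norm t" "e / 2" "norm t ^ 2"] by simp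
        qed
        finally show ?thesis by simp
      qed
      with d' show ?thesis by blast
    qed
    from quadratic_coeffs_small_o[OF this] show "c 0 w = 0" "c 1 w = 0" "c 2 w = q w" by simp_all
  qed
  have q0: "q 0 = 0" using qhom[of 0 0] by simp
  define K where "K = 2 * M / r^4"
  have K0: "K \<ge> 0" using M0 r by (simp add: K_def)
  have bound: "norm (G u - q u - c 3 u) \<le> K * norm u ^ 4" if u: "norm u < r / 2" for u
  proof (cases "u = 0")
    case True
    then show ?thesis using low(1)[of 0] r by (simp add: c0 q0 c_def)
  next
    case False
    \<comment> \<open>u is moved to the sphere of radius r, where the coefficient bounds are uniform
      in the direction; |u| < r/2 becomes |t| < 1/2.\<close>
    define w where "w = of_real (r / norm u) *s u"
    define t where "t = complex_of_real (norm u / r)"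
    have w: "norm w \<le> r" using False r by (simp add: w_def norm_cscale norm_divide)
    have t: "norm t = norm u / r" "norm t \<le> 1/2" using r u by (auto simp: t_def norm_divide)
    have u_eq: "u = t *s w"
      using False r by (simp add: w_def t_def vector_smult_assoc)
    have "norm (G u - q u - c 3 u) = norm (G (t *s w) - (\<Sum>k<4. c k w * t^k))"
      using low[OF w] by (simp add: u_eq hom qhom eval_nat_numeral algebra_simps)
    also have "\<dots> \<le> 2 * M * norm t ^ 4" using exp(2)[OF w t(2)] .
    finally show ?thesis by (simp add: t(1) K_def power_divide)
  qed
  have growth: "norm (c 3 u) \<le> M / r^3 * norm u ^ 3" for u
  proof (cases "u = 0")
    case True
    then show ?thesis using c0[of 3] by simp
  next
    case False
    define w where "w = of_real (r / norm u) *s u"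
    have w: "norm w \<le> r" using False r by (simp add: w_def norm_cscale norm_divide)
    have "norm (c 3 w) = (r / norm u)^3 * norm (c 3 u)"
      using r by (simp add: w_def hom norm_mult norm_power norm_divide)
    then have "(r / norm u)^3 * norm (c 3 u) \<le> M" using exp(1)[OF w, of 3] by simp
    then show ?thesis using False r by (simp add: field_simps)
  qed
  have lines: "\<exists>a. \<forall>s. c 3 (u + s *s v) = (\<Sum>k<4. a k * s^k)" for u v
  proof -
    define h where "h s = c 3 (u + s *s v)" for s
    have "h holomorphic_on ball 0 B" if B: "B > 0" for B
    proof -
      define N where "N = norm u + B * norm v + 1"
      have N: "N > 0" using B by (simp add: N_def add_nonneg_pos)
      have nb: "norm (u + s *s v) \<le> N" if "norm s \<le> B" for s
        using norm_triangle_ineq[of u "s *s v"] mult_right_mono[OF that, of "norm v"]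
        by (simp add: N_def norm_cscale)
      \<comment> \<open>By homogeneity the rescaled quotient differs from \<open>h\<close> by the
        fourth-order remainder divided by \<tau>^3, which is at most \<tau> K N^4 uniformly for |s|
        at most B.\<close>
      define H where "H \<tau> s = (G (of_real \<tau> *s (u + s *s v)) - (of_real \<tau>)^2 * q (u + s *s v)) / (of_real \<tau>)^3"
        for \<tau> :: real and s
      have small: "norm (of_real \<tau> *s (u + s *s v)) < r / 2" if "0 < \<tau>" "\<tau> < r / (2 * N)" "norm s \<le> B" for \<tau> s
      proof -
        have "norm (of_real \<tau> *s (u + s *s v)) \<le> \<tau> * N"
          unfolding norm_cscale using nb[OF that(3)] that by (simp add: mult_left_mono)
        also have "\<dots> < r / 2" using that N by (simp add: field_simps)
        finally show ?thesis .
      qed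
      have e1: "\<forall>\<^sub>F \<tau> in at_right 0. 0 < \<tau> \<and> \<tau> < x" if "x > 0" for x :: real
        using that eventually_at_right_field by blast
      have ballU: "w \<in> U" if "norm w < r / 2" for w
        using that R r by (auto simp: r_def subset_iff)
      show ?thesis
      proof (rule holomorphic_uniform_limit[of 0 B H "at_right 0" h])
        have "continuous_on (cball 0 B) (H \<tau>) \<and> H \<tau> holomorphic_on ball 0 B"
          if \<tau>: "0 < \<tau> \<and> \<tau> < r / (2 * N)" for \<tau>
        proof -
          have "(\<lambda>s. G (of_real \<tau> *s u + s *s (of_real \<tau> *s v))) holomorphic_on cball 0 B"
            using small[of \<tau>] \<tau> ballU
            by (intro cholo_line_holomorphic[OF G(1)])
              (auto simp: vector_add_ldistrib vector_smult_assoc mult.commute)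
          then have "(\<lambda>s. G (of_real \<tau> *s (u + s *s v))) holomorphic_on cball 0 B"
            by (simp add: vector_add_ldistrib vector_smult_assoc mult.commute)
          then have "H \<tau> holomorphic_on cball 0 B"
            unfolding H_def using \<tau> holomorphic_on_subset[OF qhol, of "cball 0 B" u v]
            by (intro holomorphic_intros) auto
          then show ?thesis
            by (meson ball_subset_cball holomorphic_on_imp_continuous_on holomorphic_on_subset)
        qed
        then show "\<forall>\<^sub>F \<tau> in at_right 0. continuous_on (cball 0 B) (H \<tau>) \<and> H \<tau> holomorphic_on ball 0 B"
          using e1[of "r / (2 * N)"] r N by (auto elim: eventually_mono)
        show "uniform_limit (cball 0 B) H h (at_right 0)"
          unfolding uniform_limit_iff
        proof (intro allI impI)
          fix e :: real assume e: "e > 0"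
          define x where "x = min (r / (2 * N)) (e / (K * N^4 + 1))"
          have KN: "K * N^4 + 1 > 0" using K0 N by (simp add: add_nonneg_pos)
          have "x > 0" using r N e KN by (simp add: x_def)
          have "dist (H \<tau> s) (h s) < e" if \<tau>: "0 < \<tau> \<and> \<tau> < x" and s: "s \<in> cball 0 B" for \<tau> s
          proof -
            let ?w = "u + s *s v" and ?t = "of_real \<tau> :: complex"
            have s': "norm s \<le> B" using s by simp
            have t: "0 < \<tau>" "\<tau> < r / (2 * N)" "\<tau> < e / (K * N^4 + 1)" using \<tau> by (auto simp: x_def)
            define D where "D = G (?t *s ?w) - q (?t *s ?w) - c 3 (?t *s ?w)"
            have "norm D \<le> K * norm (?t *s ?w) ^ 4"
              unfolding D_def using bound small[OF t(1,2) s'] by blast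
            also have "\<dots> \<le> K * (\<tau> * N) ^ 4"
              unfolding norm_cscale using nb[OF s'] t K0
              by (intro mult_left_mono power_mono mult_mono) auto
            finally have le: "norm D \<le> \<tau> * (K * N ^ 4) * \<tau>^3"
              by (simp add: power_mult_distrib mult_ac eval_nat_numeral)
            have "D = G (?t *s ?w) - ?t^2 * q ?w - ?t^3 * c 3 ?w"
              unfolding D_def hom qhom ..
            then have "H \<tau> s - h s = D / ?t^3"
              using t(1) unfolding H_def h_def by (simp add: diff_divide_distrib)
            then have "norm (H \<tau> s - h s) = norm D / \<tau>^3"
              using t(1) by (simp add: norm_divide norm_power)
            also have "\<dots> \<le> \<tau> * (K * N ^ 4)"
              using le t(1) by (simp add: pos_divide_le_eq)
            finally have "norm (H \<tau> s - h s) \<le> \<tau> * (K * N ^ 4)" .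
            also have "\<dots> \<le> \<tau> * (K * N ^ 4 + 1)" using t by simp
            also have "\<dots> < e" using t(3) KN by (simp add: field_simps)
            finally show ?thesis by (simp add: dist_norm)
          qed
          then show "\<forall>\<^sub>F \<tau> in at_right 0. \<forall>s\<in>cball 0 B. dist (H \<tau> s) (h s) < e"
            using e1[OF \<open>x > 0\<close>] by (auto elim: eventually_mono)
        qed
      qed auto
    qed
    then have hol: "h holomorphic_on UNIV"
    proof -
      assume *: "\<And>B. B > 0 \<Longrightarrow> h holomorphic_on ball 0 B"
      have "h field_differentiable at s" for s
        using *[of "norm s + 1"] by (rule holomorphic_on_imp_differentiable_at) (auto simp: add_nonneg_pos)
      then show ?thesis by (simp add: holomorphic_on_def field_differentiable_at_within)
    qed
    \<comment> \<open>For |s| at least 1, |u + s v| is at most (|u| + |v|)|s|, so the bound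
      \<open>growth\<close> becomes a cubic bound in s as Liouville's theorem requires.\<close>
    have "norm (h s) \<le> M / r^3 * (norm u + norm v)^3 * norm s ^ 3" if s: "1 \<le> norm s" for s
    proof -
      have "norm (u + s *s v) \<le> norm u + norm s * norm v"
        using norm_triangle_ineq[of u "s *s v"] by (simp add: norm_cscale)
      also have "\<dots> \<le> (norm u + norm v) * norm s"
        using mult_right_mono[OF s, of "norm u"] by (simp add: algebra_simps)
      finally have "norm (u + s *s v)^3 \<le> ((norm u + norm v) * norm s)^3"
        by (intro power_mono) auto
      then have "M / r^3 * norm (u + s *s v)^3 \<le> M / r^3 * ((norm u + norm v) * norm s)^3"
        using M0 r by (intro mult_left_mono) auto
      then show ?thesis using growth[of "u + s *s v"] by (simp add: h_def power_mult_distrib)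
    qed
    then have "h s = (\<Sum>k\<le>3. (deriv ^^ k) h 0 / fact k * s^k)" for s
      using Liouville_polynomial[OF hol] by blast
    moreover have "{..3} = {..<4::nat}" by auto
    ultimately show ?thesis
      by (intro exI[of _ "\<lambda>k. (deriv ^^ k) h 0 / fact k"]) (simp add: h_def)
  qed
  show thesis
  proof (rule that[of "r / 2" "c 3" K])
    show "ball 0 (r / 2) \<subseteq> U" using R r by (auto simp: r_def subset_iff)
  qed (use r bound hom lines in auto)
qed

section \<open>Affine changes of charts\<close>

text \<open>\<open>nf_chart\<close> without its expansion, so that coordinates can be changed
  before, or independently of, any estimate on the graph function.\<close>

definition gchart ::
  "(complex^4) set \<Rightarrow> complex^4^4 \<Rightarrow> complex^4 \<Rightarrow> (complex^3) set \<Rightarrow> (complex^3 \<Rightarrow> complex) \<Rightarrow> bool" where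
  "gchart S L b U F \<longleftrightarrow> invertible L \<and> cholo U F \<and> 0 \<in> U \<and>
     (\<exists>V. open V \<and> 0 \<in> V \<and> (\<lambda>q. L *v q + b) ` S \<inter> V = (\<lambda>u. lift u (F u)) ` U \<inter> V)"

lemma nf_chart_gchart:
  "nf_chart S L b U F C \<longleftrightarrow> gchart S L b U F \<and>
     (\<exists>K d. d > 0 \<and> (\<forall>u\<in>U. norm u < d \<longrightarrow> norm (F u - Q0 u - C u) \<le> K * norm u ^ 4))"
  by (auto simp: nf_chart_def gchart_def)

lemma continuous_matrix: "continuous_on A ((*v) (M :: complex^'n^'m))"
  by (intro linear_continuous_on bounded_linear_matrix)

lemma open_affine_preimage: "open V \<Longrightarrow> open {q. M *v q + b \<in> V}" for M :: "complex^'n^'m"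
proof -
  assume "open V"
  moreover have "continuous_on UNIV (\<lambda>q. M *v q + b)"
    by (intro continuous_on_add continuous_matrix continuous_on_const)
  ultimately show ?thesis
    using continuous_open_preimage[of UNIV "\<lambda>q. M *v q + b" V] by (simp add: vimage_def)
qed

lemma open_proj3_preimage: "open B \<Longrightarrow> open {p. proj3 p \<in> B}"
  using continuous_open_preimage[of UNIV proj3 B] linear_continuous_on[OF bounded_linear_proj3]
  by (auto simp: vimage_def)

text \<open>\<open>graph_chart\<close> maps the graph into space while \<open>gchart\<close> maps
  \<open>S\<close> to the graph, hence the inverse affine map; \<open>b \<in> V\<close> places the
  origin in the new neighbourhood.\<close>

lemma graph_chart_gchart:
  assumes "graph_chart S L b U G V" "b \<in> V" "0 \<in> U"
  shows "gchart S (matrix_inv L) (- (matrix_inv L *v b)) U G"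
proof -
  have inv: "invertible L" and V: "open V" and G: "cholo U G"
    and eq: "S \<inter> V = (\<lambda>u. L *v lift u (G u) + b) ` U \<inter> V"
    using assms by (auto simp: graph_chart_def)
  let ?T = "\<lambda>q. matrix_inv L *v q + - (matrix_inv L *v b)"
  have T1: "?T (L *v q + b) = q" and T2: "L *v ?T q + b = q" for q
    using inv by (simp_all add: matrix_vector_right_distrib matrix_vector_mult_diff_distrib matrix_inv_mult_vec)
  let ?V = "{q. L *v q + b \<in> V}"
  have "x \<in> ?T ` S \<inter> ?V \<longleftrightarrow> L *v x + b \<in> S \<inter> V" for x
    using T1 T2 by (auto simp: image_iff) metis+
  moreover have "x \<in> (\<lambda>u. lift u (G u)) ` U \<inter> ?V \<longleftrightarrow> L *v x + b \<in> (\<lambda>u. L *v lift u (G u) + b) ` U \<inter> V" for x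
    using T1 by (auto simp: image_iff) metis+
  ultimately have "?T ` S \<inter> ?V = (\<lambda>u. lift u (G u)) ` U \<inter> ?V"
    using eq by blast
  then show ?thesis
    unfolding gchart_def using inv G assms open_affine_preimage[OF V]
    by (intro conjI exI[of _ ?V]) (auto simp: invertible_matrix_inv)
qed

text \<open>Passing to a smaller base \<open>B\<close> is harmless because
  \<open>proj3 p \<in> B\<close> is an open condition on the ambient point and can be absorbed into
  the neighbourhood.\<close>

lemma gchart_map:
  assumes "gchart S L b U F" "B \<subseteq> U" "open B" "0 \<in> B" and N: "invertible N"
    and F': "cholo U' F'" "0 \<in> U'"
    and graph: "(\<lambda>u. N *v lift u (F u)) ` B = (\<lambda>u. lift u (F' u)) ` U'"
  shows "gchart S (N ** L) (N *v b) U' F'"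
proof -
  obtain V where V: "open V" "0 \<in> V" and eq: "(\<lambda>q. L *v q + b) ` S \<inter> V = (\<lambda>u. lift u (F u)) ` U \<inter> V"
    and L: "invertible L"
    using assms(1) by (auto simp: gchart_def)
  let ?V = "{q. matrix_inv N *v q + 0 \<in> V \<inter> {p. proj3 p \<in> B}}"
  have "open ?V"
    by (intro open_affine_preimage open_Int V open_proj3_preimage assms)
  moreover have "(\<lambda>q. (N ** L) *v q + N *v b) ` S \<inter> ?V = (\<lambda>u. lift u (F' u)) ` U' \<inter> ?V"
  proof -
    have "x \<in> (\<lambda>q. (N ** L) *v q + N *v b) ` S \<longleftrightarrow> matrix_inv N *v x \<in> (\<lambda>q. L *v q + b) ` S" for x
      using matrix_inv_mult_vec[OF N]
      by (auto simp: image_iff matrix_vector_mul_assoc[symmetric] matrix_vector_right_distrib[symmetric]) metis+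
    moreover have "x \<in> (\<lambda>u. lift u (F' u)) ` U' \<longleftrightarrow> matrix_inv N *v x \<in> (\<lambda>u. lift u (F u)) ` B" for x
      unfolding graph[symmetric] using matrix_inv_mult_vec[OF N] by (auto simp: image_iff) metis+
    moreover have "x \<in> (\<lambda>u. lift u (F u)) ` B \<longleftrightarrow> x \<in> (\<lambda>u. lift u (F u)) ` U \<and> proj3 x \<in> B" for x
      using \<open>B \<subseteq> U\<close> by auto
    moreover have "y \<in> (\<lambda>q. L *v q + b) ` S \<and> y \<in> V \<longleftrightarrow> y \<in> (\<lambda>u. lift u (F u)) ` U \<and> y \<in> V" for y
      using eq by blast
    ultimately show ?thesis by (intro set_eqI) (simp only: Int_iff mem_Collect_eq add_0_right, blast)
  qed
  ultimately show ?thesis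
    unfolding gchart_def using F' N L V \<open>0 \<in> B\<close>
    by (intro conjI exI[of _ ?V]) (auto simp: invertible_mult)
qed

lemma gchart_linear:
  assumes S: "gchart S L b U F" and R: "invertible R" and c: "c \<noteq> 0"
  obtains L' b' where "gchart S L' b' {u. R *v u \<in> U} (\<lambda>u. F (R *v u) / c)"
proof -
  have F: "cholo U F" "0 \<in> U" using S by (auto simp: gchart_def)
  let ?U = "{u. R *v u \<in> U}" and ?F = "\<lambda>u. F (R *v u) / c"
  have U: "open ?U" using open_affine_preimage[of U R 0] F by (simp add: cholo_def)
  have "\<exists>D. (?F has_derivative D) (at u) \<and> (\<forall>c v. D (c *s v) = c * D v)" if u: "u \<in> ?U" for u
  proof -
    obtain D where D: "(F has_derivative D) (at (R *v u))" "\<And>c v. D (c *s v) = c * D v"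
      using choloD[OF F(1)] u by blast
    have "((*v) R has_derivative (*v) R) (at u)"
      by (rule bounded_linear_imp_has_derivative[OF bounded_linear_matrix])
    from has_derivative_compose[OF this D(1)]
    have "(?F has_derivative (\<lambda>v. D (R *v v) / c)) (at u)"
      unfolding divide_inverse by (rule has_derivative_mult_left)
    then show ?thesis using D(2) by (intro exI) (auto simp: matrix_scale)
  qed
  then have cholo: "cholo ?U ?F" using U by (simp add: cholo_def)
  \<comment> \<open>Substituting R u into the function means applying the inverse of R to the
    points.\<close>
  let ?N = "blk (matrix_inv R) 0 (1 / c)"
  have "(\<lambda>u. ?N *v lift u (F u)) ` U = (\<lambda>u. lift u (?F u)) ` ?U"
  proof (intro equalityI subsetI)
    fix x assume "x \<in> (\<lambda>u. ?N *v lift u (F u)) ` U"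
    then obtain u where "u \<in> U" "x = ?N *v lift u (F u)" by blast
    then have "x = lift (matrix_inv R *v u) (?F (matrix_inv R *v u))" "matrix_inv R *v u \<in> ?U"
      using R by (auto simp: blk_mult matrix_inv_mult_vec)
    then show "x \<in> (\<lambda>u. lift u (?F u)) ` ?U" by blast
  next
    fix x assume "x \<in> (\<lambda>u. lift u (?F u)) ` ?U"
    then obtain u where "R *v u \<in> U" "x = lift u (?F u)" by blast
    then have "x = ?N *v lift (R *v u) (F (R *v u))"
      using R by (auto simp: blk_mult matrix_inv_mult_vec)
    then show "x \<in> (\<lambda>u. ?N *v lift u (F u)) ` U" using \<open>R *v u \<in> U\<close> by blast
  qed
  from gchart_map[OF S order_refl _ F(2) _ cholo _ this] have "gchart S (?N ** L) (?N *v b) ?U ?F"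
    using R c F by (auto simp: cholo_def invertible_blk invertible_matrix_inv)
  then show thesis by (rule that)
qed

lemma matrix_norm_bound:
  fixes R :: "complex^'n^'m"
  obtains B where "B > 0" "\<And>u. norm (R *v u) \<le> B * norm u"
  using bounded_linear.pos_bounded[OF bounded_linear_matrix[of R]] by (metis mult.commute)

text \<open>Dividing w by the conformal factor \<open>c\<close> restores the quadratic part exactly,
  so only the cubic changes; the remainder grows by B^4 / |c|.\<close>

lemma nf_chart_linear:
  assumes S: "nf_chart S L b U F C" and R: "invertible R" and c: "c \<noteq> 0"
    and Q: "\<And>u. Q0 (R *v u) = c * Q0 u"
  shows "\<exists>L' b' U' F'. nf_chart S L' b' U' F' (\<lambda>u. C (R *v u) / c)"
proof -
  obtain K d where d: "d > 0" and K: "\<And>u. u \<in> U \<Longrightarrow> norm u < d \<Longrightarrow> norm (F u - Q0 u - C u) \<le> K * norm u ^ 4"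
    and g: "gchart S L b U F"
    using S unfolding nf_chart_gchart by blast
  obtain L' b' where g': "gchart S L' b' {u. R *v u \<in> U} (\<lambda>u. F (R *v u) / c)"
    using gchart_linear[OF g R c] .
  obtain B where B: "B > 0" "\<And>u. norm (R *v u) \<le> B * norm u"
    using matrix_norm_bound[of R] by blast
  have "norm (F (R *v u) / c - Q0 u - C (R *v u) / c) \<le> (\<bar>K\<bar> * B^4 / norm c) * norm u ^ 4"
    if u: "R *v u \<in> U" "norm u < d / B" for u
  proof -
    have "B * norm u < d" using u(2) B(1) by (simp add: field_simps)
    then have "norm (R *v u) < d" using B(2)[of u] by linarith
    then have "norm (F (R *v u) - Q0 (R *v u) - C (R *v u)) \<le> K * norm (R *v u) ^ 4"
      using K u(1) by blast
    also have "\<dots> \<le> \<bar>K\<bar> * (B * norm u) ^ 4"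
      using B by (intro mult_mono power_mono) auto
    finally have *: "norm (F (R *v u) - Q0 (R *v u) - C (R *v u)) \<le> \<bar>K\<bar> * (B * norm u) ^ 4" .
    have "F (R *v u) / c - Q0 u - C (R *v u) / c = (F (R *v u) - Q0 (R *v u) - C (R *v u)) / c"
      using c by (simp add: Q diff_divide_distrib)
    then have "norm (F (R *v u) / c - Q0 u - C (R *v u) / c) = norm (F (R *v u) - Q0 (R *v u) - C (R *v u)) / norm c"
      by (simp add: norm_divide)
    also have "\<dots> \<le> (\<bar>K\<bar> * (B * norm u) ^ 4) / norm c"
      using * by (rule divide_right_mono) simp
    finally show ?thesis by (simp add: power_mult_distrib)
  qed
  then have "\<forall>u\<in>{u. R *v u \<in> U}. norm u < d / B \<longrightarrow>
      norm (F (R *v u) / c - Q0 u - C (R *v u) / c) \<le> (\<bar>K\<bar> * B^4 / norm c) * norm u ^ 4"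
    by blast
  moreover have "d / B > 0" using d B by simp
  ultimately show ?thesis
    unfolding nf_chart_gchart using g' by blast
qed

text \<open>Changing the transversal direction by \<open>u \<mapsto> u + F u *s a\<close> is a local biholomorphism because
  the derivative of \<open>F\<close> is small near the origin.\<close>
lemma gchart_shear:
  assumes S: "gchart S L b U F" and d: "d > 0"
    and K: "\<And>u. norm u < d \<Longrightarrow> u \<in> U \<and> norm (F u) \<le> K * norm u ^ 2"
  obtains L' b' U' F' where "gchart S L' b' U' F'"
    "\<And>v. v \<in> U' \<Longrightarrow> \<exists>u. norm u < d \<and> v = u + F u *s a \<and> F' v = F u \<and> norm u \<le> 2 * norm v"
proof -
  have F: "cholo U F" "0 \<in> U" using S by (auto simp: gchart_def)
  have F0: "F 0 = 0" using K[of 0] d by auto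
  \<comment> \<open>Chosen so that \<open>r * P \<le> 1\<close> yields
    \<open>m * norm a \<le> 1/2\<close>. The other bound d/3 keeps balls of radius r about points of
    \<open>?B\<close>, which reach radius 2r, inside the domain of the estimate.\<close>
  define P where "P = 8 * (\<bar>K\<bar> + 1) * (norm a + 1)"
  have P: "P > 0" unfolding P_def by (intro mult_pos_pos) (auto simp: add_nonneg_pos)
  define r where "r = min (d / 3) (1 / P)"
  have "r \<le> 1 / P" "r \<le> d / 3" by (simp_all add: r_def)
  then have r: "r > 0" "2 * r < d" "r * P \<le> 1"
    using d P by (simp add: r_def, linarith, simp only: pos_le_divide_eq)
  \<comment> \<open>Cauchy's bound for the derivative on a ball of radius r, where |F| is at most
    (|K| + 1)(2r)^2.\<close>
  define m where "m = 4 * (\<bar>K\<bar> + 1) * r"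
  have m0: "m \<ge> 0" using r by (simp add: m_def)
  have ma: "m * norm a \<le> 1/2"
  proof -
    have "m * norm a \<le> m * (norm a + 1)" using m0 by (intro mult_left_mono) auto
    also have "\<dots> \<le> 1/2" using r(3) by (simp add: m_def P_def algebra_simps)
    finally show ?thesis .
  qed
  let ?B = "ball (0 :: complex^3) r"
  have BU: "?B \<subseteq> U" using K r by (auto simp: subset_iff)
  obtain D where D: "\<And>u. u \<in> ?B \<Longrightarrow> (F has_derivative D u) (at u)"
  proof -
    have "\<forall>u\<in>?B. \<exists>D. (F has_derivative D) (at u)"
      using F(1) BU unfolding cholo_def by blast
    from bchoice[OF this] show thesis using that by blast
  qed
  have Dhom: "D u (c *s v) = c * D u v" if "u \<in> ?B" for u c v
    using cholo_derivative_scale[OF F(1) _ D] BU that by blast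
  have Dm: "norm (D u v) \<le> m * norm v" if u: "u \<in> ?B" for u v
  proof -
    have w: "norm w \<le> 2 * r" if "w \<in> cball u r" for w
      using that u norm_triangle_ineq2[of w u] by (simp add: dist_norm norm_minus_commute)
    have "norm (D u v) \<le> ((\<bar>K\<bar> + 1) * (2 * r)^2) / r * norm v"
    proof (rule cholo_derivative_bound[OF F(1) _ r(1) _ D[OF u]])
      have Kw: "w \<in> U \<and> norm (F w) \<le> K * norm w ^ 2" if "w \<in> cball u r" for w
        using w[OF that] K[of w] r(2) by simp
      then show "cball u r \<subseteq> U" by blast
      fix y assume "y \<in> cball u r"
      have "norm (F y) \<le> K * norm y ^ 2" using Kw \<open>y \<in> cball u r\<close> by blast
      moreover have "norm y ^ 2 \<le> (2 * r)^2"
        using w[OF \<open>y \<in> cball u r\<close>] by (intro power_mono) auto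
      moreover have "K * norm y ^ 2 \<le> (\<bar>K\<bar> + 1) * norm y ^ 2" by (intro mult_right_mono) auto
      moreover have "(\<bar>K\<bar> + 1) * norm y ^ 2 \<le> (\<bar>K\<bar> + 1) * (2 * r)^2" 
        using calculation(2) by (intro mult_left_mono) auto
      ultimately show "norm (F y) \<le> (\<bar>K\<bar> + 1) * (2 * r)^2" by linarith
    qed
    also have "\<dots> = m * norm v" using r by (simp add: m_def power2_eq_square)
    finally show ?thesis .
  qed
  define \<psi> where "\<psi> u = u + F u *s a" for u
  \<comment> \<open>The map is the identity plus a contraction of constant 1/2. This gives
    injectivity and also the final estimate |u| \<le> 2 |v|.\<close>
  have lower: "norm (u - v) / 2 \<le> norm (\<psi> u - \<psi> v)" if uv: "u \<in> ?B" "v \<in> ?B" for u v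
  proof -
    have "norm (F u - F v) \<le> m * norm (u - v)"
    proof (rule differentiable_bound[where S = ?B and f' = D])
      fix x assume x: "x \<in> ?B"
      show "(F has_derivative D x) (at x within ?B)" using D[OF x] by (rule has_derivative_at_withinI)
      show "onorm (D x) \<le> m" using Dm[OF x] by (rule onorm_bound[OF m0])
    qed (use uv in auto)
    then have "norm ((F u - F v) *s a) \<le> m * norm (u - v) * norm a"
      unfolding norm_cscale by (rule mult_right_mono) simp
    also have "\<dots> \<le> norm (u - v) / 2"
      using mult_right_mono[OF ma, of "norm (u - v)"] by (simp add: mult_ac)
    finally have "norm ((F u - F v) *s a) \<le> norm (u - v) / 2" .
    moreover have "\<psi> u - \<psi> v = (u - v) + (F u - F v) *s a"
      by (simp add: \<psi>_def vec_eq_iff algebra_simps)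
    ultimately show ?thesis
      using norm_diff_ineq[of "u - v" "(F u - F v) *s a"] by simp
  qed
  have inj: "inj_on \<psi> ?B"
  proof (rule inj_onI)
    fix u v assume "u \<in> ?B" "v \<in> ?B" "\<psi> u = \<psi> v"
    then show "u = v" using lower[of u v] by simp
  qed
  define \<psi>' where "\<psi>' u h = h + D u h *s a" for u h
  have \<psi>': "(\<psi> has_derivative \<psi>' u) (at u)" if "u \<in> ?B" for u
    unfolding \<psi>_def \<psi>'_def
    by (intro has_derivative_add has_derivative_ident
        bounded_linear.has_derivative[OF bounded_linear_cscale_left] D that)
  have "continuous_on ?B \<psi>"
    using has_derivative_continuous[OF \<psi>'] by (intro continuous_at_imp_continuous_on) blast
  \<comment> \<open>Invariance of domain supplies openness of the image; differentiability of the
    inverse is then derived pointwise from the invertible derivative.\<close>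
  then have opn: "open (\<psi> ` ?B)" by (rule invariance_of_domain[OF _ open_ball inj])
  define g where "g = inv_into ?B \<psi>"
  have g: "g (\<psi> u) = u" if "u \<in> ?B" for u
    using inj that by (simp add: g_def)
  have "\<exists>D'. ((F \<circ> g) has_derivative D') (at v) \<and> (\<forall>c w. D' (c *s w) = c * D' w)"
    if v: "v \<in> \<psi> ` ?B" for v
  proof -
    obtain u where u: "u \<in> ?B" "v = \<psi> u" using v by blast
    have lin: "linear (\<psi>' u)" using has_derivative_linear[OF \<psi>'[OF u(1)]] .
    have inj': "h = 0" if "\<psi>' u h = 0" for h
    proof -
      have "norm h = norm (D u h *s a)" using that norm_minus_cancel[of "D u h *s a"] by (simp only: \<psi>'_def eq_neg_iff_add_eq_0[symmetric])
      also have "\<dots> \<le> m * norm h * norm a"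
        unfolding norm_cscale by (intro mult_right_mono Dm u) simp
      also have "\<dots> \<le> norm h / 2"
        using mult_right_mono[OF ma, of "norm h"] by (simp add: mult_ac)
      finally show ?thesis by simp
    qed
    then have "inj (\<psi>' u)" using lin by (simp add: linear_injective_0)
    then obtain h where h: "linear h" "\<And>x. h (\<psi>' u x) = x" "\<And>x. \<psi>' u (h x) = x"
      using linear_injective_isomorphism[OF lin] by blast
    have "\<psi>' u (c *s x) = c *s \<psi>' u x" for c x
      using Dhom[OF u(1)] by (simp add: \<psi>'_def vector_add_ldistrib vector_smult_assoc)
    \<comment> \<open>\<open>h\<close> is so far only real linear; \<open>cholo\<close> requires a
      complex-linear derivative, and the inverse of a complex-linear map is complex linear.\<close>
    then have hc: "h (c *s x) = c *s h x" for c x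
    proof -
      have "h (c *s x) = h (c *s \<psi>' u (h x))" by (simp only: h(3))
      also have "\<dots> = h (\<psi>' u (c *s h x))" by (simp only: \<open>\<And>c x. \<psi>' u (c *s x) = c *s \<psi>' u x\<close>)
      finally show ?thesis by (simp only: h(2))
    qed
    have "(g has_derivative h) (at (\<psi> u))"
      by (rule has_derivative_inverse_on[where S = ?B and f' = \<psi>' and g' = "\<lambda>_. h"])
        (use h u \<psi>' g in \<open>simp_all add: fun_eq_iff\<close>)
    moreover have "(F has_derivative D u) (at (g (\<psi> u)))" using D[OF u(1)] g[OF u(1)] by simp
    ultimately have "(F \<circ> g has_derivative D u \<circ> h) (at (\<psi> u))"
      by (rule diff_chain_at)
    then show ?thesis using u Dhom[OF u(1)] hc by (intro exI[of _ "D u \<circ> h"]) auto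
  qed
  then have cholo: "cholo (\<psi> ` ?B) (F \<circ> g)" using opn by (simp add: cholo_def)
  have \<psi>0: "\<psi> 0 = 0" by (simp add: \<psi>_def F0)
  let ?N = "blk (mat 1) a 1"
  have N: "?N *v lift u (F u) = lift (\<psi> u) (F u)" for u
    by (simp add: blk_mult \<psi>_def)
  have inv: "invertible ?N"
    by (rule invertible_blk) (auto simp: invertible_def intro: exI[of _ "mat 1"])
  have graph: "(\<lambda>u. ?N *v lift u (F u)) ` ?B = (\<lambda>u. lift u ((F \<circ> g) u)) ` \<psi> ` ?B"
    unfolding N image_image by (rule image_cong) (simp_all add: g)
  have "0 \<in> \<psi> ` ?B" using \<psi>0 r by force
  then have "gchart S (?N ** L) (?N *v b) (\<psi> ` ?B) (F \<circ> g)"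
    using r by (intro gchart_map[OF S BU open_ball _ inv cholo _ graph]) auto
  then show thesis
  proof (rule that)
    fix v assume "v \<in> \<psi> ` ?B"
    then obtain u where u: "u \<in> ?B" "v = \<psi> u" by blast
    then have "norm u \<le> 2 * norm v" using lower[of u 0] r \<psi>0 by simp
    moreover have "norm u < d" using u r by simp
    ultimately show "\<exists>u. norm u < d \<and> v = u + F u *s a \<and> (F \<circ> g) v = F u \<and> norm u \<le> 2 * norm v"
      using u g by (auto simp: \<psi>_def)
  qed
qed

section \<open>Existence of the trace-free normal form\<close>

definition bil :: "complex^3^3 \<Rightarrow> complex^3 \<Rightarrow> complex^3 \<Rightarrow> complex" where
  "bil h u v = u$1 * (h *v v)$1 + u$2 * (h *v v)$2 + u$3 * (h *v v)$3"

lemma bil_linear: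
  "bil h (u + u') v = bil h u v + bil h u' v" "bil h (c *s u) v = c * bil h u v"
  "bil h u (v + v') = bil h u v + bil h u v'" "bil h u (c *s v) = c * bil h u v"
  unfolding bil_def by (simp_all add: algebra_simps)

lemma bil_commute: "transpose h = h \<Longrightarrow> bil h u v = bil h v u"
proof -
  assume sym: "transpose h = h"
  have "h$i$j = h$j$i" for i j
    using arg_cong[OF sym, of "\<lambda>m. m$j$i"] by (simp add: transpose_def)
  then have "h$2$1 = h$1$2" "h$3$1 = h$1$3" "h$3$2 = h$2$3" by blast+
  then show ?thesis by (simp add: bil_def algebra_simps)
qed

lemma qform_bil: "qform h u = bil h u u"
  by (simp add: qform_def bil_def sum_3 algebra_simps)

text \<open>It suffices to look in the (x, z)-plane: either e3 is isotropic or the quadratic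
  equation for (1, 0, z) has leading coefficient h33 \<noteq> 0 and is solvable over the complex
  numbers.\<close>

lemma exists_isotropic:
  obtains v where "v \<noteq> 0" "bil h v v = 0"
proof (cases "h$3$3 = 0")
  case True
  then show ?thesis by (intro that[of "vec3 0 0 1"]) (auto simp: bil_def vec3_eq)
next
  case False
  define b where "b = h$1$3 + h$3$1"
  define z where "z = (- b + csqrt (b^2 - 4 * h$1$1 * h$3$3)) / (2 * h$3$3)"
  have "2 * h$3$3 * z + b = csqrt (b^2 - 4 * h$1$1 * h$3$3)" using False by (simp add: z_def)
  then have "(2 * h$3$3 * z + b)^2 = b^2 - 4 * h$1$1 * h$3$3" by simp
  then have "4 * h$3$3 * (h$3$3 * z^2 + b * z + h$1$1) = 0" by (simp add: power2_eq_square algebra_simps)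
  then have "h$3$3 * z^2 + b * z + h$1$1 = 0" using False by simp
  then show ?thesis
    by (intro that[of "vec3 1 0 z"]) (auto simp: bil_def vec3_eq b_def algebra_simps power2_eq_square)
qed

text \<open>The columns of R are a hyperbolic pair v, w, which produces 2xy, and a normalised vector
  orthogonal to both, which produces z^2.\<close>

lemma symmetric_form_diagonalise:
  assumes sym: "transpose h = h" and det: "det h \<noteq> 0"
  obtains R where "invertible R" "\<And>u. qform h (R *v u) = Q0 u"
proof -
  have hinj: "v = 0" if "h *v v = 0" for v
    using det that invertible_det_nz[of h] unfolding invertible_iff_inj inj_mult_iff by blast
  have nondeg: "v = 0" if "\<And>w. bil h w v = 0" for v
    using that[of "vec3 1 0 0"] that[of "vec3 0 1 0"] that[of "vec3 0 0 1"]
    by - (rule hinj, simp add: bil_def vec3_eq)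
  note comm = bil_commute[OF sym]
  obtain v where v: "v \<noteq> 0" "bil h v v = 0" using exists_isotropic by blast
  obtain w1 where w1: "bil h w1 v \<noteq> 0" using nondeg v by blast
  define w0 where "w0 = (1 / bil h w1 v) *s w1"
  have w0: "bil h w0 v = 1" using w1 by (simp add: w0_def bil_linear)
  \<comment> \<open>The multiple of v makes w isotropic and does not affect its pairing with the
    isotropic v.\<close>
  define w where "w = w0 + (- (bil h w0 w0 / 2)) *s v"
  have w: "bil h w v = 1" "bil h w w = 0"
    unfolding w_def bil_linear using w0 v comm[of v w0] by simp_all
  define a b where "a = h *v v" and "b = h *v w"
  \<comment> \<open>The cross product of h v and h w: orthogonality for \<open>h\<close> to v and w
    is ordinary orthogonality to these two vectors.\<close>
  define t where "t = vec3 (a$2 * b$3 - a$3 * b$2) (a$3 * b$1 - a$1 * b$3) (a$1 * b$2 - a$2 * b$1)"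
  have tv: "bil h t v = 0" and tw: "bil h t w = 0"
    unfolding bil_def a_def[symmetric] b_def[symmetric] t_def by (simp_all add: algebra_simps)
  have "t \<noteq> 0"
  proof
    assume "t = 0"
    then have t0: "a$2 * b$3 = a$3 * b$2" "a$3 * b$1 = a$1 * b$3" "a$1 * b$2 = a$2 * b$1"
      by (simp_all add: t_def vec3_eq)
    have va: "v$1 * a$1 + v$2 * a$2 + v$3 * a$3 = 0" "v$1 * b$1 + v$2 * b$2 + v$3 * b$3 = 1"
      using v(2) w(1) comm[of v w] unfolding bil_def a_def[symmetric] b_def[symmetric] by simp_all
    \<comment> \<open>Componentwise the identity a (v.b) - b (v.a) = v x (a x b). With v.a = 0, v.b
      = 1 and a x b = 0 it gives a = 0.\<close>
    have "a$1 * (v$1 * b$1 + v$2 * b$2 + v$3 * b$3) - b$1 * (v$1 * a$1 + v$2 * a$2 + v$3 * a$3)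
        = v$2 * (a$1 * b$2 - a$2 * b$1) - v$3 * (a$3 * b$1 - a$1 * b$3)"
      "a$2 * (v$1 * b$1 + v$2 * b$2 + v$3 * b$3) - b$2 * (v$1 * a$1 + v$2 * a$2 + v$3 * a$3)
        = v$3 * (a$2 * b$3 - a$3 * b$2) - v$1 * (a$1 * b$2 - a$2 * b$1)"
      "a$3 * (v$1 * b$1 + v$2 * b$2 + v$3 * b$3) - b$3 * (v$1 * a$1 + v$2 * a$2 + v$3 * a$3)
        = v$1 * (a$3 * b$1 - a$1 * b$3) - v$2 * (a$2 * b$3 - a$3 * b$2)"
      by (simp_all add: algebra_simps)
    then have "a$1 = 0" "a$2 = 0" "a$3 = 0" unfolding va t0 by simp_all
    then have "a = 0" by (simp add: vec3_eq)
    then show False using hinj[of v] v by (simp add: a_def)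
  qed
  have indep: "x = 0 \<and> y = 0 \<and> z = 0" if "x *s v + y *s w + z *s t = 0" for x y z
  proof -
    have 0: "bil h (x *s v + y *s w + z *s t) p = 0" for p unfolding that by (simp add: bil_def)
    have "x = 0" "y = 0" using 0[of w] 0[of v] v w tv tw comm[of v w] by (simp_all add: bil_linear)
    then show ?thesis using that \<open>t \<noteq> 0\<close> by (auto simp: vec3_eq)
  qed
  define R where "R c = transpose (vector [v, w, c *s t] :: complex^3^3)" for c
  have R: "R c *v u = u$1 *s v + u$2 *s w + (c * u$3) *s t" for c u
    by (simp add: R_def transpose_def vec3_eq algebra_simps)
  have invR: "invertible (R c)" if "c \<noteq> 0" for c
    unfolding invertible_iff_inj inj_mult_iff
  proof (intro allI impI)
    fix u assume "R c *v u = 0"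
    then show "u = 0" using indep[of "u$1" "u$2" "c * u$3"] that by (simp add: R vec3_eq)
  qed
  \<comment> \<open>An isotropic t would be orthogonal to the basis v, w, t, contradicting
    non-degeneracy.\<close>
  have tt: "bil h t t \<noteq> 0"
  proof
    assume t0: "bil h t t = 0"
    have "bil h v t = 0" "bil h w t = 0" using tv tw comm[of t v] comm[of t w] by simp_all
    then have R0: "bil h (R 1 *v u) t = 0" for u
      unfolding R bil_linear t0 by simp
    have "bil h p t = 0" for p
      using R0[of "matrix_inv (R 1) *v p"] by (simp only: matrix_inv_mult_vec(2)[OF invR[OF one_neq_zero]])
    then show False using nondeg \<open>t \<noteq> 0\<close> by blast
  qed
  define c where "c = 1 / csqrt (bil h t t)"
  have c: "c \<noteq> 0" "c^2 * bil h t t = 1" using tt by (simp_all add: c_def power_divide)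
  have "qform h (R c *v u) = Q0 u" for u
  proof -
    have "qform h (R c *v u) = 2 * u$1 * u$2 + (u$3)^2 * (c^2 * bil h t t)"
      unfolding qform_bil R bil_linear
      using v w tv tw comm[of v w] comm[of t v] comm[of t w] by (simp add: power2_eq_square)
    then show ?thesis using c by (simp add: Q0_def)
  qed
  with invR[OF c(1)] show thesis by (rule that)
qed

text \<open>The Lipschitz bound of a cubic form, with constant of order m^2 on the ball of radius m:
  an argument of size n displaced by O(n^2) then changes the value by O(n^4) only.\<close>

definition lipschitz3 :: "(complex^3 \<Rightarrow> complex) \<Rightarrow> bool" where
  "lipschitz3 C \<longleftrightarrow> (\<exists>K\<ge>0. \<forall>u v m d. norm u \<le> m \<longrightarrow> norm v \<le> m \<longrightarrow> norm (u - v) \<le> d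
     \<longrightarrow> norm (C u - C v) \<le> K * m^2 * d)"

lemma lipschitz3_add:
  assumes "lipschitz3 C" "lipschitz3 C'" shows "lipschitz3 (\<lambda>u. C u + C' u)"
proof -
  obtain K K' where K: "K \<ge> 0" "K' \<ge> 0"
    "\<And>u v m d. norm u \<le> m \<Longrightarrow> norm v \<le> m \<Longrightarrow> norm (u - v) \<le> d \<Longrightarrow> norm (C u - C v) \<le> K * m^2 * d"
    "\<And>u v m d. norm u \<le> m \<Longrightarrow> norm v \<le> m \<Longrightarrow> norm (u - v) \<le> d \<Longrightarrow> norm (C' u - C' v) \<le> K' * m^2 * d"
    using assms unfolding lipschitz3_def by metis
  have "norm (C u + C' u - (C v + C' v)) \<le> (K + K') * m^2 * d"
    if "norm u \<le> m" "norm v \<le> m" "norm (u - v) \<le> d" for u v m d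
    using K(3)[OF that] K(4)[OF that] norm_triangle_ineq[of "C u - C v" "C' u - C' v"]
    by (simp add: algebra_simps)
  then show ?thesis unfolding lipschitz3_def using K by (intro exI[of _ "K + K'"]) auto
qed

lemma lipschitz3_mult:
  assumes "lipschitz3 C" shows "lipschitz3 (\<lambda>u. c * C u)"
proof -
  obtain K where K: "K \<ge> 0"
    "\<And>u v m d. norm u \<le> m \<Longrightarrow> norm v \<le> m \<Longrightarrow> norm (u - v) \<le> d \<Longrightarrow> norm (C u - C v) \<le> K * m^2 * d"
    using assms unfolding lipschitz3_def by metis
  have "norm (c * C u - c * C v) \<le> (norm c * K) * m^2 * d"
    if "norm u \<le> m" "norm v \<le> m" "norm (u - v) \<le> d" for u v m d
    using mult_left_mono[OF K(2)[OF that], of "norm c"]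
    by (simp add: norm_mult right_diff_distrib[symmetric] mult.assoc)
  then show ?thesis unfolding lipschitz3_def using K by (intro exI[of _ "norm c * K"]) auto
qed

lemma lipschitz3_monomial: "lipschitz3 (\<lambda>u. u$i * u$j * u$k)"
proof -
  have "norm (u$i * u$j * u$k - v$i * v$j * v$k) \<le> 3 * m^2 * d"
    if "norm u \<le> m" "norm v \<le> m" "norm (u - v) \<le> d" for u v :: "complex^3" and m d
  proof -
    have u: "norm (u$l) \<le> m" and v: "norm (v$l) \<le> m" for l
      using that Finite_Cartesian_Product.norm_nth_le order_trans by blast+
    have uv: "norm (u$l - v$l) \<le> d" for l
      using that(3) Finite_Cartesian_Product.norm_nth_le[of "u - v" l] by simp
    have m: "0 \<le> m" using that(1) norm_ge_zero order_trans by blast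
    have d: "0 \<le> d" using that(3) norm_ge_zero order_trans by blast
    have p: "norm (x * y * z) \<le> d * m * m" if "norm x \<le> d" "norm y \<le> m" "norm z \<le> m" for x y z :: complex
      unfolding norm_mult using that m d by (intro mult_mono mult_nonneg_nonneg) auto
    have "u$i * u$j * u$k - v$i * v$j * v$k
      = (u$i - v$i) * u$j * u$k + (u$j - v$j) * v$i * u$k + (u$k - v$k) * v$i * v$j"
      by (simp add: algebra_simps)
    also have "norm \<dots> \<le> d * m * m + d * m * m + d * m * m"
      by (intro norm_triangle_mono p u v uv)
    finally show ?thesis by (simp add: power2_eq_square mult_ac)
  qed
  then show ?thesis unfolding lipschitz3_def by (intro exI[of _ 3]) auto
qed

definition cubic :: "complex \<Rightarrow> complex \<Rightarrow> complex \<Rightarrow> complex \<Rightarrow> complex \<Rightarrow> complex \<Rightarrow> complex \<Rightarrow> complex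
    \<Rightarrow> complex \<Rightarrow> complex \<Rightarrow> complex^3 \<Rightarrow> complex" where
  "cubic k1 k2 k3 k4 k5 k6 k7 k8 k9 k10 u = k1 * (u$1)^3 + k2 * (u$2)^3 + k3 * (u$3)^3 + k4 * ((u$1)^2 * u$2)
    + k5 * ((u$1)^2 * u$3) + k6 * (u$1 * (u$2)^2) + k7 * ((u$2)^2 * u$3) + k8 * (u$1 * (u$3)^2)
    + k9 * (u$2 * (u$3)^2) + k10 * (u$1 * u$2 * u$3)"

lemma lipschitz3_cubic: "lipschitz3 (cubic k1 k2 k3 k4 k5 k6 k7 k8 k9 k10)"
proof -
  have "cubic k1 k2 k3 k4 k5 k6 k7 k8 k9 k10 = (\<lambda>u. k1 * (u$1*u$1*u$1) + k2 * (u$2*u$2*u$2) + k3 * (u$3*u$3*u$3)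
     + k4 * (u$1*u$1*u$2) + k5 * (u$1*u$1*u$3) + k6 * (u$1*u$2*u$2) + k7 * (u$2*u$2*u$3) + k8 * (u$1*u$3*u$3)
     + k9 * (u$2*u$3*u$3) + k10 * (u$1*u$2*u$3))"
    by (simp add: fun_eq_iff cubic_def power2_eq_square power3_eq_cube)
  then show ?thesis by (simp only:) (intro lipschitz3_add lipschitz3_mult lipschitz3_monomial)
qed

lemma lipschitz3_growth:
  assumes "lipschitz3 C" "C 0 = 0"
  obtains K where "K \<ge> 0" "\<And>u. norm (C u) \<le> K * norm u ^ 3"
proof -
  obtain K where K: "K \<ge> 0"
    "\<And>u v m d. norm u \<le> m \<Longrightarrow> norm v \<le> m \<Longrightarrow> norm (u - v) \<le> d \<Longrightarrow> norm (C u - C v) \<le> K * m^2 * d"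
    using assms(1) unfolding lipschitz3_def by metis
  have "norm (C u) \<le> K * norm u ^ 3" for u
    using K(2)[of u "norm u" 0 "norm u"] assms(2) by (simp add: power2_eq_square power3_eq_cube mult.assoc)
  with K(1) show thesis by (rule that)
qed

lemma Q0_scale: "Q0 (t *s u) = t^2 * Q0 u"
  by (simp add: Q0_def power2_eq_square algebra_simps)

lemma Q0_bound: "norm (Q0 u) \<le> 3 * norm u ^ 2"
proof -
  have p: "norm (u$i * u$j) \<le> norm u ^ 2" for i j
    unfolding norm_mult power2_eq_square by (intro mult_mono Finite_Cartesian_Product.norm_nth_le) auto
  have "Q0 u = u$1 * u$2 + u$1 * u$2 + u$3 * u$3" by (simp add: Q0_def power2_eq_square)
  also have "norm \<dots> \<le> norm u ^ 2 + norm u ^ 2 + norm u ^ 2"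
    by (intro norm_triangle_mono p)
  finally show ?thesis by simp
qed

text \<open>The shear along \<open>a\<close> subtracts \<open>Q0\<close> times the linear form \<open>dQ0(a)\<close> from the cubic part.\<close>
lemma nf_chart_shear:
  fixes a :: "complex^3"
  assumes S: "nf_chart S L b U F C" and C: "lipschitz3 C" "C 0 = 0"
    and C': "lipschitz3 C'" "\<And>u. C' u = C u - Q0 u * (2 * (u$1 * a$2 + u$2 * a$1 + u$3 * a$3))"
  shows "\<exists>L' b' U' F'. nf_chart S L' b' U' F' C'"
proof -
  obtain K0 d0 where d0: "d0 > 0" and K0: "\<And>u. u \<in> U \<Longrightarrow> norm u < d0 \<Longrightarrow> norm (F u - Q0 u - C u) \<le> K0 * norm u ^ 4"
    and g: "gchart S L b U F"
    using S unfolding nf_chart_gchart by blast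
  have "open U" "0 \<in> U" using g by (auto simp: gchart_def cholo_def)
  then obtain d1 where d1: "d1 > 0" "ball 0 d1 \<subseteq> U" by (meson openE)
  define K where "K = \<bar>K0\<bar>"
  define d where "d = min 1 (min d0 d1)"
  have d: "d > 0" using d0 d1 by (simp add: d_def)
  have K: "K \<ge> 0" by (simp add: K_def)
  have FU: "u \<in> U" if "norm u < d" for u using that d1 by (auto simp: d_def subset_iff)
  have F4: "norm (F u - Q0 u - C u) \<le> K * norm u ^ 4" if u: "norm u < d" for u
  proof -
    have "norm (F u - Q0 u - C u) \<le> K0 * norm u ^ 4" using K0 FU[OF u] u by (simp add: d_def)
    also have "\<dots> \<le> K * norm u ^ 4" by (intro mult_right_mono) (auto simp: K_def)
    finally show ?thesis .
  qed
  obtain Kc where Kc: "Kc \<ge> 0" "\<And>u. norm (C u) \<le> Kc * norm u ^ 3"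
    using lipschitz3_growth[OF C] by blast
  obtain Kl where Kl: "Kl \<ge> 0"
    "\<And>u v m d. norm u \<le> m \<Longrightarrow> norm v \<le> m \<Longrightarrow> norm (u - v) \<le> d \<Longrightarrow> norm (C' u - C' v) \<le> Kl * m^2 * d"
    using C'(1) unfolding lipschitz3_def by metis
  have F3: "norm (F u - Q0 u) \<le> (K + Kc) * norm u ^ 3" if u: "norm u < d" for u
  proof -
    have "norm (F u - Q0 u) \<le> K * norm u ^ 4 + Kc * norm u ^ 3"
      using F4[OF u] Kc(2)[of u] norm_triangle_ineq[of "F u - Q0 u - C u" "C u"] by simp
    moreover have "norm u ^ 4 \<le> norm u ^ 3" using u by (intro power_decreasing) (auto simp: d_def)
    ultimately show ?thesis using mult_left_mono[OF _ K, of "norm u ^ 4" "norm u ^ 3"] by (simp add: algebra_simps)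
  qed
  define KF where "KF = K + Kc + 3"
  have KF: "KF \<ge> 0" using K Kc by (simp add: KF_def)
  have F2: "norm (F u) \<le> KF * norm u ^ 2" if u: "norm u < d" for u
  proof -
    have "norm (F u) \<le> (K + Kc) * norm u ^ 3 + 3 * norm u ^ 2"
      using F3[OF u] Q0_bound[of u] norm_triangle_ineq[of "F u - Q0 u" "Q0 u"] by simp
    moreover have "norm u ^ 3 \<le> norm u ^ 2" using u by (intro power_decreasing) (auto simp: d_def)
    ultimately show ?thesis
      using mult_left_mono[of "norm u ^ 3" "norm u ^ 2" "K + Kc"] K Kc by (simp add: KF_def algebra_simps)
  qed
  obtain L' b' U' F' where g': "gchart S L' b' U' F'"
    and F': "\<And>v. v \<in> U' \<Longrightarrow> \<exists>u. norm u < d \<and> v = u + F u *s a \<and> F' v = F u \<and> norm u \<le> 2 * norm v"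
    using gchart_shear[OF g d, of KF a] FU F2 by blast
  define l where "l u = 2 * (u$1 * a$2 + u$2 * a$1 + u$3 * a$3)" for u :: "complex^3"
  have l: "norm (l u) \<le> 6 * norm a * norm u" for u
  proof -
    have p: "norm (2 * (u$i * a$j)) \<le> 2 * (norm u * norm a)" for i j
      unfolding norm_mult by (intro mult_mono Finite_Cartesian_Product.norm_nth_le) auto
    have "l u = 2 * (u$1 * a$2) + 2 * (u$2 * a$1) + 2 * (u$3 * a$3)" by (simp add: l_def)
    also have "norm \<dots> \<le> 2 * (norm u * norm a) + 2 * (norm u * norm a) + 2 * (norm u * norm a)"
      by (intro norm_triangle_mono p)
    finally show ?thesis by simp
  qed
  define A where "A = norm a"
  have A: "A \<ge> 0" by (simp add: A_def)
  \<comment> \<open>The sum of the constants of the four error terms \<open>t1\<close> to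
    \<open>t4\<close>, each of order n^4.\<close>
  define K1 where "K1 = K + 6 * A * (K + Kc) + KF^2 * (3 * A^2) + Kl * (1 + KF * A)^2 * (KF * A)"
  have K1: "K1 \<ge> 0" using K A Kc Kl KF by (simp add: K1_def)
  have "norm (F' v - Q0 v - C' v) \<le> (16 * K1) * norm v ^ 4" if v: "v \<in> U'" for v
  proof -
    obtain u where u: "norm u < d" "v = u + F u *s a" "F' v = F u" "norm u \<le> 2 * norm v"
      using F'[OF v] by blast
    define n where "n = norm u"
    have n: "0 \<le> n" "n \<le> 1" using u(1) by (auto simp: n_def d_def)
    have Fa: "norm (F u *s a) \<le> KF * n^2 * A"
      unfolding norm_cscale n_def A_def using F2[OF u(1)] by (rule mult_right_mono) simp
    have "n^2 \<le> n" using n by (simp add: power2_eq_square mult_left_le)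
    then have "KF * n^2 * A \<le> KF * n * A" using KF A by (intro mult_right_mono mult_left_mono) auto
    then have nv: "norm v \<le> (1 + KF * A) * n"
      using norm_triangle_ineq[of u "F u *s a"] Fa by (simp add: u(2) n_def algebra_simps)
    \<comment> \<open>In F u * l u the leading part Q0 u * l u is what \<open>C'\<close> subtracts
      from \<open>C\<close>; the other part and the square of F u are of fourth order.\<close>
    have "Q0 v = Q0 u + F u * l u + (F u)^2 * Q0 a"
      unfolding u(2) Q0_def l_def by (simp add: power2_eq_square algebra_simps)
    then have eq: "F' v - Q0 v - C' v = (F u - Q0 u - C u) + (- (l u * (F u - Q0 u)))
        + (- ((F u)^2 * Q0 a)) + (- (C' v - C' u))"
      unfolding u(3) C'(2)[of u] l_def[symmetric] by (simp add: algebra_simps)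
    have t1: "norm (F u - Q0 u - C u) \<le> K * n^4" using F4[OF u(1)] by (simp add: n_def)
    have t2: "norm (- (l u * (F u - Q0 u))) \<le> 6 * A * (K + Kc) * n^4"
    proof -
      have "norm (l u * (F u - Q0 u)) \<le> (6 * A * n) * ((K + Kc) * n^3)"
        unfolding norm_mult using l[of u] F3[OF u(1)] A n
        by (intro mult_mono) (auto simp: A_def n_def)
      then show ?thesis by (simp add: power3_eq_cube power4_eq_xxxx mult_ac)
    qed
    have t3: "norm (- ((F u)^2 * Q0 a)) \<le> KF^2 * (3 * A^2) * n^4"
    proof -
      have "norm ((F u)^2 * Q0 a) \<le> (KF * n^2)^2 * (3 * A^2)"
        unfolding norm_mult norm_power using F2[OF u(1)] Q0_bound[of a]
        by (intro mult_mono power_mono) (auto simp: A_def n_def)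
      then show ?thesis by (simp add: power2_eq_square power4_eq_xxxx mult_ac)
    qed
    have t4: "norm (- (C' v - C' u)) \<le> Kl * (1 + KF * A)^2 * (KF * A) * n^4"
    proof -
      have "norm (C' v - C' u) \<le> Kl * ((1 + KF * A) * n)^2 * (KF * n^2 * A)"
      proof (rule Kl(2)[OF nv])
        show "norm u \<le> (1 + KF * A) * n" using KF A n by (simp add: n_def algebra_simps)
        show "norm (v - u) \<le> KF * n^2 * A" using Fa by (simp add: u(2))
      qed
      then show ?thesis unfolding norm_minus_cancel by (simp add: power2_eq_square power4_eq_xxxx mult_ac)
    qed
    have "norm (F' v - Q0 v - C' v) \<le> K * n^4 + 6 * A * (K + Kc) * n^4 + KF^2 * (3 * A^2) * n^4
        + Kl * (1 + KF * A)^2 * (KF * A) * n^4"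
      unfolding eq by (intro norm_triangle_mono t1 t2 t3 t4)
    also have "\<dots> = K1 * n^4" unfolding K1_def by (simp only: distrib_right)
    \<comment> \<open>The estimate so far is in terms of |u|; since |u| \<le> 2 |v|, passing to |v|
      costs the factor 16.\<close>
    also have "\<dots> \<le> K1 * (2 * norm v)^4"
      using u(4) K1 n by (intro mult_left_mono power_mono) (auto simp: n_def)
    finally show ?thesis by (simp add: power_mult_distrib)
  qed
  then have "\<forall>v\<in>U'. norm v < 1 \<longrightarrow> norm (F' v - Q0 v - C' v) \<le> (16 * K1) * norm v ^ 4"
    by blast
  then have "nf_chart S L' b' U' F' C'"
    unfolding nf_chart_gchart using g' zero_less_one[where 'a = real] by blast
  then show ?thesis by blast
qed

lemma nf_chart_exists:
  assumes "S \<noteq> {}" and "nondegenerate S"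
  shows "\<exists>L b U F C. tracefree_cubic C \<and> nf_chart S L b U F C"
proof -
  obtain p where "p \<in> S" using assms(1) by blast
  from bspec[OF assms(2)[unfolded nondegenerate_def] \<open>p \<in> S\<close>]
  obtain L b U G V h where *: "graph_chart S L b U G V \<and> p \<in> V \<and> 0 \<in> U \<and> p = L *v lift 0 (G 0) + b \<and>
     transpose h = h \<and> det h \<noteq> 0 \<and>
     (\<forall>e>0. \<exists>d>0. \<forall>u. norm u < d \<longrightarrow> norm (G u - qform h u) \<le> e * norm u ^ 2)"
    by (elim exE) (rule that)
  note c1 = conjunct2[OF *] note c2 = conjunct2[OF c1] note c3 = conjunct2[OF c2] note c4 = conjunct2[OF c3]
  note ch = conjunct1[OF *] conjunct1[OF c1] conjunct1[OF c2] conjunct1[OF c3]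
  note h = conjunct1[OF c4] conjunct1[OF conjunct2[OF c4]]
  have Gh: "\<exists>d>0. \<forall>u. norm u < d \<longrightarrow> norm (G u - qform h u) \<le> e * norm u ^ 2" if "e > 0" for e
    using * that by simp
  \<comment> \<open>The o-estimate is also valid at u = 0, where its right-hand side
    vanishes.\<close>
  have "G 0 = 0"
  proof -
    obtain d where "d > 0" and d: "\<forall>u. norm u < d \<longrightarrow> norm (G u - qform h u) \<le> 1 * norm u ^ 2"
      using Gh[OF zero_less_one] by blast
    then have "norm (G 0 - qform h 0) \<le> 1 * norm (0 :: complex^3) ^ 2" using spec[OF d, of 0] by simp
    then show ?thesis by (simp add: qform_def)
  qed
  then have "b \<in> V" using ch by simp
  then have g: "gchart S (matrix_inv L) (- (matrix_inv L *v b)) U G"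
    using graph_chart_gchart ch by blast
  obtain R where R: "invertible R" "\<And>u. qform h (R *v u) = Q0 u"
    using symmetric_form_diagonalise[OF h] by blast
  define F where "F = (\<lambda>u. G (R *v u))"
  define W where "W = {u. R *v u \<in> U}"
  obtain L1 b1 where g1: "gchart S L1 b1 W F"
    using gchart_linear[OF g R(1) one_neq_zero] unfolding F_def W_def div_by_1 by blast
  obtain B where B: "B > 0" "\<And>u. norm (R *v u) \<le> B * norm u"
    using matrix_norm_bound[of R] by blast
  have FQ: "\<exists>d>0. \<forall>u. norm u < d \<longrightarrow> norm (F u - Q0 u) \<le> e * norm u ^ 2" if e: "e > 0" for e
  proof -
    obtain d where d: "d > 0" "\<And>u. norm u < d \<Longrightarrow> norm (G u - qform h u) \<le> e / B^2 * norm u ^ 2"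
      using Gh[of "e / B^2"] e B by auto
    have "norm (F u - Q0 u) \<le> e * norm u ^ 2" if u: "norm u < d / B" for u
    proof -
      have "B * norm u < d" using u B(1) by (simp add: field_simps)
      then have "norm (R *v u) < d" using B(2)[of u] by linarith
      then have "norm (F u - Q0 u) \<le> e / B^2 * norm (R *v u) ^ 2"
        using d(2)[of "R *v u"] R(2)[of u] by (simp add: F_def)
      also have "\<dots> \<le> e / B^2 * (B * norm u)^2"
        using e B by (intro mult_left_mono power_mono) auto
      also have "\<dots> = e * norm u ^ 2" using B(1) by (simp add: power_mult_distrib)
      finally show ?thesis .
    qed
    moreover have "d / B > 0" using d B by simp
    ultimately show ?thesis by blast
  qed
  have hol: "(\<lambda>s. Q0 (u + s *s v)) holomorphic_on UNIV" for u v
    unfolding Q0_def by (auto intro!: holomorphic_intros)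
  have W: "cholo W F" "0 \<in> W" using g1 by (auto simp: gchart_def)
  obtain C r K where r: "r > 0" "ball 0 r \<subseteq> W" and FC: "\<And>u. norm u < r \<Longrightarrow> norm (F u - Q0 u - C u) \<le> K * norm u ^ 4"
    and C: "\<And>t u. C (t *s u) = t^3 * C u" "\<And>u v. \<exists>a. \<forall>s. C (u + s *s v) = (\<Sum>k<4. a k * s^k)"
    by (rule taylor_cubic[where q = Q0, OF W Q0_scale hol FQ], assumption) (rule that)
  obtain k1 k2 k3 k4 k5 k6 k7 k8 k9 k10 where Cxyz: "\<And>x y z. C (vec3 x y z) = k1 * x^3 + k2 * y^3 + k3 * z^3
    + k4 * (x^2 * y) + k5 * (x^2 * z) + k6 * (x * y^2) + k7 * (y^2 * z) + k8 * (x * z^2) + k9 * (y * z^2) + k10 * (x * y * z)"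
    by (rule cubic_on_lines[OF C(2,1)]) (rule that)
  have Ceq: "C = cubic k1 k2 k3 k4 k5 k6 k7 k8 k9 k10"
    unfolding fun_eq_iff vec3_all cubic_def by (simp add: Cxyz)
  have nf: "nf_chart S L1 b1 W F C"
    unfolding nf_chart_gchart using g1 r(1) FC by blast
  \<comment> \<open>The linear form l with C - Q0 l trace-free. For instance the coefficients of x
    z^2 and x^2 y must satisfy k8 - l1 = -2 (k4 - 2 l1).\<close>
  define l1 l2 l3 where "l1 = (k8 + 2 * k4) / 5" and "l2 = (k9 + 2 * k6) / 5" and "l3 = (k10 + 3 * k3) / 5"
  define C' where "C' = cubic k1 k2 (k3 - l3) (k4 - 2 * l1) k5 (k6 - 2 * l2) k7 (k8 - l1) (k9 - l2) (k10 - 2 * l3)"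
  have "\<exists>L' b' U' F'. nf_chart S L' b' U' F' C'"
  \<comment> \<open>The shear vector is dual to l for the polar form of \<open>Q0\<close>: the
    pairing exchanges the first two coordinates and doubles.\<close>
  proof (rule nf_chart_shear[OF nf, where a = "vec3 (l2 / 2) (l1 / 2) (l3 / 2)"])
    show "lipschitz3 C" "lipschitz3 C'" unfolding Ceq C'_def by (rule lipschitz3_cubic)+
    show "C 0 = 0" by (simp add: Ceq cubic_def)
    show "C' u = C u - Q0 u * (2 * (u$1 * vec3 (l2 / 2) (l1 / 2) (l3 / 2) $ 2
        + u$2 * vec3 (l2 / 2) (l1 / 2) (l3 / 2) $ 1 + u$3 * vec3 (l2 / 2) (l1 / 2) (l3 / 2) $ 3))" for u
      by (simp add: Ceq C'_def cubic_def Q0_def power2_eq_square power3_eq_cube algebra_simps)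
  qed
  moreover have "tracefree_cubic C'"
    unfolding tracefree_cubic_def
  proof (intro exI allI)
    fix u :: "complex^3"
    have "k8 - l1 = - 2 * (k4 - 2 * l1)" "k9 - l2 = - 2 * (k6 - 2 * l2)" "k10 - 2 * l3 = 3 * (l3 - k3)"
      by (simp_all add: l1_def l2_def l3_def field_simps)
    then show "let x = u $ 1; y = u $ 2; z = u $ 3 in
      C' u = k1 * x^3 + k5 * (x^2 * z) + (k4 - 2 * l1) * (x^2 * y - 2 * x * z^2) + (l3 - k3) * (3 * x * y * z - z^3)
          + (k6 - 2 * l2) * (x * y^2 - 2 * y * z^2) + k7 * (y^2 * z) + k2 * y^3"
      unfolding Let_def C'_def cubic_def by (simp only:) (simp add: algebra_simps)
  qed
  ultimately show ?thesis by blast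
qed

section \<open>Infinitesimal symmetries\<close>

text \<open>\<open>tangent\<close> allows any chart, so independence of the chart is the content: a
  curve in \<open>S\<close> with velocity v, built in the other chart, lies on the graph of the
  given chart near t = 0, and its equation is differentiated there.\<close>

lemma tangent_chart_iff:
  assumes ch: "graph_chart S L b U G V" and pV: "p \<in> V" and u0: "u0 \<in> U"
    and p: "p = L *v lift u0 (G u0) + b" and D: "(G has_derivative D) (at u0)"
  shows "tangent S p v \<longleftrightarrow> wc (matrix_inv L *v v) = D (proj3 (matrix_inv L *v v))"
proof
  have L: "invertible L" using ch by (simp add: graph_chart_def)
  {
    assume eq: "wc (matrix_inv L *v v) = D (proj3 (matrix_inv L *v v))"
    have "v = L *v lift (proj3 (matrix_inv L *v v)) (D (proj3 (matrix_inv L *v v)))"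
      unfolding eq[symmetric] lift_proj3 using matrix_inv_mult_vec(2)[OF L] by simp
    then show "tangent S p v"
      unfolding tangent_def using ch pV u0 p D by blast
  }
  assume "tangent S p v"
  then obtain L2 b2 U2 G2 V2 u2 D2 k where ch2: "graph_chart S L2 b2 U2 G2 V2" and "p \<in> V2" "u2 \<in> U2"
    and p2: "p = L2 *v lift u2 (G2 u2) + b2" and D2: "(G2 has_derivative D2) (at u2)"
    and v: "v = L2 *v lift k (D2 k)"
    unfolding tangent_def by blast
  define \<gamma> where "\<gamma> t = L2 *v lift (u2 + t *\<^sub>R k) (G2 (u2 + t *\<^sub>R k)) + b2" for t :: real
  have line: "((\<lambda>t. u2 + t *\<^sub>R k) has_derivative (\<lambda>t. t *\<^sub>R k)) (at 0)"
    by (auto intro!: derivative_eq_intros)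
  have "((\<lambda>t. G2 (u2 + t *\<^sub>R k)) has_derivative (\<lambda>t. D2 (t *\<^sub>R k))) (at 0)"
    using has_derivative_compose[OF line, of G2 D2] D2 by simp
  from has_derivative_lift[OF line this]
  have "(\<gamma> has_derivative (\<lambda>t. L2 *v lift (t *\<^sub>R k) (D2 (t *\<^sub>R k)) + 0)) (at 0)"
    unfolding \<gamma>_def
    by (intro has_derivative_add has_derivative_const bounded_linear.has_derivative[OF bounded_linear_matrix])
  moreover have "L2 *v lift (t *\<^sub>R k) (D2 (t *\<^sub>R k)) + 0 = t *\<^sub>R v" for t
    unfolding v linear_cmul[OF has_derivative_linear[OF D2]] lift_scaleR
      linear_cmul[OF bounded_linear.linear[OF bounded_linear_matrix]] by simp
  ultimately have \<gamma>: "(\<gamma> has_derivative (\<lambda>t. t *\<^sub>R v)) (at 0)" by simp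
  define \<sigma> where "\<sigma> t = matrix_inv L *v (\<gamma> t - b)" for t
  have \<sigma>: "(\<sigma> has_derivative (\<lambda>t. matrix_inv L *v (t *\<^sub>R v - 0))) (at 0)"
    unfolding \<sigma>_def
    by (intro bounded_linear.has_derivative[OF bounded_linear_matrix] has_derivative_diff \<gamma> has_derivative_const)
  have \<gamma>0: "\<gamma> 0 = p" by (simp add: \<gamma>_def p2)
  have \<sigma>0: "\<sigma> 0 = lift u0 (G u0)"
    using matrix_inv_mult_vec(1)[OF L] by (simp add: \<sigma>_def \<gamma>0 p)
  have tend: "(\<gamma> \<longlongrightarrow> p) (at 0)"
    using has_derivative_continuous[OF \<gamma>] by (simp add: isCont_def \<gamma>0)
  have tend2: "((\<lambda>t. u2 + t *\<^sub>R k) \<longlongrightarrow> u2) (at 0)"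
    using has_derivative_continuous[OF line] by (simp add: isCont_def)
  have op: "open V" "open V2" "open U2"
    using ch ch2 by (auto simp: graph_chart_def cholo_def)
  have "\<forall>\<^sub>F t in at 0. \<gamma> t \<in> V \<and> \<gamma> t \<in> V2 \<and> u2 + t *\<^sub>R k \<in> U2"
    using topological_tendstoD[OF tend op(1) pV] topological_tendstoD[OF tend op(2) \<open>p \<in> V2\<close>]
      topological_tendstoD[OF tend2 op(3) \<open>u2 \<in> U2\<close>]
    by eventually_elim simp
  then have ev: "\<forall>\<^sub>F t in at 0. wc (\<sigma> t) = G (proj3 (\<sigma> t))"
  proof eventually_elim
    case (elim t)
    then have "\<gamma> t \<in> (\<lambda>u. L2 *v lift u (G2 u) + b2) ` U2 \<inter> V2" by (auto simp: \<gamma>_def)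
    then have "\<gamma> t \<in> S \<inter> V" using ch2 elim by (auto simp: graph_chart_def)
    then have "\<gamma> t \<in> (\<lambda>u. L *v lift u (G u) + b) ` U" using ch by (auto simp: graph_chart_def)
    then obtain u where "\<gamma> t = L *v lift u (G u) + b" by blast
    then have "\<sigma> t = lift u (G u)" using matrix_inv_mult_vec(1)[OF L] by (simp add: \<sigma>_def)
    then show ?case by simp
  qed
  have 1: "((\<lambda>t. wc (\<sigma> t)) has_derivative (\<lambda>t. wc (matrix_inv L *v (t *\<^sub>R v - 0)))) (at 0)"
    by (rule bounded_linear.has_derivative[OF bounded_linear_wc \<sigma>])
  have "((\<lambda>t. proj3 (\<sigma> t)) has_derivative (\<lambda>t. proj3 (matrix_inv L *v (t *\<^sub>R v - 0)))) (at 0)"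
    by (rule bounded_linear.has_derivative[OF bounded_linear_proj3 \<sigma>])
  from has_derivative_compose[OF this, of G D]
  have "((\<lambda>t. G (proj3 (\<sigma> t))) has_derivative (\<lambda>t. D (proj3 (matrix_inv L *v (t *\<^sub>R v - 0))))) (at 0)"
    using D by (simp add: \<sigma>0)
  moreover have "\<forall>\<^sub>F t in at 0. G (proj3 (\<sigma> t)) = wc (\<sigma> t)"
    using ev by eventually_elim simp
  ultimately have "((\<lambda>t. wc (\<sigma> t)) has_derivative (\<lambda>t. D (proj3 (matrix_inv L *v (t *\<^sub>R v - 0))))) (at 0)"
    by (rule has_derivative_transform_eventually) (simp_all add: \<sigma>0)
  from has_derivative_unique[OF 1 this]
  have "(\<lambda>t::real. wc (matrix_inv L *v (t *\<^sub>R v - 0))) = (\<lambda>t. D (proj3 (matrix_inv L *v (t *\<^sub>R v - 0))))" .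
  from fun_cong[OF this, of 1] show "wc (matrix_inv L *v v) = D (proj3 (matrix_inv L *v v))" by simp
qed

text \<open>Tangent vectors form the graph of a complex-linear functional in suitable coordinates.
  This makes tangency a linear condition and the symmetries a complex vector space.\<close>

lemma tangent_space:
  assumes "hypersurface S" "p \<in> S"
  obtains N :: "complex^4^4" and D where "invertible N"
    "\<And>v. tangent S p v \<longleftrightarrow> wc (N *v v) = D (proj3 (N *v v))"
    "\<And>u v. D (u + v) = D u + D v" "\<And>c u. D (c *s u) = c * D u"
proof -
  obtain L b U G V where ch: "graph_chart S L b U G V" "p \<in> V"
    using assms unfolding hypersurface_def by blast
  then have "p \<in> (\<lambda>u. L *v lift u (G u) + b) ` U" and L: "invertible L" and G: "cholo U G"
    using assms(2) by (auto simp: graph_chart_def)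
  then obtain u0 where u0: "u0 \<in> U" "p = L *v lift u0 (G u0) + b" by blast
  obtain D where D: "(G has_derivative D) (at u0)" "\<And>c v. D (c *s v) = c * D v"
    using choloD[OF G u0(1)] by blast
  show thesis
  proof (rule that[OF invertible_matrix_inv[OF L] tangent_chart_iff[OF ch u0 D(1)] _ D(2)])
    show "D (u + v) = D u + D v" for u v
      using linear_add[OF has_derivative_linear[OF D(1)]] .
  qed
qed

lemma mat_mult_vec: "mat a *v x = a *s x" for x :: "complex^'n"
  by (simp add: vec_eq_iff matrix_vector_mult_def mat_def if_distrib[of "\<lambda>y. y * _"] cong: if_cong)

lemma aff_sym_add:
  assumes S: "hypersurface S" and "(M, c) \<in> aff_sym S" "(M', c') \<in> aff_sym S"
  shows "(M + M', c + c') \<in> aff_sym S"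
  unfolding aff_sym_def
proof (clarify)
  fix q assume q: "q \<in> S"
  obtain N D where N: "\<And>v. tangent S q v \<longleftrightarrow> wc (N *v v) = D (proj3 (N *v v))"
    "\<And>u v. D (u + v) = D u + D v"
    by (rule tangent_space[OF S q]) (rule that)
  have "tangent S q (M *v q + c)" "tangent S q (M' *v q + c')" using assms q by (auto simp: aff_sym_def)
  then have "tangent S q ((M *v q + c) + (M' *v q + c'))"
    unfolding N by (simp only: matrix_vector_right_distrib[of N "M *v q + c" "M' *v q + c'"] wc_linear proj3_linear N(2))
  then show "tangent S q ((M + M') *v q + (c + c'))"
    by (simp add: matrix_vector_mult_add_rdistrib algebra_simps)
qed

lemma aff_sym_scale:
  assumes S: "hypersurface S" and "(M, c) \<in> aff_sym S"
  shows "(mat a ** M, a *s c) \<in> aff_sym S"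
  unfolding aff_sym_def
proof (clarify)
  fix q assume q: "q \<in> S"
  obtain N :: "complex^4^4" and D where N: "\<And>v. tangent S q v \<longleftrightarrow> wc (N *v v) = D (proj3 (N *v v))"
    "\<And>c u. D (c *s u) = c * D u"
    by (rule tangent_space[OF S q]) (rule that)
  have "tangent S q (M *v q + c)" using assms q by (auto simp: aff_sym_def)
  then have "tangent S q (a *s (M *v q + c))"
    unfolding N by (simp only: matrix_scale wc_linear proj3_linear N(2))
  then show "tangent S q ((mat a ** M) *v q + a *s c)"
    by (simp add: mat_mult_vec vector_add_ldistrib flip: matrix_vector_mul_assoc)
qed

text \<open>As columns of a 4 x 4 matrix with vanishing last row, the vectors give a map that misses
  e4, hence is not injective.\<close>

lemma four_vectors_dependent:
  fixes k0 k1 k2 k3 :: "complex^3"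
  obtains l0 l1 l2 l3 where "l0 *s k0 + l1 *s k1 + l2 *s k2 + l3 *s k3 = 0"
    "\<not> (l0 = 0 \<and> l1 = 0 \<and> l2 = 0 \<and> l3 = 0)"
proof -
  define N where "N = transpose (vector [lift k0 0, lift k1 0, lift k2 0, lift k3 0] :: complex^4^4)"
  have v4: "(vector [a, b, c, d] :: 'z^4) $ 1 = a" "(vector [a, b, c, d] :: 'z^4) $ 2 = b"
    "(vector [a, b, c, d] :: 'z^4) $ 3 = c" "(vector [a, b, c, d] :: 'z^4) $ 4 = d" for a b c d :: "'z :: zero"
    by (simp_all add: vector_def)
  have N: "N *v x = lift (x$1 *s k0 + x$2 *s k1 + x$3 *s k2 + x$4 *s k3) 0" for x
    by (simp add: N_def vec4_eq matrix_vector_mult_def sum_4 transpose_def v4 mult.commute)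
  have "\<not> (\<forall>x. N *v x = 0 \<longrightarrow> x = 0)"
  proof
    assume "\<forall>x. N *v x = 0 \<longrightarrow> x = 0"
    then have "invertible N" unfolding invertible_iff_inj inj_mult_iff .
    then have "N *v (matrix_inv N *v lift 0 1) = lift 0 1" by (rule matrix_inv_mult_vec)
    then have "wc (lift 0 1) = wc (N *v (matrix_inv N *v lift 0 1))" by simp
    then show False by (simp add: N)
  qed
  then obtain x where x: "N *v x = 0" "x \<noteq> 0" by blast
  from x(1) have "proj3 (N *v x) = 0" by simp
  then show thesis
    using x(2) by (intro that[of "x$1" "x$2" "x$3" "x$4"]) (auto simp: N vec4_eq)
qed

lemma proj3_matrix_combination:
  "proj3 (N *v (a *s x + b *s y + c *s z + d *s w))
    = a *s proj3 (N *v x) + b *s proj3 (N *v y) + c *s proj3 (N *v z) + d *s proj3 (N *v w)"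
  by (simp only: matrix_vector_right_distrib matrix_scale proj3_linear)

text \<open>The symmetry algebra has dimension at least 4 by looking at the point with isotropy, while every
  tangent space has dimension 3.\<close>
lemma isotropy_everywhere:
  assumes S: "hypersurface S" "homogeneous S" "has_isotropy S" and p: "p \<in> S"
  obtains M c where "(M, c) \<in> aff_sym S" "M *v p + c = 0" "(M, c) \<noteq> (0, 0)"
proof -
  obtain p0 M0 c0 where p0: "p0 \<in> S" and M0: "(M0, c0) \<in> aff_sym S" "(M0, c0) \<noteq> (0, 0)" "M0 *v p0 + c0 = 0"
    using S(3) unfolding has_isotropy_def by blast
  obtain N0 :: "complex^4^4" and D0 where N0: "invertible N0" "\<And>v. tangent S p0 v \<longleftrightarrow> wc (N0 *v v) = D0 (proj3 (N0 *v v))"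
    by (rule tangent_space[OF S(1) p0]) (rule that)
  obtain N :: "complex^4^4" and D where N: "invertible N" "\<And>v. tangent S p v \<longleftrightarrow> wc (N *v v) = D (proj3 (N *v v))"
    "\<And>u v. D (u + v) = D u + D v" "\<And>c u. D (c *s u) = c * D u"
    by (rule tangent_space[OF S(1) p]) (rule that)
  have "\<exists>M c. (M, c) \<in> aff_sym S \<and> proj3 (N0 *v (M *v p0 + c)) = k" for k
  proof -
    define v where "v = matrix_inv N0 *v lift k (D0 k)"
    have v: "N0 *v v = lift k (D0 k)" unfolding v_def by (rule matrix_inv_mult_vec[OF N0(1)])
    then have "tangent S p0 v" by (simp add: N0)
    then obtain M c where "(M, c) \<in> aff_sym S" "M *v p0 + c = v"
      using S(2) p0 unfolding homogeneous_def by blast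
    then show ?thesis using v by (intro exI[of _ M] exI[of _ c]) simp
  qed
  \<comment> \<open>By homogeneity three symmetries have independent values at \<open>p0\<close>;
    with the isotropy \<open>M0\<close> there they form a four-dimensional family.\<close>
  then obtain M1 c1 M2 c2 M3 c3 where
    M1: "(M1, c1) \<in> aff_sym S" "proj3 (N0 *v (M1 *v p0 + c1)) = vec3 1 0 0" and
    M2: "(M2, c2) \<in> aff_sym S" "proj3 (N0 *v (M2 *v p0 + c2)) = vec3 0 1 0" and
    M3: "(M3, c3) \<in> aff_sym S" "proj3 (N0 *v (M3 *v p0 + c3)) = vec3 0 0 1"
    by meson
  \<comment> \<open>A tangent vector at p is determined by its three base coordinates, so a
    nontrivial combination of the four fields vanishes at p.\<close>
  obtain l0 l1 l2 l3 where
    l: "l0 *s proj3 (N *v (M0 *v p + c0)) + l1 *s proj3 (N *v (M1 *v p + c1))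
      + l2 *s proj3 (N *v (M2 *v p + c2)) + l3 *s proj3 (N *v (M3 *v p + c3)) = 0"
    and ln: "\<not> (l0 = 0 \<and> l1 = 0 \<and> l2 = 0 \<and> l3 = 0)"
    by (rule four_vectors_dependent)
  define M c where "M = mat l0 ** M0 + mat l1 ** M1 + mat l2 ** M2 + mat l3 ** M3"
    and "c = l0 *s c0 + l1 *s c1 + l2 *s c2 + l3 *s c3"
  have val: "M *v x + c = l0 *s (M0 *v x + c0) + l1 *s (M1 *v x + c1) + l2 *s (M2 *v x + c2) + l3 *s (M3 *v x + c3)" for x
    unfolding M_def c_def
    by (simp add: matrix_vector_mult_add_rdistrib mat_mult_vec vector_add_ldistrib algebra_simps
        flip: matrix_vector_mul_assoc)
  have sym: "(M, c) \<in> aff_sym S"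
    unfolding M_def c_def by (intro aff_sym_add[OF S(1)] aff_sym_scale[OF S(1)] M0 M1 M2 M3)
  have "proj3 (N *v (M *v p + c)) = 0"
    unfolding val proj3_matrix_combination by (rule l)
  moreover have "tangent S p (M *v p + c)" using sym p by (auto simp: aff_sym_def)
  moreover have "D 0 = 0" using N(4)[of 0 0] by simp
  ultimately have "N *v (M *v p + c) = 0"
    unfolding N(2) by (metis lift_0 lift_proj3)
  then have "M *v p + c = 0" using N(1) unfolding invertible_iff_inj inj_mult_iff by blast
  moreover have "(M, c) \<noteq> (0, 0)"
  proof
    assume 0: "(M, c) = (0, 0)"
    then have "proj3 (N0 *v (M *v p0 + c)) = 0" by simp
    \<comment> \<open>At \<open>p0\<close> the field \<open>M0\<close> vanishes and the other three
      are independent, so only l0 can survive, and then \<open>M0\<close> itself would be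
      trivial.\<close>
    then have "l1 *s vec3 1 0 0 + l2 *s vec3 0 1 0 + l3 *s vec3 0 0 1 = (0 :: complex^3)"
      unfolding val M0(3) proj3_matrix_combination M1(2) M2(2) M3(2) by simp
    then have l123: "l1 = 0" "l2 = 0" "l3 = 0" by (simp_all add: vec3_eq)
    then have l0: "l0 \<noteq> 0" using ln by simp
    have "mat l0 ** M0 = 0" "l0 *s c0 = 0" using 0 l123 by (simp_all add: M_def c_def mat_0)
    then have "c0 = 0" using l0 by (simp add: vec_eq_iff)
    have "l0 *s (M0 *v x) = 0" for x
      using \<open>mat l0 ** M0 = 0\<close> by (metis mat_mult_vec matrix_vector_mul_assoc matrix_vector_mult_0)
    then have "M0 *v x = 0" for x using l0 by (simp add: vec_eq_iff)
    then have "M0 = 0" by (simp add: matrix_eq)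
    with \<open>c0 = 0\<close> M0(2) show False by simp
  qed
  ultimately show thesis using sym by (intro that)
qed

section \<open>Tangency up to third order and the equations of an isotropy\<close>

definition dQ0 :: "complex^3 \<Rightarrow> complex^3 \<Rightarrow> complex" where
  "dQ0 u w = 2 * (u$1 * w$2 + u$2 * w$1 + u$3 * w$3)"

definition dcubic :: "complex \<Rightarrow> complex \<Rightarrow> complex \<Rightarrow> complex \<Rightarrow> complex \<Rightarrow> complex \<Rightarrow> complex \<Rightarrow> complex
    \<Rightarrow> complex \<Rightarrow> complex \<Rightarrow> complex^3 \<Rightarrow> complex^3 \<Rightarrow> complex" where
  "dcubic k1 k2 k3 k4 k5 k6 k7 k8 k9 k10 u w =
    (3 * k1 * (u$1)^2 + 2 * k4 * u$1 * u$2 + 2 * k5 * u$1 * u$3 + k6 * (u$2)^2 + k8 * (u$3)^2 + k10 * u$2 * u$3) * w$1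
  + (3 * k2 * (u$2)^2 + k4 * (u$1)^2 + 2 * k6 * u$1 * u$2 + 2 * k7 * u$2 * u$3 + k9 * (u$3)^2 + k10 * u$1 * u$3) * w$2
  + (3 * k3 * (u$3)^2 + k5 * (u$1)^2 + k7 * (u$2)^2 + 2 * k8 * u$1 * u$3 + 2 * k9 * u$2 * u$3 + k10 * u$1 * u$2) * w$3"

lemma has_derivative_nth: "((\<lambda>u. u$i) has_derivative (\<lambda>w. w$i)) (at u)" for u :: "complex^3"
  by (rule bounded_linear_imp_has_derivative[OF bounded_linear_vec_nth])

lemma Q0_has_derivative: "(Q0 has_derivative dQ0 u) (at u)"
proof -
  have "((\<lambda>u. 2 * u$1 * u$2 + (u$3)^2) has_derivative dQ0 u) (at u)"
    by (rule has_derivative_eq_rhs, (rule derivative_intros has_derivative_nth)+)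
      (simp add: dQ0_def fun_eq_iff algebra_simps)
  then show ?thesis unfolding Q0_def[abs_def] .
qed

lemma cubic_has_derivative:
  "(cubic k1 k2 k3 k4 k5 k6 k7 k8 k9 k10 has_derivative dcubic k1 k2 k3 k4 k5 k6 k7 k8 k9 k10 u) (at u)"
  unfolding cubic_def[abs_def]
  by (rule has_derivative_eq_rhs, (rule derivative_intros has_derivative_nth)+)
    (simp add: dcubic_def fun_eq_iff algebra_simps)

lemma cubic_coeffs_small_o:
  fixes a b c :: complex
  assumes d: "d > 0" and small: "\<And>s. norm s < d \<Longrightarrow> norm (a * s + b * s^2 + c * s^3) \<le> K * norm s ^ 4"
  shows "a = 0" "b = 0" "c = 0"
proof -
  have bound: "norm (a * s + b * s^2) \<le> (norm c + \<bar>K\<bar>) * norm s ^ 3" if s: "norm s < d" "norm s < 1" for s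
  proof -
    have "norm (a * s + b * s^2) \<le> K * norm s ^ 4 + norm c * norm s ^ 3"
      using small[OF s(1)] norm_triangle_ineq4[of "a * s + b * s^2 + c * s^3" "c * s^3"]
      by (simp add: norm_mult norm_power)
    also have "K * norm s ^ 4 \<le> \<bar>K\<bar> * norm s ^ 3"
      using s(2) by (intro mult_mono power_decreasing) auto
    finally show ?thesis by (simp add: algebra_simps)
  qed
  have ab: "a = 0 \<and> b = 0"
  proof -
    have "\<exists>d>0. \<forall>t. norm t < d \<longrightarrow> norm (0 + a * t + b * t^2) \<le> e * norm t ^ 2" if e: "e > 0" for e
    proof -
      define P where "P = norm c + \<bar>K\<bar> + 1"
      have P: "P > 0" by (simp add: P_def add_nonneg_pos)
      have "norm (0 + a * t + b * t^2) \<le> e * norm t ^ 2" if t: "norm t < min (min d 1) (e / P)" for t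
      proof -
        have "norm (a * t + b * t^2) \<le> (norm c + \<bar>K\<bar>) * norm t ^ 3" using bound t by simp
        also have "\<dots> \<le> P * norm t ^ 3" by (intro mult_right_mono) (auto simp: P_def)
        also have "\<dots> = (P * norm t) * norm t ^ 2" by (simp add: power2_eq_square power3_eq_cube)
        also have "\<dots> \<le> e * norm t ^ 2"
        proof (rule mult_right_mono)
          have "norm t < e / P" using t by simp
          then show "P * norm t \<le> e" using P by (simp add: pos_less_divide_eq mult.commute)
        qed simp
        finally show ?thesis by simp
      qed
      moreover have "min (min d 1) (e / P) > 0" using d e P by simp
      ultimately show ?thesis by blast
    qed
    from quadratic_coeffs_small_o(2,3)[OF this] show ?thesis by simp
  qed
  then show "a = 0" "b = 0" by simp_all
  show "c = 0"
  proof (rule eq_0_if_le_eps_norm)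
    fix e :: real assume e: "e > 0"
    define s where "s = min (d / 2) (e / (\<bar>K\<bar> + 1))"
    have K1: "\<bar>K\<bar> + 1 > 0" by simp
    have s: "s > 0" "s < d" "s \<le> e / (\<bar>K\<bar> + 1)" using d e K1 by (simp_all add: s_def min_less_iff_disj)
    have "norm c * s ^ 3 \<le> K * s ^ 4"
      using small[of "of_real s"] s ab by (simp add: norm_mult norm_power)
    also have "\<dots> = (K * s) * s ^ 3" by (simp add: power3_eq_cube power4_eq_xxxx)
    finally have "norm c \<le> K * s" using s(1) by simp
    also have "\<dots> \<le> (\<bar>K\<bar> + 1) * s" using s(1) by (intro mult_right_mono) auto
    also have "\<dots> \<le> e" using s(3) K1 by (simp add: pos_le_divide_eq mult.commute)
    finally show "norm c \<le> e" .
  qed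
qed

text \<open>An isotropy at the point over the origin vanishes there, so in the chart it is the
  linear field given by \<open>m\<close>, the conjugate of its matrix part.\<close>

lemma nf_chart_infinitesimal_symmetry:
  assumes S: "hypersurface S" "homogeneous S" "has_isotropy S"
    and g: "gchart S L b U F" and F0: "F 0 = 0"
  obtains m :: "complex^4^4" and V where "m \<noteq> 0" "open V" "0 \<in> V"
    "\<And>u D. u \<in> U \<Longrightarrow> lift u (F u) \<in> V \<Longrightarrow> (F has_derivative D) (at u) \<Longrightarrow>
      wc (m *v lift u (F u)) = D (proj3 (m *v lift u (F u)))"
proof -
  obtain V where V: "open V" "0 \<in> V" and eq: "(\<lambda>q. L *v q + b) ` S \<inter> V = (\<lambda>u. lift u (F u)) ` U \<inter> V"
    and L: "invertible L" and U: "cholo U F" "0 \<in> U"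
    using g by (auto simp: gchart_def)
  have inS: "\<exists>q\<in>S. L *v q + b = lift u (F u)" if "u \<in> U" "lift u (F u) \<in> V" for u
  proof -
    have "lift u (F u) \<in> (\<lambda>q. L *v q + b) ` S \<inter> V" unfolding eq using that by blast
    then show ?thesis by auto
  qed
  have "lift 0 (F 0) \<in> V" using V(2) F0 by simp
  from inS[OF U(2) this] obtain q0 where q0: "q0 \<in> S" "L *v q0 + b = 0" using F0 by auto
  obtain M c where M: "(M, c) \<in> aff_sym S" "M *v q0 + c = 0" "(M, c) \<noteq> (0, 0)"
    by (rule isotropy_everywhere[OF S q0(1)]) (rule that)
  define m where "m = L ** M ** matrix_inv L"
  have "m \<noteq> 0"
  proof
    assume "m = 0"
    have "M *v x = 0" for x
    proof -
      have "L *v (M *v x) = m *v (L *v x)"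
        unfolding m_def by (simp only: matrix_vector_mul_assoc[symmetric] matrix_inv_mult_vec(1)[OF L])
      also have "\<dots> = 0" unfolding \<open>m = 0\<close> by simp
      finally show ?thesis using L unfolding invertible_iff_inj inj_mult_iff by blast
    qed
    then have "M = 0" by (simp add: matrix_eq)
    moreover have "c = 0" using M(2) \<open>M = 0\<close> by simp
    ultimately show False using M(3) by simp
  qed
  let ?V = "{q. L *v q + b \<in> V}"
  have invinv: "matrix_inv (matrix_inv L) *v x = L *v x" for x
  proof -
    have "matrix_inv (matrix_inv L) *v (matrix_inv L *v (L *v x)) = L *v x"
      by (rule matrix_inv_mult_vec[OF invertible_matrix_inv[OF L]])
    then show ?thesis unfolding matrix_inv_mult_vec(1)[OF L] .
  qed
  have chart_inv: "matrix_inv L *v (L *v q + b) + - (matrix_inv L *v b) = q" for q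
    unfolding matrix_vector_right_distrib matrix_inv_mult_vec(1)[OF L] by simp
  have chart_fwd: "L *v (matrix_inv L *v x + - (matrix_inv L *v b)) + b = x" for x
    unfolding diff_conv_add_uminus[symmetric] matrix_vector_mult_diff_distrib matrix_inv_mult_vec(2)[OF L] by simp
  \<comment> \<open>The chart is rewritten as a \<open>graph_chart\<close> so that the tangency
    criterion applies with the graph function F itself.\<close>
  have chart: "graph_chart S (matrix_inv L) (- (matrix_inv L *v b)) U F ?V"
    unfolding graph_chart_def
  proof (intro conjI invertible_matrix_inv[OF L] open_affine_preimage V(1) U(1) set_eqI iffI)
    fix q assume q: "q \<in> S \<inter> ?V"
    then have "L *v q + b \<in> (\<lambda>u. lift u (F u)) ` U" using eq by blast
    then obtain u where "u \<in> U" "L *v q + b = lift u (F u)" by blast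
    then show "q \<in> (\<lambda>u. matrix_inv L *v lift u (F u) + - (matrix_inv L *v b)) ` U \<inter> ?V"
      using chart_inv[of q] q by (metis (no_types, lifting) IntD2 IntI image_eqI)
  next
    fix q assume q: "q \<in> (\<lambda>u. matrix_inv L *v lift u (F u) + - (matrix_inv L *v b)) ` U \<inter> ?V"
    then obtain u where u: "u \<in> U" "q = matrix_inv L *v lift u (F u) + - (matrix_inv L *v b)" by blast
    then have "L *v q + b = lift u (F u)" using chart_fwd by simp
    moreover have "L *v q + b \<in> V" using q by simp
    ultimately obtain q' where "q' \<in> S" "L *v q' + b = L *v q + b" using inS[OF u(1)] by auto
    then have "q' = q" using chart_inv[of q] chart_inv[of q'] by simp
    then show "q \<in> S \<inter> ?V" using \<open>q' \<in> S\<close> q by simp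
  qed
  show thesis
  proof (rule that[OF \<open>m \<noteq> 0\<close> V])
    fix u D assume u: "u \<in> U" "lift u (F u) \<in> V" and D: "(F has_derivative D) (at u)"
    obtain q where q: "q \<in> S" "L *v q + b = lift u (F u)" using inS[OF u] by blast
    have qV: "q \<in> ?V" using q u by simp
    have qe: "q = matrix_inv L *v lift u (F u) + - (matrix_inv L *v b)" using chart_inv[of q] q by simp
    have "tangent S q (M *v q + c)" using M(1) q(1) by (auto simp: aff_sym_def)
    then have t: "wc (L *v (M *v q + c)) = D (proj3 (L *v (M *v q + c)))"
      unfolding tangent_chart_iff[OF chart qV u(1) qe D] invinv .
    have "M *v q + c = M *v (q - q0)"
      using M(2) by (simp add: matrix_vector_mult_diff_distrib add_eq_0_iff)
    moreover have "q - q0 = matrix_inv L *v (L *v (q - q0))"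
      by (simp only: matrix_inv_mult_vec(1)[OF L])
    moreover have "L *v (q - q0) = lift u (F u)"
      using q(2) q0(2) by (simp add: matrix_vector_mult_diff_distrib) (metis add_diff_cancel_right' diff_zero add_diff_cancel_right)
    ultimately have "L *v (M *v q + c) = m *v lift u (F u)"
      unfolding m_def by (simp add: matrix_vector_mul_assoc[symmetric])
    then show "wc (m *v lift u (F u)) = D (proj3 (m *v lift u (F u)))" using t by simp
  qed
qed

text \<open>At the graph point over s u, the tangency equation is expanded in s. Up to an error
  O(s^4) it is a polynomial whose coefficients of s, s^2, s^3 are the three stated
  equations.\<close>

lemma nf_chart_isotropy_equations:
  assumes S: "hypersurface S" "homogeneous S" "has_isotropy S"
    and nf: "nf_chart S L b U F C" and C: "C = cubic k1 k2 k3 k4 k5 k6 k7 k8 k9 k10"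
  defines "dC \<equiv> dcubic k1 k2 k3 k4 k5 k6 k7 k8 k9 k10"
  obtains m :: "complex^4^4" where "m \<noteq> 0" "\<And>u. wc (m *v lift u 0) = 0"
    "\<And>u. wc (m *v lift 0 1) * Q0 u = dQ0 u (proj3 (m *v lift u 0))"
    "\<And>u. wc (m *v lift 0 1) * C u = dC u (proj3 (m *v lift u 0)) + Q0 u * dQ0 u (proj3 (m *v lift 0 1))"
proof -
  obtain K0 d0 where d0: "d0 > 0" and K0: "\<And>u. u \<in> U \<Longrightarrow> norm u < d0 \<Longrightarrow> norm (F u - Q0 u - C u) \<le> K0 * norm u ^ 4"
    and g: "gchart S L b U F"
    using nf unfolding nf_chart_gchart by blast
  have U: "cholo U F" "open U" "0 \<in> U" using g by (auto simp: gchart_def cholo_def)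
  have F0: "F 0 = 0" using K0[OF U(3)] d0 by (simp add: Q0_def C cubic_def)
  obtain m :: "complex^4^4" and V where m: "m \<noteq> 0" and V: "open V" "0 \<in> V" and
    sym: "\<And>u D. u \<in> U \<Longrightarrow> lift u (F u) \<in> V \<Longrightarrow> (F has_derivative D) (at u) \<Longrightarrow>
      wc (m *v lift u (F u)) = D (proj3 (m *v lift u (F u)))"
    by (rule nf_chart_infinitesimal_symmetry[OF S g F0]) (rule that)
  define K where "K = \<bar>K0\<bar>"
  have K: "K \<ge> 0" by (simp add: K_def)
  define R where "R u = F u - Q0 u - C u" for u
  have R: "norm (R u) \<le> K * norm u ^ 4" if "u \<in> U" "norm u < d0" for u
  proof -
    have "norm (R u) \<le> K0 * norm u ^ 4" using K0 that by (simp add: R_def)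
    also have "\<dots> \<le> K * norm u ^ 4" by (intro mult_right_mono) (auto simp: K_def)
    finally show ?thesis .
  qed
  have Rder: "(R has_derivative (\<lambda>w. D w - dQ0 u w - dC u w)) (at u)" if "(F has_derivative D) (at u)" for u D
    unfolding R_def C dC_def by (intro has_derivative_diff that Q0_has_derivative cubic_has_derivative)
  \<comment> \<open>Needed for Cauchy's estimate, which bounds the derivative of the remainder by
    the remainder.\<close>
  have Rcholo: "cholo U R"
    unfolding cholo_def
  proof (intro conjI U ballI)
    fix u assume "u \<in> U"
    then obtain D where D: "(F has_derivative D) (at u)" "\<And>c v. D (c *s v) = c * D v"
      using choloD[OF U(1)] by blast
    have "D (c *s v) - dQ0 u (c *s v) - dC u (c *s v) = c * (D v - dQ0 u v - dC u v)" for c v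
      unfolding D(2) by (simp add: dQ0_def dC_def dcubic_def algebra_simps)
    then show "\<exists>D. (R has_derivative D) (at u) \<and> (\<forall>c v. D (c *s v) = c * D v)"
      using Rder[OF D(1)] by (intro exI[of _ "\<lambda>w. D w - dQ0 u w - dC u w"] conjI allI)
  qed
  obtain d1 where d1: "d1 > 0" "ball 0 d1 \<subseteq> U" using U(2)[unfolded open_contains_ball] U(3) by blast
  have "isCont (\<lambda>u. lift u (F u)) 0"
  proof -
    obtain D where "(F has_derivative D) (at 0)" by (rule choloD[OF U(1,3)]) (rule that)
    from has_derivative_continuous[OF has_derivative_lift[OF has_derivative_ident this]] show ?thesis .
  qed
  then have "((\<lambda>u. lift u (F u)) \<longlongrightarrow> 0) (at 0)" by (simp add: isCont_def F0)
  from topological_tendstoD[OF this V]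
  obtain d2 where d2: "d2 > 0" "\<And>u. u \<noteq> 0 \<Longrightarrow> norm u < d2 \<Longrightarrow> lift u (F u) \<in> V"
    unfolding eventually_at by auto
  \<comment> \<open>The halving leaves room for balls of radius |v| about v, whose points have norm
    at most 2 |v|.\<close>
  define d where "d = min d2 (min d0 d1 / 2)"
  have d: "d > 0" using d0 d1 d2 by (simp add: d_def)
  have dU: "v \<in> U" "norm v < d0" if "norm v < 2 * d" for v
    using that d1 by (auto simp: d_def subset_iff min_def split: if_splits)
  define \<beta> where "\<beta> = wc (m *v lift 0 1)"
  define B where "B = proj3 (m *v lift 0 1)"
  have all: "wc (m *v lift u 0) = 0 \<and> \<beta> * Q0 u - dQ0 u (proj3 (m *v lift u 0)) = 0
    \<and> \<beta> * C u - dC u (proj3 (m *v lift u 0)) - Q0 u * dQ0 u B = 0" for u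
  proof -
    define \<alpha> where "\<alpha> = wc (m *v lift u 0)"
    define A where "A = proj3 (m *v lift u 0)"
    define n where "n = norm u"
    have n: "n \<ge> 0" by (simp add: n_def)
    define KF where "KF = norm (Q0 u) + norm (C u) + K * n^4"
    have KF: "KF \<ge> 0" using K n by (simp add: KF_def)
    define K1 where "K1 = norm \<beta> * (K * n^4) + (norm (C u) + K * n^4) * norm (dQ0 u B) + KF * norm (dC u B)
       + 16 * K * n^3 * (norm A + KF * norm B)"
    define e where "e = min 1 (d / (n + 1))"
    have e: "e > 0" using d n by (simp add: e_def)
    have "norm (\<alpha> * s + (\<beta> * Q0 u - dQ0 u A) * s^2 + (\<beta> * C u - dC u A - Q0 u * dQ0 u B) * s^3) \<le> K1 * norm s ^ 4"
      if s: "norm s < e" for s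
    \<comment> \<open>The zero vector is separated because the Cauchy ball has radius |s u| and
      because \<open>d2\<close> controls nonzero points only.\<close>
    proof (cases "s *s u = 0")
      case True
      show ?thesis
      proof (cases "s = 0")
        case False
        then have "u = 0" using True by (simp add: vec_eq_iff)
        then have "\<alpha> = 0" "Q0 u = 0" "C u = 0" "\<And>w. dQ0 u w = 0" "\<And>w. dC u w = 0"
          by (simp_all add: \<alpha>_def Q0_def C cubic_def dQ0_def dC_def dcubic_def)
        moreover have "K1 \<ge> 0" using K n KF by (simp add: K1_def)
        ultimately show ?thesis by simp
      qed simp
    next
      case v0: False
      define v where "v = s *s u"
      have s1: "norm s \<le> 1" using s by (simp add: e_def)
      have nv: "norm v = norm s * n" by (simp add: v_def norm_cscale n_def)
      have "norm s * (n + 1) < d" using s n by (simp add: e_def pos_less_divide_eq)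
      moreover have "norm s * n \<le> norm s * (n + 1)" by (rule mult_left_mono) auto
      ultimately have vd: "norm v < d" unfolding nv by linarith
      then have vU: "v \<in> U" using dU[of v] d by simp
      obtain D where D: "(F has_derivative D) (at v)" by (rule choloD[OF U(1) vU]) (rule that)
      have vV: "lift v (F v) \<in> V" using d2(2)[of v] v0 vd by (simp add: v_def d_def)
      define \<rho> where "\<rho> w = D w - dQ0 v w - dC v w" for w
      \<comment> \<open>\<open>\<rho>\<close> is the derivative of the remainder at v. Cauchy's
        estimate with radius |v| and the bound K (2|v|)^4 gives the factor 16 K |v|^3.\<close>
      have \<rho>: "norm (\<rho> w) \<le> 16 * K * norm v ^ 3 * norm w" for w
      proof -
        have v_pos: "norm v > 0" using v0 by (simp add: v_def)
        have near: "norm y \<le> 2 * norm v" if "y \<in> cball v (norm v)" for y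
          using that norm_triangle_ineq2[of y v] by (simp add: dist_norm norm_minus_commute)
        have near': "norm y < 2 * d" if "y \<in> cball v (norm v)" for y
          using near[OF that] vd by simp
        have "norm (\<rho> w) \<le> (K * (2 * norm v)^4) / norm v * norm w"
          unfolding \<rho>_def
        proof (rule cholo_derivative_bound[OF Rcholo _ v_pos _ Rder[OF D]])
          show "cball v (norm v) \<subseteq> U" using dU(1) near' by blast
          fix y assume y: "y \<in> cball v (norm v)"
          have "norm (R y) \<le> K * norm y ^ 4" using R dU near'[OF y] by blast
          also have "\<dots> \<le> K * (2 * norm v)^4" using near[OF y] K by (intro mult_left_mono power_mono) auto
          finally show "norm (R y) \<le> K * (2 * norm v)^4" .
        qed
        also have "\<dots> = 16 * K * norm v ^ 3 * norm w"
          using v_pos by (simp add: power_mult_distrib power4_eq_xxxx power3_eq_cube)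
        finally show ?thesis .
      qed
      have lv: "lift v (F v) = s *s lift u 0 + F v *s lift 0 1" by (simp add: vec4_eq v_def)
      have eqn: "s * \<alpha> + F v * \<beta> = D (s *s A + F v *s B)"
        using sym[OF vU vV D] unfolding lv matrix_vector_right_distrib matrix_scale wc_linear proj3_linear
        by (simp only: \<alpha>_def \<beta>_def A_def B_def)
      define \<epsilon> where "\<epsilon> = R v"
      have hom: "Q0 v = s^2 * Q0 u" "C v = s^3 * C u" "\<And>w. dQ0 v w = s * dQ0 u w" "\<And>w. dC v w = s^2 * dC u w"
        by (simp_all add: v_def Q0_def C cubic_def dQ0_def dC_def dcubic_def power2_eq_square power3_eq_cube algebra_simps)
      have Fv: "F v = s^2 * Q0 u + s^3 * C u + \<epsilon>" by (simp add: \<epsilon>_def R_def hom)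
      have \<epsilon>: "norm \<epsilon> \<le> K * n^4 * norm s ^ 4"
        using R[OF vU] dU(2)[of v] vd d by (simp add: \<epsilon>_def nv power_mult_distrib mult_ac)
      have s43: "norm s ^ 4 \<le> norm s ^ 3" "norm s ^ 3 \<le> norm s ^ 2" "norm s ^ 4 \<le> norm s ^ 2" "norm s ^ 2 \<le> norm s"
        using s1 power_decreasing[of 3 4 "norm s"] power_decreasing[of 2 3 "norm s"] power_decreasing[of 2 4 "norm s"]
          power_decreasing[of 1 2 "norm s"] by simp_all
      have CE: "norm (s^3 * C u + \<epsilon>) \<le> (norm (C u) + K * n^4) * norm s ^ 3"
      proof -
        have "norm (s^3 * C u + \<epsilon>) \<le> norm (s^3 * C u) + norm \<epsilon>" by (rule norm_triangle_ineq)
        also have "\<dots> \<le> norm s ^ 3 * norm (C u) + K * n^4 * norm s ^ 3"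
          using \<epsilon> mult_left_mono[OF s43(1), of "K * n^4"] K n by (simp add: norm_mult norm_power)
        finally show ?thesis by (simp add: algebra_simps)
      qed
      have FE: "norm (F v) \<le> KF * norm s ^ 2"
      proof -
        have "norm (F v) \<le> norm (s^2 * Q0 u) + norm (s^3 * C u + \<epsilon>)"
          unfolding Fv add.assoc by (rule norm_triangle_ineq)
        also have "\<dots> \<le> norm s ^ 2 * norm (Q0 u) + (norm (C u) + K * n^4) * norm s ^ 2"
          using CE mult_left_mono[OF s43(2), of "norm (C u) + K * n^4"] K n by (simp add: norm_mult norm_power)
        finally show ?thesis by (simp add: KF_def algebra_simps)
      qed
      have \<rho>E: "norm (\<rho> (s *s A + F v *s B)) \<le> 16 * K * n^3 * (norm A + KF * norm B) * norm s ^ 4"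
      proof -
        have "norm (s *s A + F v *s B) \<le> norm s * norm A + norm (F v) * norm B"
          using norm_triangle_ineq[of "s *s A" "F v *s B"] by (simp add: norm_cscale)
        also have "\<dots> \<le> norm s * norm A + (KF * norm s) * norm B"
          using FE mult_left_mono[OF s43(4) KF] by (intro add_left_mono mult_right_mono) auto
        finally have 1: "norm (s *s A + F v *s B) \<le> norm s * (norm A + KF * norm B)" by (simp add: algebra_simps)
        have "norm (\<rho> (s *s A + F v *s B)) \<le> 16 * K * norm v ^ 3 * norm (s *s A + F v *s B)" by (rule \<rho>)
        also have "\<dots> \<le> 16 * K * norm v ^ 3 * (norm s * (norm A + KF * norm B))"
          using 1 K by (intro mult_left_mono) auto
        also have "\<dots> = 16 * K * n^3 * (norm A + KF * norm B) * norm s ^ 4"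
          by (simp add: nv power_mult_distrib power3_eq_cube power4_eq_xxxx)
        finally show ?thesis .
      qed
      have Dw: "D w = \<rho> w + s * dQ0 u w + s^2 * dC u w" for w by (simp add: \<rho>_def hom)
      have lin: "dQ0 u (s *s A + F v *s B) = s * dQ0 u A + F v * dQ0 u B"
        "dC u (s *s A + F v *s B) = s * dC u A + F v * dC u B"
        by (simp_all add: dQ0_def dC_def dcubic_def algebra_simps)
      have E: "s * \<alpha> + F v * \<beta> = \<rho> (s *s A + F v *s B) + s * (s * dQ0 u A + F v * dQ0 u B) + s^2 * (s * dC u A + F v * dC u B)"
        using eqn unfolding Dw lin .
      have "\<alpha> * s + (\<beta> * Q0 u - dQ0 u A) * s^2 + (\<beta> * C u - dC u A - Q0 u * dQ0 u B) * s^3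
        = (s * \<alpha> + F v * \<beta>) - \<beta> * \<epsilon> - s^2 * dQ0 u A - s^3 * dC u A - s^3 * Q0 u * dQ0 u B"
        unfolding Fv by (simp add: algebra_simps)
      also have "\<dots> = (- (\<beta> * \<epsilon>)) + s * (s^3 * C u + \<epsilon>) * dQ0 u B + s^2 * F v * dC u B + \<rho> (s *s A + F v *s B)"
      proof -
        have F1: "s * (F v * dQ0 u B) = s * (s^3 * C u + \<epsilon>) * dQ0 u B + s^3 * Q0 u * dQ0 u B"
          unfolding Fv by (simp add: algebra_simps power2_eq_square power3_eq_cube)
        show ?thesis unfolding E distrib_left F1 by (simp add: algebra_simps power2_eq_square power3_eq_cube)
      qed
      also have "norm \<dots> \<le> norm \<beta> * (K * n^4) * norm s ^ 4 + (norm (C u) + K * n^4) * norm (dQ0 u B) * norm s ^ 4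
          + KF * norm (dC u B) * norm s ^ 4 + 16 * K * n^3 * (norm A + KF * norm B) * norm s ^ 4"
      proof (intro norm_triangle_mono \<rho>E)
        show "norm (- (\<beta> * \<epsilon>)) \<le> norm \<beta> * (K * n^4) * norm s ^ 4"
          using mult_left_mono[OF \<epsilon>, of "norm \<beta>"] by (simp add: norm_mult mult.assoc)
        have "norm (s * (s^3 * C u + \<epsilon>) * dQ0 u B) \<le> norm s * ((norm (C u) + K * n^4) * norm s ^ 3) * norm (dQ0 u B)"
          unfolding norm_mult using CE by (intro mult_right_mono mult_left_mono) auto
        then show "norm (s * (s^3 * C u + \<epsilon>) * dQ0 u B) \<le> (norm (C u) + K * n^4) * norm (dQ0 u B) * norm s ^ 4"
          by (simp add: power3_eq_cube power4_eq_xxxx mult_ac)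
        have "norm (s^2 * F v * dC u B) \<le> norm s ^ 2 * (KF * norm s ^ 2) * norm (dC u B)"
          unfolding norm_mult norm_power using FE by (intro mult_right_mono mult_left_mono) auto
        then show "norm (s^2 * F v * dC u B) \<le> KF * norm (dC u B) * norm s ^ 4"
          by (simp add: power2_eq_square power4_eq_xxxx mult_ac)
      qed
      also have "\<dots> = K1 * norm s ^ 4" unfolding K1_def by (simp only: distrib_right)
      finally show ?thesis .
    qed
    from cubic_coeffs_small_o[OF e this] show ?thesis by (simp only: \<alpha>_def A_def)
  qed
  show thesis
  proof (rule that[OF m])
    show "wc (m *v lift u 0) = 0" for u using all[of u] by (elim conjE)
    show "wc (m *v lift 0 1) * Q0 u = dQ0 u (proj3 (m *v lift u 0))" for u
      using all[of u] unfolding \<beta>_def by (elim conjE) (simp only: right_minus_eq)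
    show "wc (m *v lift 0 1) * C u = dC u (proj3 (m *v lift u 0)) + Q0 u * dQ0 u (proj3 (m *v lift 0 1))" for u
      using all[of u] unfolding \<beta>_def B_def by (elim conjE) (simp only: right_minus_eq diff_diff_eq)
  qed
qed

section \<open>Cubic forms with infinitesimal isotropy\<close>

text \<open>The parameters run through the basis in order of weight, from 3 for x^3 to -3 for y^3;
  the dependent entries of \<open>cubic\<close> encode vanishing trace.\<close>

definition tf_cubic :: "complex \<Rightarrow> complex \<Rightarrow> complex \<Rightarrow> complex \<Rightarrow> complex \<Rightarrow> complex \<Rightarrow> complex \<Rightarrow> complex^3 \<Rightarrow> complex" where
  "tf_cubic a1 a2 a3 a4 a5 a6 a7 = cubic a1 a7 (- a4) a3 a2 a5 a6 (- 2 * a3) (- 2 * a5) (3 * a4)"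

definition dtf_cubic :: "complex \<Rightarrow> complex \<Rightarrow> complex \<Rightarrow> complex \<Rightarrow> complex \<Rightarrow> complex \<Rightarrow> complex
    \<Rightarrow> complex^3 \<Rightarrow> complex^3 \<Rightarrow> complex" where
  "dtf_cubic a1 a2 a3 a4 a5 a6 a7 = dcubic a1 a7 (- a4) a3 a2 a5 a6 (- 2 * a3) (- 2 * a5) (3 * a4)"

lemma tf_cubic_has_derivative:
  "(tf_cubic a1 a2 a3 a4 a5 a6 a7 has_derivative dtf_cubic a1 a2 a3 a4 a5 a6 a7 u) (at u)"
  unfolding tf_cubic_def dtf_cubic_def by (rule cubic_has_derivative)

lemma tracefree_cubicE:
  assumes "tracefree_cubic C"
  obtains a1 a2 a3 a4 a5 a6 a7 where "C = tf_cubic a1 a2 a3 a4 a5 a6 a7"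
proof -
  obtain a1 a2 a3 a4 a5 a6 a7 where *: "\<forall>u. (let x = u$1; y = u$2; z = u$3 in
      C u = a1 * x^3 + a2 * (x^2 * z) + a3 * (x^2 * y - 2 * x * z^2) + a4 * (3 * x * y * z - z^3)
          + a5 * (x * y^2 - 2 * y * z^2) + a6 * (y^2 * z) + a7 * y^3)"
    using assms unfolding tracefree_cubic_def by (elim exE) (rule that)
  have "C u = tf_cubic a1 a2 a3 a4 a5 a6 a7 u" for u
    using spec[OF *, of u] unfolding Let_def tf_cubic_def cubic_def by (simp add: algebra_simps)
  then show thesis by (intro that ext)
qed

text \<open>The elements of the orthogonal Lie algebra of \<open>Q0\<close>.\<close>
definition skew :: "complex \<Rightarrow> complex \<Rightarrow> complex \<Rightarrow> complex^3^3" where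
  "skew p q r = vector [vec3 p 0 q, vec3 0 (- p) r, vec3 (- r) (- q) 0]"

lemma skew_mult: "skew p q r *v u = vec3 (p * u$1 + q * u$3) (r * u$3 - p * u$2) (- (r * u$1) - q * u$2)"
  by (simp add: skew_def vec3_eq)

lemma matrix4_lift:
  "(m *v lift u w) $ i = m$i$1 * u$1 + m$i$2 * u$2 + m$i$3 * u$3 + m$i$4 * w" for m :: "complex^4^4"
  by (simp add: matrix_vector_mult_def sum_4)

text \<open>The second-order equation splits the tangential block into mu times the identity plus a
  skew part, with m44 = 2 mu. The trace of the third-order equation kills the last column above m44,
  so these four numbers determine m and cannot all vanish.\<close>

lemma nf_chart_isotropy_skew:
  assumes S: "hypersurface S" "homogeneous S" "has_isotropy S"
    and nf: "nf_chart S L b U F (tf_cubic a1 a2 a3 a4 a5 a6 a7)"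
  obtains p q r mu where "\<not> (p = 0 \<and> q = 0 \<and> r = 0 \<and> mu = 0)"
    "\<And>u. dtf_cubic a1 a2 a3 a4 a5 a6 a7 u (skew p q r *v u) + mu * tf_cubic a1 a2 a3 a4 a5 a6 a7 u = 0"
proof -
  obtain m :: "complex^4^4" where m: "m \<noteq> 0" and m1: "\<And>u. wc (m *v lift u 0) = 0"
    and m2: "\<And>u. wc (m *v lift 0 1) * Q0 u = dQ0 u (proj3 (m *v lift u 0))"
    and m3: "\<And>u. wc (m *v lift 0 1) * tf_cubic a1 a2 a3 a4 a5 a6 a7 u
      = dtf_cubic a1 a2 a3 a4 a5 a6 a7 u (proj3 (m *v lift u 0)) + Q0 u * dQ0 u (proj3 (m *v lift 0 1))"
    by (rule nf_chart_isotropy_equations[OF S nf tf_cubic_def, folded dtf_cubic_def]) (rule that)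
  have m4: "m$4$1 = 0" "m$4$2 = 0" "m$4$3 = 0"
    using m1[of "vec3 1 0 0"] m1[of "vec3 0 1 0"] m1[of "vec3 0 0 1"] by (simp_all add: wc_def matrix4_lift)
  have w: "wc (m *v lift 0 1) = m$4$4" by (simp add: wc_def matrix4_lift)
  have "(- 2 * m$2$1) * x^2 + (- 2 * m$1$2) * y^2 + (m$4$4 - 2 * m$3$3) * z^2
      + (2 * m$4$4 - 2 * m$1$1 - 2 * m$2$2) * (x * y) + (- 2 * m$2$3 - 2 * m$3$1) * (x * z)
      + (- 2 * m$1$3 - 2 * m$3$2) * (y * z) = 0" for x y z
    using m2[of "vec3 x y z"] unfolding w Q0_def dQ0_def
    by (simp add: matrix4_lift algebra_simps power2_eq_square)
  from quadratic_form_coeffs[OF this]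
  have c: "- 2 * m$2$1 = 0" "- 2 * m$1$2 = 0" "m$4$4 - 2 * m$3$3 = 0" "2 * m$4$4 - 2 * m$1$1 - 2 * m$2$2 = 0"
    "- 2 * m$2$3 - 2 * m$3$1 = 0" "- 2 * m$1$3 - 2 * m$3$2 = 0"
    by blast+
  have "2 * (m$2$2 - (2 * m$3$3 - m$1$1)) = 0" "2 * (m$3$1 - (- m$2$3)) = 0" "2 * (m$3$2 - (- m$1$3)) = 0"
    using c by algebra+
  then have k: "m$2$1 = 0" "m$1$2 = 0" "m$4$4 = 2 * m$3$3" "m$2$2 = 2 * m$3$3 - m$1$1"
    "m$3$1 = - m$2$3" "m$3$2 = - m$1$3"
    using c(1-3) unfolding mult_eq_0_iff right_minus_eq by simp_all
  define p where "p = m$1$1 - m$3$3"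
  define q where "q = m$1$3"
  define r where "r = m$2$3"
  define mu where "mu = m$3$3"
  define B1 where "B1 = m$1$4"
  define B2 where "B2 = m$2$4"
  define B3 where "B3 = m$3$4"
  have "(a1 * mu + 3 * a1 * p - a2 * r) * x^3
    + (-a6 * q + a7 * mu - 3 * a7 * p) * y^3
    + (2 * B3 - 2 * a3 * q - a4 * mu - 2 * a5 * r) * z^3
    + (4 * B2 - a2 * q + a3 * mu + a3 * p - 3 * a4 * r) * (x^2 * y)
    + (3 * a1 * q + a2 * mu + 2 * a2 * p + 5 * a3 * r) * (x^2 * z)
    + (4 * B1 - 3 * a4 * q + a5 * mu - a5 * p - a6 * r) * (x * y^2)
    + (5 * a5 * q + a6 * mu - 2 * a6 * p + 3 * a7 * r) * (y^2 * z)
    + (2 * B2 + 2 * a2 * q - 2 * a3 * mu - 2 * a3 * p + 6 * a4 * r) * (x * z^2)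
    + (2 * B1 + 6 * a4 * q - 2 * a5 * mu + 2 * a5 * p + 2 * a6 * r) * (y * z^2)
    + (4 * B3 + 6 * a3 * q + 3 * a4 * mu + 6 * a5 * r) * (x * y * z) = 0" for x y z
    using m3[of "vec3 x y z"] m4 k unfolding w Q0_def dQ0_def tf_cubic_def dtf_cubic_def cubic_def dcubic_def
      p_def q_def r_def mu_def B1_def B2_def B3_def
    by (simp add: matrix4_lift algebra_simps power2_eq_square power3_eq_cube)
  from cubic_form_coeffs[OF this]
  have K: "a1 * mu + 3 * a1 * p - a2 * r = 0"
    "-a6 * q + a7 * mu - 3 * a7 * p = 0"
    "2 * B3 - 2 * a3 * q - a4 * mu - 2 * a5 * r = 0"
    "4 * B2 - a2 * q + a3 * mu + a3 * p - 3 * a4 * r = 0"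
    "3 * a1 * q + a2 * mu + 2 * a2 * p + 5 * a3 * r = 0"
    "4 * B1 - 3 * a4 * q + a5 * mu - a5 * p - a6 * r = 0"
    "5 * a5 * q + a6 * mu - 2 * a6 * p + 3 * a7 * r = 0"
    "2 * B2 + 2 * a2 * q - 2 * a3 * mu - 2 * a3 * p + 6 * a4 * r = 0"
    "2 * B1 + 6 * a4 * q - 2 * a5 * mu + 2 * a5 * p + 2 * a6 * r = 0"
    "4 * B3 + 6 * a3 * q + 3 * a4 * mu + 6 * a5 * r = 0"
    by blast+
  \<comment> \<open>These combinations take the trace with respect to \<open>Q0\<close>: the terms
    in C and its image under the skew part are trace-free, and the product of \<open>Q0\<close> with
    a linear form remains.\<close>
  have "10 * B1 = 0" "10 * B2 = 0" "10 * B3 = 0"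
    using K by algebra+
  then have B: "B1 = 0" "B2 = 0" "B3 = 0" by simp_all
  have "\<not> (p = 0 \<and> q = 0 \<and> r = 0 \<and> mu = 0)"
  proof
    assume "p = 0 \<and> q = 0 \<and> r = 0 \<and> mu = 0"
    then have "m = 0" using k m4 B by (simp add: vec4_eq p_def q_def r_def mu_def B1_def B2_def B3_def)
    then show False using m by simp
  qed
  moreover have "dtf_cubic a1 a2 a3 a4 a5 a6 a7 u (skew p q r *v u) + mu * tf_cubic a1 a2 a3 a4 a5 a6 a7 u = 0" for u
  proof -
    have "proj3 (m *v lift u 0) = skew p q r *v u + mu *s u"
    proof -
      have e: "m$1$1 = p + mu" "m$2$2 = mu - p" "m$3$3 = mu" "m$1$3 = q" "m$2$3 = r" "m$3$1 = - r" "m$3$2 = - q"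
        using k by (simp_all add: p_def q_def r_def mu_def)
      show ?thesis unfolding vec3_eq skew_mult proj3_nth matrix4_lift e k(1,2) by (simp add: algebra_simps)
    qed
    moreover have "dQ0 u (proj3 (m *v lift 0 1)) = 0"
      using B by (simp add: dQ0_def matrix4_lift B1_def B2_def B3_def)
    \<comment> \<open>Euler's identity contributes 3 mu C; against 2 mu C from the w-component the
      net eigenvalue of the skew part is -mu.\<close>
    moreover have "dtf_cubic a1 a2 a3 a4 a5 a6 a7 u (skew p q r *v u + mu *s u)
        = dtf_cubic a1 a2 a3 a4 a5 a6 a7 u (skew p q r *v u) + 3 * mu * tf_cubic a1 a2 a3 a4 a5 a6 a7 u"
      unfolding dtf_cubic_def tf_cubic_def dcubic_def cubic_def
      by (simp only: vector_add_component vector_smult_component) (simp add: algebra_simps power2_eq_square power3_eq_cube)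
    moreover have "m$4$4 = 2 * mu" using k(3) by (simp add: mu_def)
    ultimately have "2 * mu * tf_cubic a1 a2 a3 a4 a5 a6 a7 u = dtf_cubic a1 a2 a3 a4 a5 a6 a7 u (skew p q r *v u)
        + 3 * mu * tf_cubic a1 a2 a3 a4 a5 a6 a7 u"
      using m3[of u] unfolding w by simp
    then show ?thesis by algebra
  qed
  ultimately show thesis by (rule that)
qed

text \<open>The effect on the cubic part of a conformal change of tangent coordinates with w divided
  by \<open>c\<close>; conformality with \<open>c \<noteq> 0\<close> makes \<open>R\<close>
  invertible.\<close>

definition equiv_cubic :: "(complex^3 \<Rightarrow> complex) \<Rightarrow> (complex^3 \<Rightarrow> complex) \<Rightarrow> bool" where
  "equiv_cubic C C' \<longleftrightarrow> (\<exists>R c. c \<noteq> 0 \<and> (\<forall>u. Q0 (R *v u) = c * Q0 u) \<and> (\<forall>u. C' u = C (R *v u) / c))"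

lemma equiv_cubic_trans:
  assumes "equiv_cubic C C'" "equiv_cubic C' C''" shows "equiv_cubic C C''"
proof -
  obtain R c R' c' where "c \<noteq> 0" "\<forall>u. Q0 (R *v u) = c * Q0 u" "\<forall>u. C' u = C (R *v u) / c"
    "c' \<noteq> 0" "\<forall>u. Q0 (R' *v u) = c' * Q0 u" "\<forall>u. C'' u = C' (R' *v u) / c'"
    using assms unfolding equiv_cubic_def by blast
  then show ?thesis
    unfolding equiv_cubic_def
    by (intro exI[of _ "R ** R'"] exI[of _ "c * c'"]) (simp add: matrix_vector_mul_assoc[symmetric])
qed

lemma nf_chart_equiv_cubic:
  assumes "nf_chart S L b U F C" "equiv_cubic C C'"
  shows "\<exists>L' b' U' F'. nf_chart S L' b' U' F' C'"
proof -
  obtain R c where R: "c \<noteq> 0" "\<And>u. Q0 (R *v u) = c * Q0 u" "\<And>u. C' u = C (R *v u) / c"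
    using assms(2) unfolding equiv_cubic_def by blast
  have "C' = (\<lambda>u. C (R *v u) / c)" using R(3) by (rule ext)
  then show ?thesis
    using nf_chart_linear[OF assms(1) invertible_if_conformal[OF R(2,1)] R(1,2)] by simp
qed

definition swap3 :: "complex^3^3" where
  "swap3 = vector [vec3 0 1 0, vec3 1 0 0, vec3 0 0 1]"

text \<open>The one-parameter group generated by the nilpotent \<open>skew 0 0 (- 1)\<close>; these
  are the tangential blocks of \<open>shearsI3\<close>.\<close>

definition shear3 :: "complex \<Rightarrow> complex^3^3" where
  "shear3 s = vector [vec3 1 0 0, vec3 (- (s^2 / 2)) 1 (- s), vec3 s 0 1]"

lemma swap3_mult: "swap3 *v u = vec3 (u$2) (u$1) (u$3)"
  by (simp add: swap3_def vec3_eq)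

lemma shear3_mult: "shear3 s *v u = vec3 (u$1) (u$2 - s^2 / 2 * u$1 - s * u$3) (s * u$1 + u$3)"
  by (simp add: shear3_def vec3_eq)

lemma equiv_cubic_swap: "equiv_cubic C (\<lambda>u. C (swap3 *v u))"
  unfolding equiv_cubic_def by (intro exI[of _ swap3] exI[of _ 1]) (simp add: swap3_mult Q0_def)

lemma equiv_cubic_shear: "equiv_cubic C (\<lambda>u. C (shear3 s *v u))"
  unfolding equiv_cubic_def
  by (intro exI[of _ "shear3 s"] exI[of _ 1])
    (simp add: shear3_mult Q0_def power2_eq_square algebra_simps)

text \<open>A dilation by 1/a scales the quadratic part by a^(-2) and the cubic by a^(-3), so
  renormalising w leaves the factor 1/a.\<close>

lemma equiv_cubic_scale:
  assumes "a \<noteq> 0" "\<And>u. C u = a * C' u" "\<And>t u. C' (t *s u) = t^3 * C' u"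
  shows "equiv_cubic C C'"
proof -
  have "C' u = C (mat (1 / a) *v u) / (1 / a)^2" for u
    unfolding mat_mult_vec assms(2,3) using assms(1) by (simp add: power2_eq_square power3_eq_cube)
  then show ?thesis
    unfolding equiv_cubic_def using assms(1)
    by (intro exI[of _ "mat (1 / a)"] exI[of _ "(1 / a)^2"]) (simp add: mat_mult_vec Q0_scale)
qed

text \<open>An eigenvector, with eigenvalue -mu, of the derivation induced by
  \<open>skew p q r\<close> on trace-free cubics.\<close>

definition isotropic_cubic :: "complex \<Rightarrow> complex \<Rightarrow> complex \<Rightarrow> (complex^3 \<Rightarrow> complex) \<Rightarrow> bool" where
  "isotropic_cubic p q r C \<longleftrightarrow> (\<exists>a1 a2 a3 a4 a5 a6 a7 mu. C = tf_cubic a1 a2 a3 a4 a5 a6 a7 \<and>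
     (\<forall>u. dtf_cubic a1 a2 a3 a4 a5 a6 a7 u (skew p q r *v u) + mu * tf_cubic a1 a2 a3 a4 a5 a6 a7 u = 0))"

text \<open>The third hypothesis says that R conjugates one skew element into the other. Uniqueness
  of the derivative identifies \<open>dtf_cubic\<close> of the new coefficients with the chain rule,
  and mu is unchanged.\<close>

lemma isotropic_cubic_transform:
  assumes iso: "isotropic_cubic p q r C"
    and C': "(\<lambda>u. C (R *v u)) = tf_cubic a1 a2 a3 a4 a5 a6 a7"
    and R: "\<And>u. skew p q r *v (R *v u) = R *v (skew p' q' r' *v u)"
  shows "isotropic_cubic p' q' r' (\<lambda>u. C (R *v u))"
proof -
  obtain b1 b2 b3 b4 b5 b6 b7 mu where C: "C = tf_cubic b1 b2 b3 b4 b5 b6 b7"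
    and eq: "\<And>u. dtf_cubic b1 b2 b3 b4 b5 b6 b7 u (skew p q r *v u) + mu * C u = 0"
    using iso unfolding isotropic_cubic_def by blast
  have "dtf_cubic a1 a2 a3 a4 a5 a6 a7 u w = dtf_cubic b1 b2 b3 b4 b5 b6 b7 (R *v u) (R *v w)" for u w
  proof -
    have "((*v) R has_derivative (*v) R) (at u)"
      by (rule bounded_linear_imp_has_derivative[OF bounded_linear_matrix])
    from has_derivative_compose[OF this tf_cubic_has_derivative]
    have "((\<lambda>u. C (R *v u)) has_derivative (\<lambda>w. dtf_cubic b1 b2 b3 b4 b5 b6 b7 (R *v u) (R *v w))) (at u)"
      unfolding C .
    from has_derivative_unique[OF tf_cubic_has_derivative this[unfolded C']] show ?thesis by (rule fun_cong)
  qed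
  then have "dtf_cubic a1 a2 a3 a4 a5 a6 a7 u (skew p' q' r' *v u) + mu * tf_cubic a1 a2 a3 a4 a5 a6 a7 u = 0" for u
    using eq[of "R *v u"] unfolding C'[symmetric] R by simp
  then show ?thesis unfolding isotropic_cubic_def using C' by blast
qed

lemma isotropic_cubic_swap:
  assumes "isotropic_cubic p q r C"
  shows "isotropic_cubic (- p) r q (\<lambda>u. C (swap3 *v u))"
proof -
  obtain a1 a2 a3 a4 a5 a6 a7 where C: "C = tf_cubic a1 a2 a3 a4 a5 a6 a7"
    using assms unfolding isotropic_cubic_def by blast
  show ?thesis
  proof (rule isotropic_cubic_transform[OF assms])
    show "(\<lambda>u. C (swap3 *v u)) = tf_cubic a7 a6 a5 a4 a3 a2 a1"
      by (rule ext) (simp add: C tf_cubic_def cubic_def swap3_mult algebra_simps)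
    show "skew p q r *v (swap3 *v u) = swap3 *v (skew (- p) r q *v u)" for u
      by (simp add: swap3_mult skew_mult vec3_eq)
  qed
qed

text \<open>Under conjugation by the shear the entry r becomes a quadratic polynomial in s, whose
  roots serve to eliminate it. The new cubic coefficients are the expansion of C(shear u).\<close>

lemma isotropic_cubic_shear:
  assumes "isotropic_cubic p q r C"
  shows "isotropic_cubic (p + q * s) q (r + p * s + q * s^2 / 2) (\<lambda>u. C (shear3 s *v u))"
proof -
  obtain a1 a2 a3 a4 a5 a6 a7 where C: "C = tf_cubic a1 a2 a3 a4 a5 a6 a7"
    using assms unfolding isotropic_cubic_def by blast
  show ?thesis
  proof (rule isotropic_cubic_transform[OF assms])
    show "(\<lambda>u. C (shear3 s *v u)) = tf_cubic (a1 + a2 * s - (5/2) * a3 * s^2 - (5/2) * a4 * s^3 + (5/4) * a5 * s^4 + (1/4) * a6 * s^5 - (1/8) * a7 * s^6) (a2 - 5 * a3 * s - (15/2) * a4 * s^2 + 5 * a5 * s^3 + (5/4) * a6 * s^4 - (3/4) * a7 * s^5) (a3 + 3 * a4 * s - 3 * a5 * s^2 - a6 * s^3 + (3/4) * a7 * s^4) (a4 - 2 * a5 * s - a6 * s^2 + a7 * s^3) (a5 + a6 * s - (3/2) * a7 * s^2) (a6 - 3 * a7 * s) (a7)"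
      by (rule ext) (simp add: C tf_cubic_def cubic_def shear3_mult field_simps power2_eq_square power3_eq_cube
        power4_eq_xxxx power_numeral_reduce)
    show "skew p q r *v (shear3 s *v u) = shear3 s *v (skew (p + q * s) q (r + p * s + q * s^2 / 2) *v u)" for u
      by (simp add: shear3_mult skew_mult vec3_eq field_simps power2_eq_square power3_eq_cube)
  qed
qed

lemma isotropic_cubic_coeffs:
  assumes "isotropic_cubic p q r C"
  obtains a1 a2 a3 a4 a5 a6 a7 mu where "C = tf_cubic a1 a2 a3 a4 a5 a6 a7"
    "a1 * mu + 3 * a1 * p - a2 * r = 0"
    "-a6 * q + a7 * mu - 3 * a7 * p = 0"
    "-2 * a3 * q - a4 * mu - 2 * a5 * r = 0"
    "-a2 * q + a3 * mu + a3 * p - 3 * a4 * r = 0"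
    "3 * a1 * q + a2 * mu + 2 * a2 * p + 5 * a3 * r = 0"
    "-3 * a4 * q + a5 * mu - a5 * p - a6 * r = 0"
    "5 * a5 * q + a6 * mu - 2 * a6 * p + 3 * a7 * r = 0"
    "2 * a2 * q - 2 * a3 * mu - 2 * a3 * p + 6 * a4 * r = 0"
    "6 * a4 * q - 2 * a5 * mu + 2 * a5 * p + 2 * a6 * r = 0"
    "6 * a3 * q + 3 * a4 * mu + 6 * a5 * r = 0"
proof -
  obtain a1 a2 a3 a4 a5 a6 a7 mu where C: "C = tf_cubic a1 a2 a3 a4 a5 a6 a7"
    and eq: "\<And>u. dtf_cubic a1 a2 a3 a4 a5 a6 a7 u (skew p q r *v u) + mu * tf_cubic a1 a2 a3 a4 a5 a6 a7 u = 0"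
    using assms unfolding isotropic_cubic_def by blast
  have "(a1 * mu + 3 * a1 * p - a2 * r) * x^3
    + (-a6 * q + a7 * mu - 3 * a7 * p) * y^3
    + (-2 * a3 * q - a4 * mu - 2 * a5 * r) * z^3
    + (-a2 * q + a3 * mu + a3 * p - 3 * a4 * r) * (x^2 * y)
    + (3 * a1 * q + a2 * mu + 2 * a2 * p + 5 * a3 * r) * (x^2 * z)
    + (-3 * a4 * q + a5 * mu - a5 * p - a6 * r) * (x * y^2)
    + (5 * a5 * q + a6 * mu - 2 * a6 * p + 3 * a7 * r) * (y^2 * z)
    + (2 * a2 * q - 2 * a3 * mu - 2 * a3 * p + 6 * a4 * r) * (x * z^2)
    + (6 * a4 * q - 2 * a5 * mu + 2 * a5 * p + 2 * a6 * r) * (y * z^2)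
    + (6 * a3 * q + 3 * a4 * mu + 6 * a5 * r) * (x * y * z) = 0" for x y z
    using eq[of "vec3 x y z"] unfolding tf_cubic_def dtf_cubic_def cubic_def dcubic_def skew_mult
    by (simp add: algebra_simps power2_eq_square power3_eq_cube)
  from cubic_form_coeffs[OF this] show thesis
    by (elim conjE) (rule that[OF C])
qed

section \<open>Reduction of isotropic cubics to the four forms\<close>

definition normal_form_cubic :: "(complex^3 \<Rightarrow> complex) \<Rightarrow> bool" where
  "normal_form_cubic C \<longleftrightarrow> equiv_cubic C cI3 \<or> equiv_cubic C cI2 \<or> equiv_cubic C cI1 \<or> equiv_cubic C cI0"

lemma normal_form_cubic_equiv: "equiv_cubic C C' \<Longrightarrow> normal_form_cubic C' \<Longrightarrow> normal_form_cubic C"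
  unfolding normal_form_cubic_def using equiv_cubic_trans by blast

text \<open>Weight vectors of nonnegative weight are multiples of the four forms, and the swap
  reverses the sign of the weight.\<close>

lemma normal_form_cubic_monomials:
  assumes "a \<noteq> 0"
  shows "normal_form_cubic (tf_cubic a 0 0 0 0 0 0)" "normal_form_cubic (tf_cubic 0 a 0 0 0 0 0)"
    "normal_form_cubic (tf_cubic 0 0 a 0 0 0 0)" "normal_form_cubic (tf_cubic 0 0 0 a 0 0 0)"
    "normal_form_cubic (tf_cubic 0 0 0 0 a 0 0)" "normal_form_cubic (tf_cubic 0 0 0 0 0 a 0)"
    "normal_form_cubic (tf_cubic 0 0 0 0 0 0 a)"
proof -
  have "equiv_cubic (tf_cubic a 0 0 0 0 0 0) cI3" "equiv_cubic (tf_cubic 0 a 0 0 0 0 0) cI2"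
    "equiv_cubic (tf_cubic 0 0 a 0 0 0 0) cI1" "equiv_cubic (tf_cubic 0 0 0 a 0 0 0) cI0"
    by (rule equiv_cubic_scale[OF assms]; simp add: tf_cubic_def cubic_def cI3_def cI2_def cI1_def cI0_def
        power_mult_distrib algebra_simps power2_eq_square power3_eq_cube)+
  then show 1: "normal_form_cubic (tf_cubic a 0 0 0 0 0 0)" "normal_form_cubic (tf_cubic 0 a 0 0 0 0 0)"
    "normal_form_cubic (tf_cubic 0 0 a 0 0 0 0)" "normal_form_cubic (tf_cubic 0 0 0 a 0 0 0)"
    unfolding normal_form_cubic_def by blast+
  have "(\<lambda>u. tf_cubic 0 0 0 0 a 0 0 (swap3 *v u)) = tf_cubic 0 0 a 0 0 0 0"
    "(\<lambda>u. tf_cubic 0 0 0 0 0 a 0 (swap3 *v u)) = tf_cubic 0 a 0 0 0 0 0"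
    "(\<lambda>u. tf_cubic 0 0 0 0 0 0 a (swap3 *v u)) = tf_cubic a 0 0 0 0 0 0"
    by (rule ext; simp add: tf_cubic_def cubic_def swap3_mult algebra_simps)+
  then show "normal_form_cubic (tf_cubic 0 0 0 0 a 0 0)" "normal_form_cubic (tf_cubic 0 0 0 0 0 a 0)"
    "normal_form_cubic (tf_cubic 0 0 0 0 0 0 a)"
    using 1 normal_form_cubic_equiv[OF equiv_cubic_swap] by metis+
qed

text \<open>For p \<noteq> 0 the seven weights 3p, ..., -3p are distinct, so an eigenvector has
  exactly one nonzero coefficient.\<close>

lemma normal_form_diagonal:
  assumes iso: "isotropic_cubic p 0 0 C" and p: "p \<noteq> 0" and C0: "C \<noteq> (\<lambda>_. 0)"
  shows "normal_form_cubic C"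
proof -
  obtain a1 a2 a3 a4 a5 a6 a7 mu where C: "C = tf_cubic a1 a2 a3 a4 a5 a6 a7"
    and k: "a1 * (mu + 3 * p) = 0" "a2 * (mu + 2 * p) = 0" "a3 * (mu + p) = 0" "a4 * mu = 0"
      "a5 * (mu - p) = 0" "a6 * (mu - 2 * p) = 0" "a7 * (mu - 3 * p) = 0"
  proof (rule isotropic_cubic_coeffs[OF iso])
    fix a1 a2 a3 a4 a5 a6 a7 mu
    assume C: "C = tf_cubic a1 a2 a3 a4 a5 a6 a7" and K:
      "a1 * mu + 3 * a1 * p - a2 * 0 = 0"
      "-a6 * 0 + a7 * mu - 3 * a7 * p = 0"
      "-2 * a3 * 0 - a4 * mu - 2 * a5 * 0 = 0"
      "-a2 * 0 + a3 * mu + a3 * p - 3 * a4 * 0 = 0"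
      "3 * a1 * 0 + a2 * mu + 2 * a2 * p + 5 * a3 * 0 = 0"
      "-3 * a4 * 0 + a5 * mu - a5 * p - a6 * 0 = 0"
      "5 * a5 * 0 + a6 * mu - 2 * a6 * p + 3 * a7 * 0 = 0"
      "2 * a2 * 0 - 2 * a3 * mu - 2 * a3 * p + 6 * a4 * 0 = 0"
      "6 * a4 * 0 - 2 * a5 * mu + 2 * a5 * p + 2 * a6 * 0 = 0"
      "6 * a3 * 0 + 3 * a4 * mu + 6 * a5 * 0 = 0"
    show thesis
    proof (rule that[OF C])
      show "a1 * (mu + 3 * p) = 0" "a2 * (mu + 2 * p) = 0" "a3 * (mu + p) = 0" "a4 * mu = 0"
        "a5 * (mu - p) = 0" "a6 * (mu - 2 * p) = 0" "a7 * (mu - 3 * p) = 0"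
        using K by algebra+
    qed
  qed
  have ne: "a1 \<noteq> 0 \<or> a2 \<noteq> 0 \<or> a3 \<noteq> 0 \<or> a4 \<noteq> 0 \<or> a5 \<noteq> 0 \<or> a6 \<noteq> 0 \<or> a7 \<noteq> 0"
  proof (rule ccontr)
    assume "\<not> ?thesis"
    then have "C = (\<lambda>_. 0)" by (simp add: C tf_cubic_def cubic_def fun_eq_iff)
    then show False using C0 by simp
  qed
  have excl: "a = 0 \<or> b = 0" if "a * (mu + i * p) = 0" "b * (mu + j * p) = 0" "i \<noteq> j" for a b i j
  proof (rule ccontr)
    assume "\<not> (a = 0 \<or> b = 0)"
    then have "mu + i * p = 0" "mu + j * p = 0" using that by simp_all
    then have "(i - j) * p = 0" by algebra
    then show False using p that(3) by simp
  qed
  have e: "a1 * (mu + 3 * p) = 0" "a2 * (mu + 2 * p) = 0" "a3 * (mu + 1 * p) = 0" "a4 * (mu + 0 * p) = 0"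
      "a5 * (mu + (- 1) * p) = 0" "a6 * (mu + (- 2) * p) = 0" "a7 * (mu + (- 3) * p) = 0"
    using k by simp_all
  have x: "a1 = 0 \<or> a2 = 0"
    "a1 = 0 \<or> a3 = 0"
    "a1 = 0 \<or> a4 = 0"
    "a1 = 0 \<or> a5 = 0"
    "a1 = 0 \<or> a6 = 0"
    "a1 = 0 \<or> a7 = 0"
    "a2 = 0 \<or> a3 = 0"
    "a2 = 0 \<or> a4 = 0"
    "a2 = 0 \<or> a5 = 0"
    "a2 = 0 \<or> a6 = 0"
    "a2 = 0 \<or> a7 = 0"
    "a3 = 0 \<or> a4 = 0"
    "a3 = 0 \<or> a5 = 0"
    "a3 = 0 \<or> a6 = 0"
    "a3 = 0 \<or> a7 = 0"
    "a4 = 0 \<or> a5 = 0"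
    "a4 = 0 \<or> a6 = 0"
    "a4 = 0 \<or> a7 = 0"
    "a5 = 0 \<or> a6 = 0"
    "a5 = 0 \<or> a7 = 0"
    "a6 = 0 \<or> a7 = 0"
    using excl[OF e(1) e(2)] excl[OF e(1) e(3)] excl[OF e(1) e(4)] excl[OF e(1) e(5)] excl[OF e(1) e(6)] excl[OF e(1) e(7)] excl[OF e(2) e(3)] excl[OF e(2) e(4)] excl[OF e(2) e(5)] excl[OF e(2) e(6)] excl[OF e(2) e(7)] excl[OF e(3) e(4)] excl[OF e(3) e(5)] excl[OF e(3) e(6)] excl[OF e(3) e(7)] excl[OF e(4) e(5)] excl[OF e(4) e(6)] excl[OF e(4) e(7)] excl[OF e(5) e(6)] excl[OF e(5) e(7)] excl[OF e(6) e(7)] by simp_all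

  from ne show ?thesis
  proof (elim disjE)
    assume n: "a1 \<noteq> 0"
    then have z: "a2 = 0" "a3 = 0" "a4 = 0" "a5 = 0" "a6 = 0" "a7 = 0" using x by simp_all
    show ?thesis unfolding C z by (rule normal_form_cubic_monomials(1)[OF n])
  next
    assume n: "a2 \<noteq> 0"
    then have z: "a1 = 0" "a3 = 0" "a4 = 0" "a5 = 0" "a6 = 0" "a7 = 0" using x by simp_all
    show ?thesis unfolding C z by (rule normal_form_cubic_monomials(2)[OF n])
  next
    assume n: "a3 \<noteq> 0"
    then have z: "a1 = 0" "a2 = 0" "a4 = 0" "a5 = 0" "a6 = 0" "a7 = 0" using x by simp_all
    show ?thesis unfolding C z by (rule normal_form_cubic_monomials(3)[OF n])
  next
    assume n: "a4 \<noteq> 0"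
    then have z: "a1 = 0" "a2 = 0" "a3 = 0" "a5 = 0" "a6 = 0" "a7 = 0" using x by simp_all
    show ?thesis unfolding C z by (rule normal_form_cubic_monomials(4)[OF n])
  next
    assume n: "a5 \<noteq> 0"
    then have z: "a1 = 0" "a2 = 0" "a3 = 0" "a4 = 0" "a6 = 0" "a7 = 0" using x by simp_all
    show ?thesis unfolding C z by (rule normal_form_cubic_monomials(5)[OF n])
  next
    assume n: "a6 \<noteq> 0"
    then have z: "a1 = 0" "a2 = 0" "a3 = 0" "a4 = 0" "a5 = 0" "a7 = 0" using x by simp_all
    show ?thesis unfolding C z by (rule normal_form_cubic_monomials(6)[OF n])
  next
    assume n: "a7 \<noteq> 0"
    then have z: "a1 = 0" "a2 = 0" "a3 = 0" "a4 = 0" "a5 = 0" "a6 = 0" using x by simp_all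
    show ?thesis unfolding C z by (rule normal_form_cubic_monomials(7)[OF n])
  qed
qed

text \<open>The equations form a single chain from a7 down to a1. If mu \<noteq> 0 it kills every
  coefficient in turn; if mu = 0 it leaves only a1, the multiple of x^3.\<close>

lemma normal_form_nilpotent:
  assumes iso: "isotropic_cubic 0 0 r C" and r: "r \<noteq> 0" and C0: "C \<noteq> (\<lambda>_. 0)"
  shows "normal_form_cubic C"
proof -
  obtain a1 a2 a3 a4 a5 a6 a7 mu where C: "C = tf_cubic a1 a2 a3 a4 a5 a6 a7"
    and k: "a1 * mu = a2 * r" "a7 * mu = 0" "a4 * mu = - 2 * a5 * r" "a3 * mu = 3 * a4 * r" "a2 * mu = - 5 * a3 * r"
      "a5 * mu = a6 * r" "a6 * mu = - 3 * a7 * r"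
  proof (rule isotropic_cubic_coeffs[OF iso])
    fix a1 a2 a3 a4 a5 a6 a7 mu
    assume C: "C = tf_cubic a1 a2 a3 a4 a5 a6 a7" and K:
      "a1 * mu + 3 * a1 * 0 - a2 * r = 0"
      "-a6 * 0 + a7 * mu - 3 * a7 * 0 = 0"
      "-2 * a3 * 0 - a4 * mu - 2 * a5 * r = 0"
      "-a2 * 0 + a3 * mu + a3 * 0 - 3 * a4 * r = 0"
      "3 * a1 * 0 + a2 * mu + 2 * a2 * 0 + 5 * a3 * r = 0"
      "-3 * a4 * 0 + a5 * mu - a5 * 0 - a6 * r = 0"
      "5 * a5 * 0 + a6 * mu - 2 * a6 * 0 + 3 * a7 * r = 0"
      "2 * a2 * 0 - 2 * a3 * mu - 2 * a3 * 0 + 6 * a4 * r = 0"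
      "6 * a4 * 0 - 2 * a5 * mu + 2 * a5 * 0 + 2 * a6 * r = 0"
      "6 * a3 * 0 + 3 * a4 * mu + 6 * a5 * r = 0"
    show thesis
    proof (rule that[OF C])
      show "a1 * mu = a2 * r" "a7 * mu = 0" "a4 * mu = - 2 * a5 * r" "a3 * mu = 3 * a4 * r" "a2 * mu = - 5 * a3 * r"
        "a5 * mu = a6 * r" "a6 * mu = - 3 * a7 * r"
        using K by algebra+
    qed
  qed
  show ?thesis
  proof (cases "mu = 0")
    case True
    then have "a2 = 0" "a3 = 0" "a4 = 0" "a5 = 0" "a6 = 0" "a7 = 0" using k r by simp_all
    moreover from this have "a1 \<noteq> 0" using C0 by (auto simp: C tf_cubic_def cubic_def fun_eq_iff)
    ultimately show ?thesis using normal_form_cubic_monomials(1) by (simp add: C)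
  next
    case False
    have "a7 = 0" using k(2) False by simp
    then have "a6 = 0" using k(7) False by simp
    then have "a5 = 0" using k(6) False by simp
    then have "a4 = 0" using k(3) False by simp
    then have "a3 = 0" using k(4) False by simp
    then have "a2 = 0" using k(5) False by simp
    then have "a1 = 0" using k(1) False by simp
    then have "C = (\<lambda>_. 0)"
      using \<open>a2 = 0\<close> \<open>a3 = 0\<close> \<open>a4 = 0\<close> \<open>a5 = 0\<close> \<open>a6 = 0\<close> \<open>a7 = 0\<close>
      by (simp add: C tf_cubic_def cubic_def fun_eq_iff)
    then show ?thesis using C0 by simp
  qed
qed

lemma swap3_nonzero: "C \<noteq> (\<lambda>_. 0) \<Longrightarrow> (\<lambda>u. C (swap3 *v u)) \<noteq> (\<lambda>_. 0)"
proof
  assume C: "C \<noteq> (\<lambda>_. 0)" "(\<lambda>u. C (swap3 *v u)) = (\<lambda>_. 0)"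
  have "C u = 0" for u
  proof -
    have "swap3 *v (swap3 *v u) = u" by (simp add: swap3_mult vec3_eq)
    then show ?thesis using fun_cong[OF C(2), of "swap3 *v u"] by simp
  qed
  then show False using C(1) by blast
qed

lemma shear3_nonzero: "C \<noteq> (\<lambda>_. 0) \<Longrightarrow> (\<lambda>u. C (shear3 s *v u)) \<noteq> (\<lambda>_. 0)"
proof
  assume C: "C \<noteq> (\<lambda>_. 0)" "(\<lambda>u. C (shear3 s *v u)) = (\<lambda>_. 0)"
  have "C u = 0" for u
  proof -
    have "shear3 s *v (shear3 (- s) *v u) = u" by (simp add: shear3_mult vec3_eq algebra_simps power2_eq_square)
    then show ?thesis using fun_cong[OF C(2), of "shear3 (- s) *v u"] by simp
  qed
  then show False using C(1) by blast
qed

text \<open>For q = 0 and p \<noteq> 0 the shear with s = -r/p turns r into r + p s = 0; for p = 0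
  the element is already nilpotent.\<close>

lemma normal_form_triangular:
  assumes iso: "isotropic_cubic p 0 r C" and pr: "p \<noteq> 0 \<or> r \<noteq> 0" and C0: "C \<noteq> (\<lambda>_. 0)"
  shows "normal_form_cubic C"
proof (cases "p = 0")
  case True
  then show ?thesis using normal_form_nilpotent[of r C] iso pr C0 by simp
next
  case False
  have "isotropic_cubic p 0 0 (\<lambda>u. C (shear3 (- r / p) *v u))"
    using isotropic_cubic_shear[OF iso, of "- r / p"] False by simp
  then have "normal_form_cubic (\<lambda>u. C (shear3 (- r / p) *v u))"
    by (rule normal_form_diagonal[OF _ False shear3_nonzero[OF C0]])
  then show ?thesis by (rule normal_form_cubic_equiv[OF equiv_cubic_shear])
qed

lemma normal_form_isotropic:
  assumes iso: "isotropic_cubic p q r C" and pqr: "\<not> (p = 0 \<and> q = 0 \<and> r = 0)" and C0: "C \<noteq> (\<lambda>_. 0)"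
  shows "normal_form_cubic C"
proof (cases "q = 0")
  case True
  then show ?thesis using normal_form_triangular[of p r C] iso pqr C0 by auto
next
  case False
  \<comment> \<open>A root of r + p s + q s^2 / 2, so that the shear makes r vanish; the swap then
    exchanges q and r and produces the triangular case with r = q \<noteq> 0.\<close>
  define s where "s = (- p + csqrt (p^2 - 2 * q * r)) / q"
  have "(q * s + p)^2 = p^2 - 2 * q * r" using False by (simp add: s_def)
  then have "2 * q * (r + p * s + q * s^2 / 2) = 0" by (simp add: power2_eq_square algebra_simps)
  then have r0: "r + p * s + q * s^2 / 2 = 0" using False by simp
  define C' where "C' = (\<lambda>u. C (shear3 s *v u))"
  have "isotropic_cubic (p + q * s) q 0 C'"
    using isotropic_cubic_shear[OF iso, of s] unfolding r0 C'_def .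
  from isotropic_cubic_swap[OF this]
  have "normal_form_cubic (\<lambda>u. C' (swap3 *v u))"
    by (rule normal_form_triangular) (use False swap3_nonzero[OF shear3_nonzero[OF C0]] in \<open>simp_all add: C'_def\<close>)
  then have "normal_form_cubic C'" by (rule normal_form_cubic_equiv[OF equiv_cubic_swap])
  then show ?thesis unfolding C'_def by (rule normal_form_cubic_equiv[OF equiv_cubic_shear])
qed

lemma nf_chart_normal_form:
  assumes S: "hypersurface S" "homogeneous S" "has_isotropy S"
    and tf: "tracefree_cubic C" and nf: "nf_chart S L b U F C" and C0: "C \<noteq> (\<lambda>_. 0)"
  shows "\<exists>L' b' U' F'. nf_chart S L' b' U' F' cI3 \<or> nf_chart S L' b' U' F' cI2
    \<or> nf_chart S L' b' U' F' cI1 \<or> nf_chart S L' b' U' F' cI0"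
proof -
  obtain a1 a2 a3 a4 a5 a6 a7 where C: "C = tf_cubic a1 a2 a3 a4 a5 a6 a7"
    using tracefree_cubicE[OF tf] .
  obtain p q r mu where n: "\<not> (p = 0 \<and> q = 0 \<and> r = 0 \<and> mu = 0)"
    and eq: "\<And>u. dtf_cubic a1 a2 a3 a4 a5 a6 a7 u (skew p q r *v u) + mu * tf_cubic a1 a2 a3 a4 a5 a6 a7 u = 0"
    by (rule nf_chart_isotropy_skew[OF S nf[unfolded C]]) (rule that)
  \<comment> \<open>A pure dilation would have mu \<noteq> 0 and mu C = 0, which a nonzero C
    excludes.\<close>
  have "\<not> (p = 0 \<and> q = 0 \<and> r = 0)"
  proof
    assume 0: "p = 0 \<and> q = 0 \<and> r = 0"
    then have "skew p q r *v u = 0" for u by (simp add: skew_mult vec3_eq)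
    moreover have "dtf_cubic a1 a2 a3 a4 a5 a6 a7 u 0 = 0" for u by (simp add: dtf_cubic_def dcubic_def)
    ultimately have "mu * C u = 0" for u using eq[of u] by (simp add: C)
    then have "C = (\<lambda>_. 0)" using n 0 by auto
    then show False using C0 by simp
  qed
  moreover have "isotropic_cubic p q r C"
    unfolding isotropic_cubic_def using C eq by blast
  ultimately have "normal_form_cubic C" using normal_form_isotropic C0 by blast
  then show ?thesis
    unfolding normal_form_cubic_def using nf_chart_equiv_cubic[OF nf] by blast
qed

theorem theorem3:
  fixes S :: "(complex^4) set"
  assumes "S \<noteq> {}" and "hypersurface S" and "nondegenerate S"
    and "homogeneous S" and "has_isotropy S"
  shows "(\<exists>L b U F C. tracefree_cubic C \<and> nf_chart S L b U F C)
    \<and> (\<forall>L b U F C. tracefree_cubic C \<and> nf_chart S L b U F C \<and> C \<noteq> (\<lambda>_. 0) \<longrightarrow>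
         (\<exists>L' b' U' F'. nf_chart S L' b' U' F' cI3 \<or> nf_chart S L' b' U' F' cI2
                       \<or> nf_chart S L' b' U' F' cI1 \<or> nf_chart S L' b' U' F' cI0))
    \<and> residual Q0 cI3 = (\<lambda>L. (L, 0)) ` gen_grp (scalings 3 \<union> shearsI3)
    \<and> residual Q0 cI2 = (\<lambda>L. (L, 0)) ` gen_grp (scalings 2)
    \<and> residual Q0 cI1 = (\<lambda>L. (L, 0)) ` gen_grp (scalings 1)
    \<and> residual Q0 cI0 = (\<lambda>L. (L, 0)) ` gen_grp (scalings 0 \<union> {swapI0})"
  using nf_chart_exists[OF assms(1,3)] nf_chart_normal_form[OF assms(2,4,5)]
    residual_cI3 residual_cI2 residual_cI1 residual_cI0 by blast

end
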